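(* Let $G$ be a compact group, $K$ a closed subgroup, $\mathscr X=G/K$, $\tau$ an irreducible unitary representation of $K$ on a finite-dimensional complex Hilbert space $H$, and $\xi_\tau=(G\times_\tau H,\pi_\tau,\mathscr X)$ the associated homogeneous vector bundle. Let $T$ be a square integrable random section of $\xi_\tau$. Then $T$ is mean square continuous (i.e. its pullback random field on $G$ is mean square continuous) if and only if the associated scalar random field $T^{sc}$ is mean square continuous. Moreover, if $T$ is a.s. continuous, then $T$ is isotropic if and only if $T^{sc}$ is $G$-invariant.
   Context: $K$ acts on $G\times H$ by $k(g,z)=(gk,\tau(k^{-1})z)$; $\theta(g,z)$ is the orbit of $(g,z)$, $G\times_\tau H$ the quotient space, $\pi_\tau(\theta(g,z))=gK$. The fiber over $x=gK$ has inner product $\langle\theta(g,z),\theta(g,w)\rangle=\langle z,w\rangle_H$. $G$ acts on $G\times_\tau H$ by $h\theta(g,z)=\theta(hg,z)$, and on sections by $U_hu(x)=hu(h^{-1}x)$. $\mathscr X$ carries the $G$-invariant probability measure $dx$. A random section $T=(T_x)_{x\in\mathscr X}$ is a measurable family such that every path $x\mapsto T_x(\omega)$ is a section ($\pi_\tau(T_x)=x$). Its pullback is the unique random field $X=(X_g)_{g\in G}$ with values in $H$ such that $T_{gK}=\theta(g,X_g)$ for all $g$. $T$ is square integrable if $\int_{\mathscr X}\|T_x\|^2dx<\infty$ a.s., and a.s. continuous if its paths are a.s. continuous sections. $X$ is mean square continuous if $\lim_{h\to g}\mathbb E\|X_h-X_g\|_H^2=0$ for all $g$. With $T(u)=\int_{\mathscr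 X}\langle T_x,u(x)\rangle_{\pi_\tau^{-1}(x)}dx$, $T$ is isotropic if $(T(u_1),\dots,T(u_m))$ and $(T(U_gu_1),\dots,T(U_gu_m))$ have the same law for all $g\in G$, $m$, and square integrable sections $u_i$. The associated scalar random field is the complex-valued field on $G\times_\tau H$ given by $T^{sc}_\eta=\langle\eta,T_x\rangle_{\pi_\tau^{-1}(x)}$, $x=\pi_\tau(\eta)$. It is mean square continuous if the map $\eta\mapsto T^{sc}_\eta$ is continuous from $G\times_\tau H$ to $L^2(\mathbb P)$, and $G$-invariant if its finite-dimensional distributions are invariant under the action $\eta\mapsto h\eta$ of $G$ on $G\times_\tau H$.
   Formalization: Mean square continuity of the pullback field X also requires each X_g to be in L^2(P); otherwise, with K trivial and X_g = Z, E|Z|^2 infinite, X would be mean square continuous but T^sc not L^2-valued. The invariant measure dx is taken to be regular. *)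

theory Defs
  imports "HOL-Probability.Probability"
begin

text \<open>
  The (not necessarily commutative) topological group \<open>G\<close> is the universe of a type of class
  \<open>topological_group_add\<close>; the group operation is therefore written additively: \<open>g + k\<close> is the
  product \<open>gk\<close>, \<open>- g\<close> the inverse and \<open>0\<close> the identity.
\<close>

definition closed_subgroup :: "'g::topological_group_add set \<Rightarrow> bool" where
  "closed_subgroup K \<longleftrightarrow>
     0 \<in> K \<and> (\<forall>a\<in>K. \<forall>b\<in>K. a + b \<in> K) \<and> (\<forall>a\<in>K. - a \<in> K) \<and> closed K"

text \<open>
  A finite-dimensional complex Hilbert space: a Euclidean space with a complex scalar
  multiplication extending the real one and a Hermitian inner product (linear in the first
  argument) inducing the given norm.
\<close>

locale fd_complex_hilbert = vector_space scaleC
  for scaleC :: "complex \<Rightarrow> 'h::euclidean_space \<Rightarrow> 'h" +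
  fixes cinner :: "'h \<Rightarrow> 'h \<Rightarrow> complex"
  assumes scaleC_of_real: "scaleC (complex_of_real r) x = r *\<^sub>R x"
    and cinner_add_left: "cinner (x + y) z = cinner x z + cinner y z"
    and cinner_scaleC_left: "cinner (scaleC c x) z = c * cinner x z"
    and cinner_commute: "cinner x y = cnj (cinner y x)"
    and cinner_self: "cinner x x = complex_of_real ((norm x)\<^sup>2)"

locale unitary_rep = fd_complex_hilbert scaleC cinner
  for scaleC :: "complex \<Rightarrow> 'h::euclidean_space \<Rightarrow> 'h"
    and cinner :: "'h \<Rightarrow> 'h \<Rightarrow> complex" +
  fixes K :: "'g::topological_group_add set"
    and tau :: "'g \<Rightarrow> 'h \<Rightarrow> 'h"
  assumes K_subgroup: "closed_subgroup K"
    and tau_linear: "k \<in> K \<Longrightarrow> Vector_Spaces.linear scaleC scaleC (tau k)"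
    and tau_unitary: "k \<in> K \<Longrightarrow> cinner (tau k z) (tau k w) = cinner z w"
    and tau_zero: "tau 0 z = z"
    and tau_add: "k \<in> K \<Longrightarrow> l \<in> K \<Longrightarrow> tau (k + l) z = tau k (tau l z)"
    and tau_continuous: "continuous_on K (\<lambda>k. tau k z)"

text \<open>\<open>H \<noteq> {0}\<close> is automatic, as the types of class \<open>euclidean_space\<close> have positive dimension.\<close>

locale irreducible_unitary_rep = unitary_rep scaleC cinner K tau
  for scaleC :: "complex \<Rightarrow> 'h::euclidean_space \<Rightarrow> 'h"
    and cinner :: "'h \<Rightarrow> 'h \<Rightarrow> complex"
    and K :: "'g::topological_group_add set"
    and tau :: "'g \<Rightarrow> 'h \<Rightarrow> 'h" +
  assumes irreducible:
    "\<lbrakk>module.subspace scaleC W; \<And>k w. k \<in> K \<Longrightarrow> w \<in> W \<Longrightarrow> tau k w \<in> W\<rbrakk> \<Longrightarrow> W = {0} \<or> W = UNIV"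


section \<open>The homogeneous space and the homogeneous vector bundle\<close>

definition quotient_top :: "('a::topological_space \<Rightarrow> 'b) \<Rightarrow> 'b topology" where
  "quotient_top q = topology (\<lambda>U. U \<subseteq> range q \<and> open (q -` U))"

definition borel_sigma :: "'a topology \<Rightarrow> 'a measure" where
  "borel_sigma X = sigma (topspace X) {U. openin X U}"

definition coset :: "'g::topological_group_add set \<Rightarrow> 'g \<Rightarrow> 'g set" where
  "coset K g = (\<lambda>k. g + k) ` K"

definition hom_space :: "'g::topological_group_add set \<Rightarrow> 'g set topology" where
  "hom_space K = quotient_top (coset K)"

definition orbit :: "'g::topological_group_add set \<Rightarrow> ('g \<Rightarrow> 'h \<Rightarrow> 'h) \<Rightarrow> 'g \<Rightarrow> 'h \<Rightarrow> ('g \<times> 'h) set" where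
  "orbit K tau g z = (\<lambda>k. (g + k, tau (- k) z)) ` K"

definition total_space ::
  "'g::topological_group_add set \<Rightarrow> ('g \<Rightarrow> 'h::topological_space \<Rightarrow> 'h) \<Rightarrow> ('g \<times> 'h) set topology" where
  "total_space K tau = quotient_top (\<lambda>(g, z). orbit K tau g z)"

text \<open>
  An orbit \<open>\<theta>(g,z)\<close> is the set of its representatives, so its first projection is the coset \<open>gK\<close>.
\<close>

definition bundle_proj :: "('g \<times> 'h) set \<Rightarrow> 'g set" where
  "bundle_proj \<eta> = fst ` \<eta>"

definition fib_inner ::
  "('h \<Rightarrow> 'h \<Rightarrow> complex) \<Rightarrow> 'g::topological_group_add set \<Rightarrow> ('g \<Rightarrow> 'h \<Rightarrow> 'h)
     \<Rightarrow> ('g \<times> 'h) set \<Rightarrow> ('g \<times> 'h) set \<Rightarrow> complex" where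
  "fib_inner cinner K tau \<eta> \<zeta> =
     (THE c. \<exists>g z w. \<eta> = orbit K tau g z \<and> \<zeta> = orbit K tau g w \<and> c = cinner z w)"

definition fib_norm ::
  "('h \<Rightarrow> 'h \<Rightarrow> complex) \<Rightarrow> 'g::topological_group_add set \<Rightarrow> ('g \<Rightarrow> 'h \<Rightarrow> 'h)
     \<Rightarrow> ('g \<times> 'h) set \<Rightarrow> real" where
  "fib_norm cinner K tau \<eta> = sqrt (Re (fib_inner cinner K tau \<eta> \<eta>))"

definition act_space :: "'g::topological_group_add \<Rightarrow> 'g set \<Rightarrow> 'g set" where
  "act_space h x = (\<lambda>g. h + g) ` x"

definition act_bundle :: "'g::topological_group_add \<Rightarrow> ('g \<times> 'h) set \<Rightarrow> ('g \<times> 'h) set" where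
  "act_bundle h \<eta> = (\<lambda>(g, z). (h + g, z)) ` \<eta>"

definition act_section ::
  "'g::topological_group_add \<Rightarrow> ('g set \<Rightarrow> ('g \<times> 'h) set) \<Rightarrow> 'g set \<Rightarrow> ('g \<times> 'h) set" where
  "act_section h u x = act_bundle h (u (act_space (- h) x))"

text \<open>
  The \<open>G\<close>-invariant probability measure \<open>dx\<close> on \<open>G/K\<close>. Regularity is what makes it unique when
  \<open>G/K\<close> is not metrizable.
\<close>

definition invariant_probability :: "'g::topological_group_add set \<Rightarrow> 'g set measure \<Rightarrow> bool" where
  "invariant_probability K \<mu> \<longleftrightarrow>
     prob_space \<mu> \<and>
     space \<mu> = topspace (hom_space K) \<and>
     sets \<mu> = sets (borel_sigma (hom_space K)) \<and>
     (\<forall>h. distr \<mu> \<mu> (act_space h) = \<mu>) \<and>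
     (\<forall>A\<in>sets \<mu>. emeasure \<mu> A = (SUP C\<in>{C. compactin (hom_space K) C \<and> C \<subseteq> A}. emeasure \<mu> C))"

definition is_section ::
  "'g::topological_group_add set \<Rightarrow> ('g \<Rightarrow> 'h::topological_space \<Rightarrow> 'h)
     \<Rightarrow> ('g set \<Rightarrow> ('g \<times> 'h) set) \<Rightarrow> bool" where
  "is_section K tau u \<longleftrightarrow>
     (\<forall>x\<in>topspace (hom_space K). u x \<in> topspace (total_space K tau) \<and> bundle_proj (u x) = x)"

definition square_integrable_section ::
  "('h \<Rightarrow> 'h \<Rightarrow> complex) \<Rightarrow> 'g::topological_group_add set \<Rightarrow> ('g \<Rightarrow> 'h::topological_space \<Rightarrow> 'h)
     \<Rightarrow> 'g set measure \<Rightarrow> ('g set \<Rightarrow> ('g \<times> 'h) set) \<Rightarrow> bool" where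
  "square_integrable_section cinner K tau \<mu> u \<longleftrightarrow>
     is_section K tau u \<and>
     u \<in> borel_sigma (hom_space K) \<rightarrow>\<^sub>M borel_sigma (total_space K tau) \<and>
     integrable \<mu> (\<lambda>x. (fib_norm cinner K tau (u x))\<^sup>2)"


section \<open>Random fields\<close>

definition in_L2 :: "'w measure \<Rightarrow> ('w \<Rightarrow> 'e::euclidean_space) \<Rightarrow> bool" where
  "in_L2 P f \<longleftrightarrow> f \<in> borel_measurable P \<and> integrable P (\<lambda>\<omega>. (norm (f \<omega>))\<^sup>2)"

text \<open>
  Square integrability of the single variables is part of mean square continuity: the field is a
  continuous map from its index space to \<open>L\<^sup>2(P)\<close>. Without it the Bochner integral below would be
  the default value \<open>0\<close> for increments that are not square integrable.
\<close>

definition mean_square_continuous ::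
  "'i topology \<Rightarrow> 'w measure \<Rightarrow> ('i \<Rightarrow> 'w \<Rightarrow> 'e::euclidean_space) \<Rightarrow> bool" where
  "mean_square_continuous I P Y \<longleftrightarrow>
     (\<forall>a\<in>topspace I. in_L2 P (Y a)) \<and>
     (\<forall>a\<in>topspace I. ((\<lambda>b. \<integral>\<omega>. (norm (Y b \<omega> - Y a \<omega>))\<^sup>2 \<partial>P) \<longlongrightarrow> 0) (atin I a))"

definition joint_law :: "'w measure \<Rightarrow> nat \<Rightarrow> (nat \<Rightarrow> 'w \<Rightarrow> complex) \<Rightarrow> (nat \<Rightarrow> complex) measure" where
  "joint_law P m Z = distr P (\<Pi>\<^sub>M i\<in>{..<m}. borel) (\<lambda>\<omega>. \<lambda>i\<in>{..<m}. Z i \<omega>)"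

definition random_section ::
  "'g::topological_group_add set \<Rightarrow> ('g \<Rightarrow> 'h::topological_space \<Rightarrow> 'h) \<Rightarrow> 'w measure
     \<Rightarrow> ('g set \<Rightarrow> 'w \<Rightarrow> ('g \<times> 'h) set) \<Rightarrow> bool" where
  "random_section K tau P T \<longleftrightarrow>
     (\<lambda>(x, \<omega>). T x \<omega>) \<in> borel_sigma (hom_space K) \<Otimes>\<^sub>M P \<rightarrow>\<^sub>M borel_sigma (total_space K tau) \<and>
     (\<forall>\<omega>\<in>space P. is_section K tau (\<lambda>x. T x \<omega>))"

definition square_integrable_random ::
  "('h \<Rightarrow> 'h \<Rightarrow> complex) \<Rightarrow> 'g::topological_group_add set \<Rightarrow> ('g \<Rightarrow> 'h \<Rightarrow> 'h) \<Rightarrow> 'g set measure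
     \<Rightarrow> 'w measure \<Rightarrow> ('g set \<Rightarrow> 'w \<Rightarrow> ('g \<times> 'h) set) \<Rightarrow> bool" where
  "square_integrable_random cinner K tau \<mu> P T \<longleftrightarrow>
     (AE \<omega> in P. integrable \<mu> (\<lambda>x. (fib_norm cinner K tau (T x \<omega>))\<^sup>2))"

definition as_continuous ::
  "'g::topological_group_add set \<Rightarrow> ('g \<Rightarrow> 'h::topological_space \<Rightarrow> 'h) \<Rightarrow> 'w measure
     \<Rightarrow> ('g set \<Rightarrow> 'w \<Rightarrow> ('g \<times> 'h) set) \<Rightarrow> bool" where
  "as_continuous K tau P T \<longleftrightarrow>
     (AE \<omega> in P. continuous_map (hom_space K) (total_space K tau) (\<lambda>x. T x \<omega>))"

definition pullback ::
  "'g::topological_group_add set \<Rightarrow> ('g \<Rightarrow> 'h \<Rightarrow> 'h)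
     \<Rightarrow> ('g set \<Rightarrow> 'w \<Rightarrow> ('g \<times> 'h) set) \<Rightarrow> 'g \<Rightarrow> 'w \<Rightarrow> 'h" where
  "pullback K tau T g \<omega> = (THE z. T (coset K g) \<omega> = orbit K tau g z)"

definition section_pairing ::
  "('h \<Rightarrow> 'h \<Rightarrow> complex) \<Rightarrow> 'g::topological_group_add set \<Rightarrow> ('g \<Rightarrow> 'h \<Rightarrow> 'h) \<Rightarrow> 'g set measure
     \<Rightarrow> ('g set \<Rightarrow> 'w \<Rightarrow> ('g \<times> 'h) set) \<Rightarrow> ('g set \<Rightarrow> ('g \<times> 'h) set) \<Rightarrow> 'w \<Rightarrow> complex" where
  "section_pairing cinner K tau \<mu> T u \<omega> = (\<integral>x. fib_inner cinner K tau (T x \<omega>) (u x) \<partial>\<mu>)"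

definition isotropic ::
  "('h \<Rightarrow> 'h \<Rightarrow> complex) \<Rightarrow> 'g::topological_group_add set \<Rightarrow> ('g \<Rightarrow> 'h::topological_space \<Rightarrow> 'h)
     \<Rightarrow> 'g set measure \<Rightarrow> 'w measure \<Rightarrow> ('g set \<Rightarrow> 'w \<Rightarrow> ('g \<times> 'h) set) \<Rightarrow> bool" where
  "isotropic cinner K tau \<mu> P T \<longleftrightarrow>
     (\<forall>h m u. (\<forall>i<m. square_integrable_section cinner K tau \<mu> (u i)) \<longrightarrow>
        joint_law P m (\<lambda>i. section_pairing cinner K tau \<mu> T (u i)) =
        joint_law P m (\<lambda>i. section_pairing cinner K tau \<mu> T (act_section h (u i))))"

definition scalar_field ::
  "('h \<Rightarrow> 'h \<Rightarrow> complex) \<Rightarrow> 'g::topological_group_add set \<Rightarrow> ('g \<Rightarrow> 'h \<Rightarrow> 'h)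
     \<Rightarrow> ('g set \<Rightarrow> 'w \<Rightarrow> ('g \<times> 'h) set) \<Rightarrow> ('g \<times> 'h) set \<Rightarrow> 'w \<Rightarrow> complex" where
  "scalar_field cinner K tau T \<eta> \<omega> = fib_inner cinner K tau \<eta> (T (bundle_proj \<eta>) \<omega>)"

definition G_invariant ::
  "'g::topological_group_add set \<Rightarrow> ('g \<Rightarrow> 'h::topological_space \<Rightarrow> 'h) \<Rightarrow> 'w measure
     \<Rightarrow> (('g \<times> 'h) set \<Rightarrow> 'w \<Rightarrow> complex) \<Rightarrow> bool" where
  "G_invariant K tau P Y \<longleftrightarrow>
     (\<forall>h m \<eta>. (\<forall>i<m. \<eta> i \<in> topspace (total_space K tau)) \<longrightarrow>
        joint_law P m (\<lambda>i. Y (\<eta> i)) = joint_law P m (\<lambda>i. Y (act_bundle h (\<eta> i))))"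


section \<open>The definitions are well posed\<close>

lemma openin_quotient_top: "openin (quotient_top q) U \<longleftrightarrow> U \<subseteq> range q \<and> open (q -` U)"
proof -
  have "istopology (\<lambda>U. U \<subseteq> range q \<and> open (q -` U))"
    unfolding istopology_def by (auto simp: vimage_Union)
  then show ?thesis
    unfolding quotient_top_def by simp
qed

lemma topspace_quotient_top [simp]: "topspace (quotient_top q) = range q"
proof -
  have "openin (quotient_top q) (range q)"
    by (simp add: openin_quotient_top vimage_def)
  then show ?thesis
    using openin_quotient_top[of q "topspace (quotient_top q)"] openin_subset by blast
qed

lemma quotient_map_quotient_top: "quotient_map euclidean (quotient_top q) q"
  by (auto simp: quotient_map_def openin_quotient_top vimage_def)

lemma act_space_coset: "act_space h (coset K g) = coset K (h + g)"
  by (auto simp: act_space_def coset_def image_image add.assoc)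

lemma act_bundle_orbit: "act_bundle h (orbit K tau g z) = orbit K tau (h + g) z"
  by (auto simp: act_bundle_def orbit_def image_image add.assoc)

lemma bundle_proj_orbit: "bundle_proj (orbit K tau g z) = coset K g"
  by (auto simp: bundle_proj_def orbit_def coset_def image_image)

context unitary_rep
begin

lemma K_zero: "0 \<in> K" and K_add: "a \<in> K \<Longrightarrow> b \<in> K \<Longrightarrow> a + b \<in> K" and K_minus: "a \<in> K \<Longrightarrow> - a \<in> K"
  using K_subgroup by (auto simp: closed_subgroup_def)

lemma orbit_eq_iff:
  "orbit K tau g z = orbit K tau h w \<longleftrightarrow> (\<exists>k\<in>K. h = g + k \<and> w = tau (- k) z)"
proof
  assume "orbit K tau g z = orbit K tau h w"
  moreover have "(h, w) \<in> orbit K tau h w"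
    unfolding orbit_def using K_zero tau_zero by (auto intro!: image_eqI[of _ _ 0])
  ultimately have "(h, w) \<in> orbit K tau g z" by simp
  then show "\<exists>k\<in>K. h = g + k \<and> w = tau (- k) z"
    by (auto simp: orbit_def)
next
  assume "\<exists>k\<in>K. h = g + k \<and> w = tau (- k) z"
  then obtain k where k: "k \<in> K" "h = g + k" "w = tau (- k) z" by blast
  have 1: "tau (- l) (tau (- k) z) = tau (- (k + l)) z" if "l \<in> K" for l
    using that k(1) K_minus tau_add[of "- l" "- k" z] by (simp add: minus_add)
  have "(\<lambda>l. (h + l, tau (- l) w)) ` K = (\<lambda>l. (g + l, tau (- l) z)) ` ((\<lambda>l. k + l) ` K)"
    unfolding k(2,3) image_image by (rule image_cong) (simp_all add: 1 add.assoc)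
  also have "(\<lambda>l. k + l) ` K = K"
  proof
    show "(\<lambda>l. k + l) ` K \<subseteq> K" using k(1) K_add by auto
    show "K \<subseteq> (\<lambda>l. k + l) ` K"
    proof
      fix x assume "x \<in> K"
      then have "- k + x \<in> K" "x = k + (- k + x)"
        using k(1) K_add K_minus by (auto simp: add.assoc[symmetric])
      then show "x \<in> (\<lambda>l. k + l) ` K" by blast
    qed
  qed
  finally show "orbit K tau g z = orbit K tau h w"
    by (simp add: orbit_def)
qed

lemma orbit_inj: "orbit K tau g z = orbit K tau g w \<longleftrightarrow> z = w"
proof
  assume "orbit K tau g z = orbit K tau g w"
  then obtain k where k: "g = g + k" "w = tau (- k) z"
    unfolding orbit_eq_iff by blast
  have "k = 0" using k(1) add_left_cancel[of g 0 k] by simp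
  then show "z = w" using k(2) tau_zero by simp
qed simp

lemma fib_inner_orbit: "fib_inner cinner K tau (orbit K tau g z) (orbit K tau g w) = cinner z w"
  unfolding fib_inner_def
proof (rule the_equality)
  show "\<exists>g' z' w'. orbit K tau g z = orbit K tau g' z' \<and> orbit K tau g w = orbit K tau g' w' \<and>
      cinner z w = cinner z' w'"
    by blast
next
  fix c
  assume "\<exists>g' z' w'. orbit K tau g z = orbit K tau g' z' \<and> orbit K tau g w = orbit K tau g' w' \<and>
      c = cinner z' w'"
  then show "c = cinner z w"
    by (auto simp: orbit_eq_iff tau_unitary K_minus)
qed

lemma fib_norm_orbit: "fib_norm cinner K tau (orbit K tau g z) = norm z"
  by (simp add: fib_norm_def fib_inner_orbit cinner_self)

lemma fibre_unique_rep:
  assumes "\<eta> \<in> topspace (total_space K tau)" and "bundle_proj \<eta> = coset K g"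
  shows "\<exists>!z. \<eta> = orbit K tau g z"
proof -
  obtain h w where eta: "\<eta> = orbit K tau h w"
    using assms(1) by (auto simp: total_space_def)
  then have "coset K h = coset K g"
    using assms(2) by (simp add: bundle_proj_orbit)
  moreover have "g \<in> coset K g"
    unfolding coset_def using K_zero by (auto intro!: image_eqI[of _ _ 0])
  ultimately obtain k where "k \<in> K" "g = h + k"
    by (auto simp: coset_def)
  then have "\<eta> = orbit K tau g (tau (- k) w)"
    unfolding eta orbit_eq_iff by blast
  then show ?thesis
    by (auto simp: orbit_inj)
qed

lemma pullback_eq:
  assumes "random_section K tau P T" and "\<omega> \<in> space P"
  shows "T (coset K g) \<omega> = orbit K tau g (pullback K tau T g \<omega>)"
proof -
  have "T (coset K g) \<omega> \<in> topspace (total_space K tau)" "bundle_proj (T (coset K g) \<omega>) = coset K g"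
    using assms by (auto simp: random_section_def is_section_def hom_space_def)
  then show ?thesis
    unfolding pullback_def by (rule theI'[OF fibre_unique_rep])
qed

end

end

theory Submission
  imports Defs
begin

text \<open>
  With \<open>X\<close> the pullback field, \<open>T\<^sup>s\<^sup>c\<close> at \<open>\<theta>(g,z)\<close> is \<open>\<langle>z, X\<^sub>g\<rangle>\<close>; as the orbit map is open, mean square
  continuity passes between \<open>X\<close> and \<open>T\<^sup>s\<^sup>c\<close>. For the second part, laws are compared through
  characteristic functions. If \<open>T\<^sup>s\<^sup>c\<close> is \<open>G\<close>-invariant, the characteristic function of a pairing
  \<open>\<integral>f dx\<close> is the limit of the expectations of \<open>(\<integral>exp(if/n) dx)^n\<close>, and these only involve
  finite-dimensional distributions of \<open>T\<^sup>s\<^sup>c\<close>. Conversely, \<open>T\<^sup>s\<^sup>c\<close> is an almost sure limit of pairings of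
  \<open>T\<close> with continuous sections restricted to shrinking open sets. As \<open>G\<close> is not assumed to be
  metrizable, two points need care: the joint measurability of the pairing of two sections, which
  rests on a countable pointwise dense family of continuous sections, and the choice of a
  \<^emph>\<open>sequence\<close> of open sets.
\<close>

section \<open>Laws and characteristic functions\<close>

text \<open>Invariance of the scalar field says nothing directly about an integral over the base.
  The power of the integral of \<open>exp (i f / n)\<close> replaces the integral of
  \<open>f\<close> by the mean of \<open>f\<close> at n independent points of the base, and such
  means are governed by finite-dimensional laws. In the converse direction the test sections are
  deterministic, so the shrinking open sets have to serve all continuous paths at once. Moreover
  isotropy compares a section only with its own translate, so one sequence of open sets has to work
  both at a point and at its translate; the limit is therefore taken for a pair-valued field.
  Characteristic functions suit both directions: a linear combination of pairings is again a single
  integral, and the normalizing factors of the averages are absorbed by the coefficients.\<close>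

lemma weighted_law_unique:
  fixes Y Y' w w' :: "'w \<Rightarrow> real"
  assumes P: "prob_space P"
    and [measurable]: "w \<in> borel_measurable P" "w' \<in> borel_measurable P"
      "Y \<in> borel_measurable P" "Y' \<in> borel_measurable P" "A \<in> sets borel"
    and w: "\<And>\<omega>. 1 \<le> w \<omega>" "\<And>\<omega>. w \<omega> \<le> 3" "\<And>\<omega>. 1 \<le> w' \<omega>" "\<And>\<omega>. w' \<omega> \<le> 3"
    and eq: "\<And>t. (LINT \<omega>|P. w \<omega> *\<^sub>R iexp (t * Y \<omega>)) = (LINT \<omega>|P. w' \<omega> *\<^sub>R iexp (t * Y' \<omega>))"
  shows "(LINT \<omega>|P. w \<omega> * indicator A (Y \<omega>)) = (LINT \<omega>|P. w' \<omega> * indicator A (Y' \<omega>))"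
proof -
  interpret prob_space P by fact
  \<comment> \<open>At t = 0 the hypothesis says that both weights have the same mass
    \<open>c\<close>. Divided by \<open>c\<close> they are probability densities, and Levy
    uniqueness applies to the laws of \<open>Y\<close> and \<open>Y'\<close> under them. The lower
    bound 1 keeps \<open>c\<close> away from 0, the upper bound 3 gives integrability.\<close>
  define c where "c = (LINT \<omega>|P. w \<omega>)"
  have bound: "integrable P v"
    if vm: "v \<in> borel_measurable P" and v1: "\<And>\<omega>. 1 \<le> v \<omega>" and v3: "\<And>\<omega>. v \<omega> \<le> 3" for v :: "'w \<Rightarrow> real"
  proof (rule integrable_const_bound[where B=3])
    have "norm (v \<omega>) \<le> 3" for \<omega>
      using v1[of \<omega>] v3[of \<omega>] by simp
    then show "AE \<omega> in P. norm (v \<omega>) \<le> 3" by (rule AE_I2)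
  qed (rule vm)
  have intw: "integrable P w"
    by (rule bound) (rule w assms(2))+
  have intw': "integrable P w'"
    by (rule bound) (rule w assms(3))+
  have "complex_of_real c = complex_of_real (LINT \<omega>|P. w' \<omega>)"
    using eq[of 0] by (simp add: c_def scaleR_conv_of_real)
  then have c': "(LINT \<omega>|P. w' \<omega>) = c"
    by simp
  have "(LINT \<omega>|P. 1) \<le> c"
    unfolding c_def by (rule integral_mono) (use w(1) intw in auto)
  then have c1: "c \<ge> 1" by (simp add: prob_space)
  have dist: "real_distribution (distr (density P (\<lambda>\<omega>. ennreal (v \<omega> / c))) borel Z)"
    and chr: "char (distr (density P (\<lambda>\<omega>. ennreal (v \<omega> / c))) borel Z) t
          = (LINT \<omega>|P. v \<omega> *\<^sub>R iexp (t * Z \<omega>)) /\<^sub>R c"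
    and ind: "c * measure (distr (density P (\<lambda>\<omega>. ennreal (v \<omega> / c))) borel Z) A
          = (LINT \<omega>|P. v \<omega> * indicator A (Z \<omega>))"
    if [measurable]: "v \<in> borel_measurable P" "Z \<in> borel_measurable P"
      and v: "\<And>\<omega>. 1 \<le> v \<omega>" "(LINT \<omega>|P. v \<omega>) = c" "integrable P v" for v Z :: "'w \<Rightarrow> real" and t
  proof -
    have v0: "0 \<le> v \<omega>" for \<omega> using v(1)[of \<omega>] by linarith
    have "(\<integral>\<^sup>+ \<omega>. ennreal (v \<omega> / c) \<partial>P) = ennreal (LINT \<omega>|P. v \<omega> / c)"
      by (rule nn_integral_eq_integral) (use v v0 c1 in auto)
    also have "\<dots> = 1" using v c1 by simp
    finally have "emeasure (density P (\<lambda>\<omega>. ennreal (v \<omega> / c))) (space P) = 1"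
      by (subst emeasure_density) (auto cong: nn_integral_cong)
    then interpret D: prob_space "density P (\<lambda>\<omega>. ennreal (v \<omega> / c))"
      by (intro prob_spaceI) simp
    interpret D': prob_space "distr (density P (\<lambda>\<omega>. ennreal (v \<omega> / c))) borel Z"
      by (rule D.prob_space_distr) simp
    show "real_distribution (distr (density P (\<lambda>\<omega>. ennreal (v \<omega> / c))) borel Z)"
      by unfold_locales auto
    have I: "(LINT x|distr (density P (\<lambda>\<omega>. ennreal (v \<omega> / c))) borel Z. f x) = (LINT \<omega>|P. v \<omega> *\<^sub>R f (Z \<omega>)) /\<^sub>R c"
      if [measurable]: "f \<in> borel_measurable borel" for f :: "real \<Rightarrow> 'b::{banach,second_countable_topology}"
    proof -
      have "(LINT x|distr (density P (\<lambda>\<omega>. ennreal (v \<omega> / c))) borel Z. f x)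
         = (LINT \<omega>|P. (v \<omega> / c) *\<^sub>R f (Z \<omega>))"
        by (subst integral_distr, simp, simp, subst integral_density) (use v0 c1 in \<open>auto\<close>)
      also have "\<dots> = (LINT \<omega>|P. inverse c *\<^sub>R (v \<omega> *\<^sub>R f (Z \<omega>)))"
        by (simp add: divide_inverse mult.commute)
      also have "\<dots> = (LINT \<omega>|P. v \<omega> *\<^sub>R f (Z \<omega>)) /\<^sub>R c"
        by (rule integral_scaleR_right)
      finally show ?thesis .
    qed
    show "char (distr (density P (\<lambda>\<omega>. ennreal (v \<omega> / c))) borel Z) t
          = (LINT \<omega>|P. v \<omega> *\<^sub>R iexp (t * Z \<omega>)) /\<^sub>R c"
      unfolding char_def by (rule I) simp
    have "measure (distr (density P (\<lambda>\<omega>. ennreal (v \<omega> / c))) borel Z) A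
       = (LINT x|distr (density P (\<lambda>\<omega>. ennreal (v \<omega> / c))) borel Z. indicator A x)"
      by simp
    also have "\<dots> = (LINT \<omega>|P. v \<omega> *\<^sub>R indicator A (Z \<omega>)) /\<^sub>R c"
      by (rule I) simp
    finally show "c * measure (distr (density P (\<lambda>\<omega>. ennreal (v \<omega> / c))) borel Z) A
          = (LINT \<omega>|P. v \<omega> * indicator A (Z \<omega>))"
      using c1 by simp
  qed
  note w_c = assms(2,4) w(1) c_def[symmetric] intw and w'_c = assms(3,5) w(3) c' intw'
  have "char (distr (density P (\<lambda>\<omega>. ennreal (w \<omega> / c))) borel Y)
      = char (distr (density P (\<lambda>\<omega>. ennreal (w' \<omega> / c))) borel Y')"
    by (rule ext) (simp only: chr[OF w_c] chr[OF w'_c] eq)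
  then have "distr (density P (\<lambda>\<omega>. ennreal (w \<omega> / c))) borel Y
      = distr (density P (\<lambda>\<omega>. ennreal (w' \<omega> / c))) borel Y'"
    by (rule Levy_uniqueness[OF dist[OF w_c] dist[OF w'_c]])
  then show ?thesis
    using ind[OF w_c] ind[OF w'_c] by simp
qed

text \<open>Levy uniqueness needs positive weights. The weight is split into real and imaginary
  part, and each part \<open>V\<close> is raised to \<open>2 + V\<close>, with values between 1 and
  3; \<open>eq1\<close> accounts for the added constant.\<close>

lemma complex_weighted_law_unique:
  fixes Y Y' :: "'w \<Rightarrow> real" and W W' :: "'w \<Rightarrow> complex"
  assumes P: "prob_space P"
    and [measurable]: "W \<in> borel_measurable P" "W' \<in> borel_measurable P"
      "Y \<in> borel_measurable P" "Y' \<in> borel_measurable P" "A \<in> sets borel"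
    and W: "\<And>\<omega>. norm (W \<omega>) \<le> 1" "\<And>\<omega>. norm (W' \<omega>) \<le> 1"
    and eq1: "\<And>t. (LINT \<omega>|P. iexp (t * Y \<omega>)) = (LINT \<omega>|P. iexp (t * Y' \<omega>))"
    and eq: "\<And>t. (LINT \<omega>|P. W \<omega> * iexp (t * Y \<omega>)) = (LINT \<omega>|P. W' \<omega> * iexp (t * Y' \<omega>))"
  shows "(LINT \<omega>|P. W \<omega> * indicator A (Y \<omega>)) = (LINT \<omega>|P. W' \<omega> * indicator A (Y' \<omega>))"
proof -
  interpret prob_space P by fact
  have bnd: "integrable P f" if "f \<in> borel_measurable P" "\<And>\<omega>. norm (f \<omega>) \<le> 1"
    for f :: "'w \<Rightarrow> 'b::{banach,second_countable_topology}"
    by (rule integrable_const_bound[where B=1]) (use that in auto)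
  \<comment> \<open>Conjugating the hypothesis at \<open>- t\<close> replaces \<open>W\<close> by
    \<open>cnj (W \<omega>)\<close> and restores the exponential; half sums and differences then
    isolate \<open>Re\<close> and \<open>Im\<close>.\<close>
  have eqc: "(LINT \<omega>|P. cnj (W \<omega>) * iexp (t * Y \<omega>)) = (LINT \<omega>|P. cnj (W' \<omega>) * iexp (t * Y' \<omega>))" for t
  proof -
    have *: "cnj (W \<omega>) * iexp (t * Y \<omega>) = cnj (W \<omega> * iexp (- t * Y \<omega>))"
      "cnj (W' \<omega>) * iexp (t * Y' \<omega>) = cnj (W' \<omega> * iexp (- t * Y' \<omega>))" for \<omega>
      by (simp_all add: exp_cnj)
    show ?thesis
      unfolding * using arg_cong[OF eq[of "- t"], of cnj] by (simp only: Bochner_Integration.integral_cnj)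
  qed
  have R: "complex_of_real (Re z) = (z + cnj z) / 2" "complex_of_real (Im z) = (z - cnj z) / (2 * \<i>)" for z
    by (auto simp: complex_eq_iff Re_divide Im_divide power2_eq_square)
  have RI: "(LINT \<omega>|P. Re (U \<omega>) *\<^sub>R iexp (t * Z \<omega>)) =
        ((LINT \<omega>|P. U \<omega> * iexp (t * Z \<omega>)) + (LINT \<omega>|P. cnj (U \<omega>) * iexp (t * Z \<omega>))) / 2"
      "(LINT \<omega>|P. Im (U \<omega>) *\<^sub>R iexp (t * Z \<omega>)) =
        ((LINT \<omega>|P. U \<omega> * iexp (t * Z \<omega>)) - (LINT \<omega>|P. cnj (U \<omega>) * iexp (t * Z \<omega>))) / (2 * \<i>)"
    if [measurable]: "U \<in> borel_measurable P" "Z \<in> borel_measurable P" and U: "\<And>\<omega>. norm (U \<omega>) \<le> 1"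
    for U :: "'w \<Rightarrow> complex" and Z :: "'w \<Rightarrow> real" and t
  proof -
    have [measurable]: "cnj \<in> borel_measurable borel"
      by (intro borel_measurable_continuous_onI continuous_intros)
    have i: "integrable P (\<lambda>\<omega>. U \<omega> * iexp (t * Z \<omega>))" "integrable P (\<lambda>\<omega>. cnj (U \<omega>) * iexp (t * Z \<omega>))"
      by (rule bnd, measurable, simp only: norm_mult norm_exp_i_times complex_mod_cnj U mult_1_right)+
    show "(LINT \<omega>|P. Re (U \<omega>) *\<^sub>R iexp (t * Z \<omega>)) =
        ((LINT \<omega>|P. U \<omega> * iexp (t * Z \<omega>)) + (LINT \<omega>|P. cnj (U \<omega>) * iexp (t * Z \<omega>))) / 2"
      unfolding Bochner_Integration.integral_add[OF i, symmetric] integral_divide_zero[symmetric]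
      by (rule Bochner_Integration.integral_cong) (simp_all only: scaleR_conv_of_real R times_divide_eq_left distrib_right)
    show "(LINT \<omega>|P. Im (U \<omega>) *\<^sub>R iexp (t * Z \<omega>)) =
        ((LINT \<omega>|P. U \<omega> * iexp (t * Z \<omega>)) - (LINT \<omega>|P. cnj (U \<omega>) * iexp (t * Z \<omega>))) / (2 * \<i>)"
      unfolding Bochner_Integration.integral_diff[OF i, symmetric] integral_divide_zero[symmetric]
      by (rule Bochner_Integration.integral_cong) (simp_all only: scaleR_conv_of_real R times_divide_eq_left left_diff_distrib)
  qed
  have eqR: "(LINT \<omega>|P. Re (W \<omega>) *\<^sub>R iexp (t * Y \<omega>)) = (LINT \<omega>|P. Re (W' \<omega>) *\<^sub>R iexp (t * Y' \<omega>))"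
    and eqI: "(LINT \<omega>|P. Im (W \<omega>) *\<^sub>R iexp (t * Y \<omega>)) = (LINT \<omega>|P. Im (W' \<omega>) *\<^sub>R iexp (t * Y' \<omega>))" for t
    using W by (simp_all only: RI assms(2-5) eq eqc)
  have one: "(LINT \<omega>|P. 1 * indicator A (Y \<omega>)) = (LINT \<omega>|P. (1::real) * indicator A (Y' \<omega>))"
    by (rule weighted_law_unique[OF P]) (use eq1 in simp_all)
  have real_case: "(LINT \<omega>|P. V \<omega> * indicator A (Y \<omega>)) = (LINT \<omega>|P. V' \<omega> * indicator A (Y' \<omega>))"
    if [measurable]: "V \<in> borel_measurable P" "V' \<in> borel_measurable P"
      and V: "\<And>\<omega>. \<bar>V \<omega>\<bar> \<le> 1" "\<And>\<omega>. \<bar>V' \<omega>\<bar> \<le> 1"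
      and eqV: "\<And>t. (LINT \<omega>|P. V \<omega> *\<^sub>R iexp (t * Y \<omega>)) = (LINT \<omega>|P. V' \<omega> *\<^sub>R iexp (t * Y' \<omega>))"
    for V V' :: "'w \<Rightarrow> real"
  proof -
    have "integrable P V" "integrable P V'"
      by (rule bnd; use V in simp)+
    have b: "1 \<le> 2 + V \<omega>" "2 + V \<omega> \<le> 3" "1 \<le> 2 + V' \<omega>" "2 + V' \<omega> \<le> 3" for \<omega>
      using V(1)[of \<omega>] V(2)[of \<omega>] by linarith+
    have i: "integrable P (\<lambda>\<omega>. v \<omega> *\<^sub>R iexp (t * Z \<omega>))"
      if "v \<in> borel_measurable P" "Z \<in> borel_measurable P" "\<And>\<omega>. \<bar>v \<omega>\<bar> \<le> 1" for v Z :: "'w \<Rightarrow> real" and t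
      by (rule bnd) (use that in auto)
    have i': "integrable P (\<lambda>\<omega>. v \<omega> * indicator A (Z \<omega>))"
      if "v \<in> borel_measurable P" "Z \<in> borel_measurable P" "\<And>\<omega>. \<bar>v \<omega>\<bar> \<le> 1" for v Z :: "'w \<Rightarrow> real"
      by (rule bnd) (use that in \<open>auto simp: indicator_def\<close>)
    have "(LINT \<omega>|P. (2 + V \<omega>) * indicator A (Y \<omega>)) = (LINT \<omega>|P. (2 + V' \<omega>) * indicator A (Y' \<omega>))"
    proof (rule weighted_law_unique[OF P])
      fix t
      have "(LINT \<omega>|P. (2 + v \<omega>) *\<^sub>R iexp (t * Z \<omega>))
          = 2 *\<^sub>R (LINT \<omega>|P. iexp (t * Z \<omega>)) + (LINT \<omega>|P. v \<omega> *\<^sub>R iexp (t * Z \<omega>))"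
        if "v \<in> borel_measurable P" "Z \<in> borel_measurable P" "\<And>\<omega>. \<bar>v \<omega>\<bar> \<le> 1" for v Z :: "'w \<Rightarrow> real"
        unfolding scaleR_add_left
        by (subst Bochner_Integration.integral_add)
          (use i[of "\<lambda>_. 1" Z] i[OF that] that in simp_all)
      then show "(LINT \<omega>|P. (2 + V \<omega>) *\<^sub>R iexp (t * Y \<omega>)) = (LINT \<omega>|P. (2 + V' \<omega>) *\<^sub>R iexp (t * Y' \<omega>))"
        using V eqV eq1 by simp
    qed (use b in simp_all)
    moreover have "(LINT \<omega>|P. (2 + v \<omega>) * indicator A (Z \<omega>))
          = 2 * (LINT \<omega>|P. indicator A (Z \<omega>)) + (LINT \<omega>|P. v \<omega> * indicator A (Z \<omega>))"
        if "v \<in> borel_measurable P" "Z \<in> borel_measurable P" "\<And>\<omega>. \<bar>v \<omega>\<bar> \<le> 1" for v Z :: "'w \<Rightarrow> real"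
        unfolding distrib_right
        by (subst Bochner_Integration.integral_add)
          (use i'[of "\<lambda>_. 1" Z] i'[OF that] that in simp_all)
    ultimately show ?thesis
      using V one by simp
  qed
  have "(LINT \<omega>|P. U \<omega> * indicator A (Z \<omega>)) =
      complex_of_real (LINT \<omega>|P. Re (U \<omega>) * indicator A (Z \<omega>)) +
      \<i> * complex_of_real (LINT \<omega>|P. Im (U \<omega>) * indicator A (Z \<omega>))"
    if [measurable]: "U \<in> borel_measurable P" "Z \<in> borel_measurable P" and U: "\<And>\<omega>. norm (U \<omega>) \<le> 1"
    for U :: "'w \<Rightarrow> complex" and Z :: "'w \<Rightarrow> real"
  proof -
    have "integrable P (\<lambda>\<omega>. U \<omega> * indicator A (Z \<omega>))"
      by (rule bnd) (use U in \<open>auto simp: indicator_def\<close>)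
    then show ?thesis
      by (simp add: complex_eq_iff indicator_def flip: integral_Re integral_Im)
        (auto intro!: Bochner_Integration.integral_cong)
  qed
  moreover have "\<bar>Re (W \<omega>)\<bar> \<le> 1" "\<bar>Im (W \<omega>)\<bar> \<le> 1" "\<bar>Re (W' \<omega>)\<bar> \<le> 1" "\<bar>Im (W' \<omega>)\<bar> \<le> 1" for \<omega>
    using W[of \<omega>] abs_Re_le_cmod abs_Im_le_cmod order_trans by blast+
  ultimately show ?thesis
    using W real_case[of "\<lambda>\<omega>. Re (W \<omega>)" "\<lambda>\<omega>. Re (W' \<omega>)"] real_case[of "\<lambda>\<omega>. Im (W \<omega>)" "\<lambda>\<omega>. Im (W' \<omega>)"] eqR eqI
    by simp
qed

text \<open>Levy's theorem for random vectors, from the one-dimensional one: the coordinates not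
  being moved form a complex weight of modulus at most 1. Boxes suffice because they are stable
  under intersection and generate the product sigma-algebra.\<close>

lemma distr_PiM_eqI_char:
  fixes Z Z' :: "'i \<Rightarrow> 'w \<Rightarrow> real"
  assumes P: "prob_space P" and J: "finite J"
    and Z [measurable]: "\<And>j. j \<in> J \<Longrightarrow> Z j \<in> borel_measurable P" "\<And>j. j \<in> J \<Longrightarrow> Z' j \<in> borel_measurable P"
    and eq: "\<And>c. (LINT \<omega>|P. iexp (\<Sum>j\<in>J. c j * Z j \<omega>)) = (LINT \<omega>|P. iexp (\<Sum>j\<in>J. c j * Z' j \<omega>))"
  shows "distr P (\<Pi>\<^sub>M j\<in>J. borel) (\<lambda>\<omega>. \<lambda>j\<in>J. Z j \<omega>) = distr P (\<Pi>\<^sub>M j\<in>J. borel) (\<lambda>\<omega>. \<lambda>j\<in>J. Z' j \<omega>)"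
proof -
  interpret prob_space P by fact
  \<comment> \<open>One coordinate after the other is moved from the exponential to the indicators.\<close>
  have step: "(LINT \<omega>|P. (\<Prod>j\<in>S. indicator (A j) (Z j \<omega>)) * iexp (\<Sum>j\<in>J - S. c j * Z j \<omega>)) =
        (LINT \<omega>|P. (\<Prod>j\<in>S. indicator (A j) (Z' j \<omega>)) * iexp (\<Sum>j\<in>J - S. c j * Z' j \<omega>))"
    if "finite S" "S \<subseteq> J" and A: "\<And>j. j \<in> J \<Longrightarrow> A j \<in> sets borel" for S A c
    using that(1,2)
  proof (induction S arbitrary: c rule: finite_induct)
    case empty
    then show ?case using eq[of c] by simp
  next
    case (insert i S)
    then have i: "i \<in> J" "i \<notin> S" "S \<subseteq> J" and JS: "J - S = insert i (J - insert i S)" "finite (J - insert i S)"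
      using J by auto
    define W where "W Y \<omega> = (\<Prod>j\<in>S. indicator (A j) (Y j \<omega>)) * iexp (\<Sum>j\<in>J - insert i S. c j * Y j \<omega>)"
      for Y :: "'i \<Rightarrow> 'w \<Rightarrow> real" and \<omega>
    have Wm: "W Y \<in> borel_measurable P" if [measurable]: "\<And>j. j \<in> J \<Longrightarrow> Y j \<in> borel_measurable P" for Y
    proof -
      have [measurable]: "(\<lambda>\<omega>. \<Sum>j\<in>J - insert i S. c j * Y j \<omega>) \<in> borel_measurable P"
        by (rule borel_measurable_sum) measurable
      have [measurable]: "(\<lambda>\<omega>. \<Prod>j\<in>S. indicator (A j) (Y j \<omega>) :: complex) \<in> borel_measurable P"
      proof (rule borel_measurable_prod)
        fix j assume "j \<in> S"
        then have [measurable]: "A j \<in> sets borel" "Y j \<in> borel_measurable P" using A i(3) that by auto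
        show "(\<lambda>\<omega>. indicator (A j) (Y j \<omega>) :: complex) \<in> borel_measurable P" by measurable
      qed
      show ?thesis unfolding W_def by measurable
    qed
    have "norm (\<Prod>j\<in>S. indicator (A j) (Y j \<omega>) :: complex) \<le> 1" for Y :: "'i \<Rightarrow> 'w \<Rightarrow> real" and \<omega>
      unfolding prod_norm[symmetric] by (rule prod_le_1) (auto simp: indicator_def)
    then have Wn: "norm (W Y \<omega>) \<le> 1" for Y \<omega>
      by (simp add: W_def norm_mult)
    have Wexp: "W Y \<omega> * iexp (t * Y i \<omega>) =
        (\<Prod>j\<in>S. indicator (A j) (Y j \<omega>)) * iexp (\<Sum>j\<in>J - S. (c(i := t)) j * Y j \<omega>)" for Y \<omega> t
    proof -
      have "(\<Sum>j\<in>J - S. (c(i := t)) j * Y j \<omega>) = t * Y i \<omega> + (\<Sum>j\<in>J - insert i S. (c(i := t)) j * Y j \<omega>)"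
        unfolding JS(1) using JS(2) by (subst sum.insert) auto
      also have "(\<Sum>j\<in>J - insert i S. (c(i := t)) j * Y j \<omega>) = (\<Sum>j\<in>J - insert i S. c j * Y j \<omega>)"
        by (rule sum.cong) auto
      finally have e: "(\<Sum>j\<in>J - S. (c(i := t)) j * Y j \<omega>) = t * Y i \<omega> + (\<Sum>j\<in>J - insert i S. c j * Y j \<omega>)" .
      show ?thesis unfolding e
        by (simp add: W_def exp_add ring_distribs mult_ac)
    qed
    \<comment> \<open>Coefficients supported on \<open>i\<close> turn \<open>eq\<close> into the
      unweighted identity that the one-dimensional lemma also asks for.\<close>
    have sng: "(\<Sum>j\<in>J. ((\<lambda>_. 0)(i := t)) j * Y j \<omega>) = t * Y i \<omega>" for t :: real and Y :: "'i \<Rightarrow> 'w \<Rightarrow> real" and \<omega>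
      using i(1) J by (simp add: if_distrib[of "\<lambda>x. x * _"] sum.delta cong: if_cong)
    have "(LINT \<omega>|P. W Z \<omega> * indicator (A i) (Z i \<omega>)) = (LINT \<omega>|P. W Z' \<omega> * indicator (A i) (Z' i \<omega>))"
    proof (rule complex_weighted_law_unique[OF P])
      fix t
      show "(LINT \<omega>|P. iexp (t * Z i \<omega>)) = (LINT \<omega>|P. iexp (t * Z' i \<omega>))"
        using eq[of "(\<lambda>_. 0)(i := t)"] unfolding sng .
      show "(LINT \<omega>|P. W Z \<omega> * iexp (t * Z i \<omega>)) = (LINT \<omega>|P. W Z' \<omega> * iexp (t * Z' i \<omega>))"
        unfolding Wexp by (rule insert.IH[OF i(3)])
    qed (use i Z A Wm Wn in auto)
    moreover have "W Y \<omega> * indicator (A i) (Y i \<omega>) =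
      (\<Prod>j\<in>insert i S. indicator (A j) (Y j \<omega>)) * iexp (\<Sum>j\<in>J - insert i S. c j * Y j \<omega>)" for Y \<omega>
      using insert.hyps by (simp add: W_def)
    ultimately show ?case by simp
  qed
  have Zm: "(\<lambda>\<omega>. \<lambda>j\<in>J. Z j \<omega>) \<in> P \<rightarrow>\<^sub>M (\<Pi>\<^sub>M j\<in>J. borel)" "(\<lambda>\<omega>. \<lambda>j\<in>J. Z' j \<omega>) \<in> P \<rightarrow>\<^sub>M (\<Pi>\<^sub>M j\<in>J. borel)"
    by (rule measurable_restrict; use Z in auto)+
  \<comment> \<open>The exponential over the empty index set is 1; it is carried along so that the
    formula is the case \<open>S = J\<close> of \<open>step\<close>.\<close>
  have box: "measure (distr P (\<Pi>\<^sub>M j\<in>J. borel) (\<lambda>\<omega>. \<lambda>j\<in>J. Y j \<omega>)) (Pi\<^sub>E J A)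
      = Re (LINT \<omega>|P. (\<Prod>j\<in>J. indicator (A j) (Y j \<omega>)) * iexp (\<Sum>j\<in>J - J. 0 * Y j \<omega>))"
    if A: "\<And>j. j \<in> J \<Longrightarrow> A j \<in> sets borel"
      and Ym: "(\<lambda>\<omega>. \<lambda>j\<in>J. Y j \<omega>) \<in> P \<rightarrow>\<^sub>M (\<Pi>\<^sub>M j\<in>J. borel)" for A and Y :: "'i \<Rightarrow> 'w \<Rightarrow> real"
  proof -
    have AM: "Pi\<^sub>E J A \<in> sets (\<Pi>\<^sub>M j\<in>J. (borel :: real measure))"
      using J A by (intro sets_PiM_I_finite) auto
    define B where "B = (\<lambda>\<omega>. \<lambda>j\<in>J. Y j \<omega>) -` Pi\<^sub>E J A \<inter> space P"
    have B: "B \<in> events" unfolding B_def using Ym AM by (rule measurable_sets)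
    have "(LINT \<omega>|P. (\<Prod>j\<in>J. indicator (A j) (Y j \<omega>)) * iexp (\<Sum>j\<in>J - J. 0 * Y j \<omega>)) =
        (LINT \<omega>|P. complex_of_real (indicator B \<omega>))"
    proof (rule Bochner_Integration.integral_cong)
      fix \<omega> assume w: "\<omega> \<in> space P"
      have "(\<Prod>j\<in>J. indicator (A j) (Y j \<omega>) :: complex) = of_real (indicator B \<omega>)"
      proof (cases "\<omega> \<in> B")
        case True
        then have "\<And>j. j \<in> J \<Longrightarrow> Y j \<omega> \<in> A j" by (auto simp: B_def PiE_iff)
        then show ?thesis using True by simp
      next
        case False
        then obtain j where "j \<in> J" "Y j \<omega> \<notin> A j" using w by (auto simp: B_def PiE_iff)
        then show ?thesis using False J by (auto intro!: prod_zero bexI[of _ j])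
      qed
      then show "(\<Prod>j\<in>J. indicator (A j) (Y j \<omega>)) * iexp (\<Sum>j\<in>J - J. 0 * Y j \<omega>) = complex_of_real (indicator B \<omega>)"
        by simp
    qed simp
    also have "\<dots> = of_real (measure P B)"
      unfolding integral_complex_of_real using B by simp
    finally show ?thesis
      unfolding measure_distr[OF Ym AM] B_def[symmetric] by simp
  qed
  show ?thesis
  proof (rule measure_eqI_PiM_finite[OF J])
    fix A :: "'i \<Rightarrow> real set" assume A: "\<And>j. j \<in> J \<Longrightarrow> A j \<in> sets borel"
    interpret D: prob_space "distr P (\<Pi>\<^sub>M j\<in>J. borel) (\<lambda>\<omega>. \<lambda>j\<in>J. Z j \<omega>)"
      by (rule prob_space_distr[OF Zm(1)])
    interpret D': prob_space "distr P (\<Pi>\<^sub>M j\<in>J. borel) (\<lambda>\<omega>. \<lambda>j\<in>J. Z' j \<omega>)"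
      by (rule prob_space_distr[OF Zm(2)])
    show "emeasure (distr P (\<Pi>\<^sub>M j\<in>J. borel) (\<lambda>\<omega>. \<lambda>j\<in>J. Z j \<omega>)) (Pi\<^sub>E J A) =
        emeasure (distr P (\<Pi>\<^sub>M j\<in>J. borel) (\<lambda>\<omega>. \<lambda>j\<in>J. Z' j \<omega>)) (Pi\<^sub>E J A)"
    proof -
      have "measure (distr P (\<Pi>\<^sub>M j\<in>J. borel) (\<lambda>\<omega>. \<lambda>j\<in>J. Z j \<omega>)) (Pi\<^sub>E J A)
          = Re (LINT \<omega>|P. (\<Prod>j\<in>J. indicator (A j) (Z j \<omega>)) * iexp (\<Sum>j\<in>J - J. 0 * Z j \<omega>))"
        by (rule box[OF _ Zm(1)]) (rule A)
      also have "\<dots> = Re (LINT \<omega>|P. (\<Prod>j\<in>J. indicator (A j) (Z' j \<omega>)) * iexp (\<Sum>j\<in>J - J. 0 * Z' j \<omega>))"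
        by (rule arg_cong[where f = Re], rule step[OF J order_refl]) (rule A)
      also have "\<dots> = measure (distr P (\<Pi>\<^sub>M j\<in>J. borel) (\<lambda>\<omega>. \<lambda>j\<in>J. Z' j \<omega>)) (Pi\<^sub>E J A)"
        by (rule box[OF _ Zm(2), symmetric]) (rule A)
      finally show ?thesis
        by (simp only: D.emeasure_eq_measure D'.emeasure_eq_measure)
    qed
  next
    interpret D: prob_space "distr P (\<Pi>\<^sub>M j\<in>J. borel) (\<lambda>\<omega>. \<lambda>j\<in>J. Z j \<omega>)"
      by (rule prob_space_distr[OF Zm(1)])
    show "range (\<lambda>n::nat. space (\<Pi>\<^sub>M j\<in>J. (borel::real measure))) \<subseteq> prod_algebra J (\<lambda>_. borel)"
      using space_in_prod_algebra[of J "\<lambda>_. borel"] by (auto simp: space_PiM)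
    show "(\<Union>n::nat. space (\<Pi>\<^sub>M j\<in>J. (borel::real measure))) = space (\<Pi>\<^sub>M j\<in>J. (borel::real measure))"
      by simp
    show "emeasure (distr P (\<Pi>\<^sub>M j\<in>J. borel) (\<lambda>\<omega>. \<lambda>j\<in>J. Z j \<omega>)) (space (\<Pi>\<^sub>M j\<in>J. borel)) \<noteq> \<infinity>"
      using D.emeasure_finite by simp
  qed simp_all
qed

lemma joint_law_eq_iff_char:
  assumes P: "prob_space P"
    and Z: "\<And>i. i < m \<Longrightarrow> Z i \<in> borel_measurable P" "\<And>i. i < m \<Longrightarrow> Z' i \<in> borel_measurable P"
  shows "joint_law P m Z = joint_law P m Z' \<longleftrightarrow>
    (\<forall>c. (LINT \<omega>|P. iexp (Re (\<Sum>i<m. c i * Z i \<omega>))) = (LINT \<omega>|P. iexp (Re (\<Sum>i<m. c i * Z' i \<omega>))))"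
proof (intro iffI allI)
  fix c :: "nat \<Rightarrow> complex"
  assume eq: "joint_law P m Z = joint_law P m Z'"
  have "(LINT z|joint_law P m Y. iexp (Re (\<Sum>i<m. c i * z i))) = (LINT \<omega>|P. iexp (Re (\<Sum>i<m. c i * Y i \<omega>)))"
    if Y: "\<And>i. i < m \<Longrightarrow> Y i \<in> borel_measurable P" for Y
  proof -
    have "(\<lambda>\<omega>. \<lambda>i\<in>{..<m}. Y i \<omega>) \<in> P \<rightarrow>\<^sub>M (\<Pi>\<^sub>M i\<in>{..<m}. borel)"
      by (rule measurable_restrict) (use Y in auto)
    moreover have "(\<lambda>z. iexp (Re (\<Sum>i<m. c i * z i))) \<in> borel_measurable (\<Pi>\<^sub>M i\<in>{..<m}. borel)"
      by measurable
    ultimately show ?thesis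
      unfolding joint_law_def by (subst integral_distr) (auto intro!: Bochner_Integration.integral_cong)
  qed
  from this[of Z] this[of Z']
  show "(LINT \<omega>|P. iexp (Re (\<Sum>i<m. c i * Z i \<omega>))) = (LINT \<omega>|P. iexp (Re (\<Sum>i<m. c i * Z' i \<omega>)))"
    using Z by (simp only: eq)
next
  assume eq: "\<forall>c. (LINT \<omega>|P. iexp (Re (\<Sum>i<m. c i * Z i \<omega>))) = (LINT \<omega>|P. iexp (Re (\<Sum>i<m. c i * Z' i \<omega>)))"
  \<comment> \<open>A complex tuple is read as a real vector, with \<open>(i, True)\<close> for real
    and \<open>(i, False)\<close> for imaginary parts; \<open>\<phi>\<close> reassembles it, so
    equality of the real laws carries over.\<close>
  define J where "J = {..<m} \<times> (UNIV :: bool set)"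
  define R where "R Y p \<omega> = (if snd p then Re (Y (fst p) \<omega>) else Im (Y (fst p) \<omega>))"
    for Y :: "nat \<Rightarrow> 'a \<Rightarrow> complex" and p \<omega>
  define \<phi> where "\<phi> = (\<lambda>r :: nat \<times> bool \<Rightarrow> real. \<lambda>i\<in>{..<m}. Complex (r (i, True)) (r (i, False)))"
  have J: "finite J" by (simp add: J_def)
  have Rm: "R Y j \<in> borel_measurable P" if "j \<in> J" "\<And>i. i < m \<Longrightarrow> Y i \<in> borel_measurable P" for Y j
  proof -
    have "Y (fst j) \<in> borel_measurable P" using that by (auto simp: J_def)
    then show ?thesis by (cases "snd j") (auto simp: R_def[abs_def])
  qed
  \<comment> \<open>The sign comes from Re ((a - i b) (x + i y)) = a x + b y.\<close>
  have Rsum: "(\<Sum>j\<in>J. c j * R Y j \<omega>) =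
      Re (\<Sum>i<m. Complex (c (i, True)) (- c (i, False)) * Y i \<omega>)" for c Y \<omega>
  proof -
    have "(\<Sum>j\<in>J. c j * R Y j \<omega>) = (\<Sum>i<m. \<Sum>b\<in>UNIV. c (i, b) * R Y (i, b) \<omega>)"
      unfolding J_def sum.cartesian_product by (rule sum.cong) auto
    also have "\<dots> = (\<Sum>i<m. Re (Complex (c (i, True)) (- c (i, False)) * Y i \<omega>))"
      by (rule sum.cong) (simp_all add: UNIV_bool R_def)
    finally show ?thesis by (simp only: Re_sum)
  qed
  have RJ: "distr P (\<Pi>\<^sub>M j\<in>J. borel) (\<lambda>\<omega>. \<lambda>j\<in>J. R Z j \<omega>) = distr P (\<Pi>\<^sub>M j\<in>J. borel) (\<lambda>\<omega>. \<lambda>j\<in>J. R Z' j \<omega>)"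
  proof (rule distr_PiM_eqI_char[OF P J])
    show "(LINT \<omega>|P. iexp (\<Sum>j\<in>J. c j * R Z j \<omega>)) = (LINT \<omega>|P. iexp (\<Sum>j\<in>J. c j * R Z' j \<omega>))" for c
      unfolding Rsum using eq by (rule spec)
    show "R Z j \<in> borel_measurable P" "R Z' j \<in> borel_measurable P" if "j \<in> J" for j
      by (rule Rm[OF that], rule Z, assumption)+
  qed
  have \<phi>m: "\<phi> \<in> (\<Pi>\<^sub>M j\<in>J. borel) \<rightarrow>\<^sub>M (\<Pi>\<^sub>M i\<in>{..<m}. borel)"
    unfolding \<phi>_def
  proof (rule measurable_restrict)
    fix i assume "i \<in> {..<m}"
    then have [measurable]: "(\<lambda>r. r (i, b)) \<in> borel_measurable (\<Pi>\<^sub>M j\<in>J. (borel::real measure))" for b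
      by (intro measurable_component_singleton) (auto simp: J_def)
    show "(\<lambda>r. Complex (r (i, True)) (r (i, False))) \<in> borel_measurable (\<Pi>\<^sub>M j\<in>J. borel)"
      unfolding Complex_eq by measurable
  qed
  have "joint_law P m Y = distr (distr P (\<Pi>\<^sub>M j\<in>J. borel) (\<lambda>\<omega>. \<lambda>j\<in>J. R Y j \<omega>)) (\<Pi>\<^sub>M i\<in>{..<m}. borel) \<phi>"
    if "\<And>i. i < m \<Longrightarrow> Y i \<in> borel_measurable P" for Y
  proof -
    have "(\<lambda>\<omega>. \<lambda>j\<in>J. R Y j \<omega>) \<in> P \<rightarrow>\<^sub>M (\<Pi>\<^sub>M j\<in>J. borel)"
      by (rule measurable_restrict) (use Rm that in auto)
    moreover have "\<phi> (\<lambda>j\<in>J. R Y j \<omega>) = (\<lambda>i\<in>{..<m}. Y i \<omega>)" for \<omega>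
      by (auto simp: \<phi>_def J_def R_def)
    ultimately show ?thesis
      by (simp add: joint_law_def distr_distr[OF \<phi>m] o_def)
  qed
  then show "joint_law P m Z = joint_law P m Z'"
    using Z RJ by simp
qed

text \<open>The weak law of large numbers in Fourier form: the left side is the characteristic
  function, at 1, of the mean of n independent copies of \<open>f\<close>. As \<open>a n\<close> and
  \<open>b n\<close> have modulus at most 1, their n-th powers differ by at most n times
  \<open>norm (a n - b n)\<close>, and n (\<open>a n\<close> - 1) and n (\<open>b n\<close> - 1)
  have the same limit.\<close>

lemma power_char_limit:
  fixes f :: "'x \<Rightarrow> real"
  assumes M: "prob_space M" and f: "integrable M f"
  shows "(\<lambda>n. (LINT x|M. iexp (f x / real n)) ^ n) \<longlonglongrightarrow> iexp (LINT x|M. f x)"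
proof -
  interpret prob_space M by fact
  have [measurable]: "f \<in> borel_measurable M" using f by simp
  define a where "a n = (LINT x|M. iexp (f x / real n))" for n :: nat
  define b where "b n = iexp ((LINT x|M. f x) / real n)" for n :: nat
  have lim: "(\<lambda>n. real n *\<^sub>R (iexp (r / real n) - 1)) \<longlonglongrightarrow> \<i> * r" for r :: real
  proof (rule LIM_zero_cancel, rule Lim_null_comparison)
    show "\<forall>\<^sub>F n in sequentially. norm (real n *\<^sub>R (iexp (r / real n) - 1) - \<i> * r) \<le> r\<^sup>2 / real n"
      using eventually_gt_at_top[of 0]
    proof eventually_elim
      case (elim n)
      define x where "x = r / real n"
      have r: "r = real n * x" using elim by (simp add: x_def)
      have "norm (iexp x - (1 + \<i> * x)) \<le> x\<^sup>2 / 2"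
        using iexp_approx1[of x 1] by (simp add: numeral_2_eq_2)
      also have "\<dots> \<le> x\<^sup>2" by simp
      finally have "real n * norm (iexp x - (1 + \<i> * x)) \<le> real n * x\<^sup>2"
        by (rule mult_left_mono) simp
      also have "real n * norm (iexp x - (1 + \<i> * x)) = norm (real n *\<^sub>R (iexp x - (1 + \<i> * x)))"
        by simp
      also have "real n *\<^sub>R (iexp x - (1 + \<i> * x)) = real n *\<^sub>R (iexp x - 1) - \<i> * r"
        by (simp add: r scaleR_conv_of_real algebra_simps)
      also have "real n * x\<^sup>2 = r\<^sup>2 / real n"
        using elim by (simp add: x_def power2_eq_square)
      finally show ?case by (simp only: x_def)
    qed
    show "(\<lambda>n. r\<^sup>2 / real n) \<longlonglongrightarrow> 0" by (rule lim_const_over_n)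
  qed
  \<comment> \<open>The quadratic estimate above is used only pointwise; domination rests on this
    linear one, so integrability of \<open>f\<close> is enough.\<close>
  have bnd: "norm (real n *\<^sub>R (iexp (r / real n) - 1)) \<le> \<bar>r\<bar>" for r :: real and n :: nat
  proof (cases "n = 0")
    case False
    have "norm (iexp (r / real n) - 1) \<le> \<bar>r / real n\<bar>"
      using iexp_approx1[of "r / real n" 0] by simp
    then have "real n * norm (iexp (r / real n) - 1) \<le> real n * \<bar>r / real n\<bar>"
      by (rule mult_left_mono) simp
    then show ?thesis using False by (simp del: of_real_divide)
  qed simp
  have ib: "integrable M (\<lambda>x. iexp (f x / real n))" for n
    by (rule integrable_const_bound[where B = 1]) auto
  have "(\<lambda>n. LINT x|M. real n *\<^sub>R (iexp (f x / real n) - 1)) \<longlonglongrightarrow> (LINT x|M. \<i> * complex_of_real (f x))"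
  proof (rule integral_dominated_convergence[where w = "\<lambda>x. \<bar>f x\<bar>"])
    show "integrable M (\<lambda>x. \<bar>f x\<bar>)" using f by simp
    show "AE x in M. (\<lambda>n. real n *\<^sub>R (iexp (f x / real n) - 1)) \<longlonglongrightarrow> \<i> * complex_of_real (f x)"
      using lim by simp
    show "AE x in M. norm (real n *\<^sub>R (iexp (f x / real n) - 1)) \<le> \<bar>f x\<bar>" for n
      using bnd by (intro AE_I2)
  qed measurable
  also have "(\<lambda>n. LINT x|M. real n *\<^sub>R (iexp (f x / real n) - 1)) = (\<lambda>n. real n *\<^sub>R (a n - 1))"
    unfolding a_def using ib by (simp add: prob_space)
  also have "(LINT x|M. \<i> * complex_of_real (f x)) = \<i> * (LINT x|M. f x)"
    by simp
  finally have "(\<lambda>n. real n *\<^sub>R (a n - 1)) \<longlonglongrightarrow> \<i> * (LINT x|M. f x)" .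
  from tendsto_norm[OF tendsto_diff[OF this lim[of "LINT x|M. f x", folded b_def]]]
  have null: "(\<lambda>n. norm (real n *\<^sub>R (a n - 1) - real n *\<^sub>R (b n - 1))) \<longlonglongrightarrow> 0"
    by (simp only: diff_self norm_zero)
  have "norm (a n ^ n - b n ^ n) \<le> norm (real n *\<^sub>R (a n - 1) - real n *\<^sub>R (b n - 1))" for n
  proof -
    have "norm (a n) \<le> (LINT x|M. norm (iexp (f x / real n)))"
      unfolding a_def by (rule integral_norm_bound)
    then have "norm (a n) \<le> 1" by (simp add: prob_space)
    moreover have "norm (b n) \<le> 1" by (simp add: b_def)
    ultimately have "norm (a n ^ n - b n ^ n) \<le> real n * norm (a n - b n)"
      by (rule norm_power_diff)
    also have "\<dots> = norm (real n *\<^sub>R (a n - 1) - real n *\<^sub>R (b n - 1))"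
      by (simp add: scaleR_diff_right[symmetric])
    finally show ?thesis .
  qed
  then have "(\<lambda>n. a n ^ n - b n ^ n) \<longlonglongrightarrow> 0"
    by (intro Lim_null_comparison[OF _ null]) simp
  moreover have "eventually (\<lambda>n. b n ^ n = iexp (LINT x|M. f x)) sequentially"
    using eventually_gt_at_top[of 0] by eventually_elim (simp add: b_def exp_of_nat_mult[symmetric])
  ultimately have "(\<lambda>n. a n ^ n - iexp (LINT x|M. f x)) \<longlonglongrightarrow> 0"
    by (elim Lim_transform_eventually) (auto elim: eventually_mono)
  then show ?thesis
    unfolding a_def by (rule LIM_zero_cancel)
qed

text \<open>
  By Fubini, the expectation of \<open>(\<integral>exp(it R) dM)^n\<close> only involves the values of \<open>R\<close> at finite lists
  of points, so no law of large numbers on product spaces is needed.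
\<close>

lemma char_integral_eqI:
  fixes R R' :: "'x \<Rightarrow> 'w \<Rightarrow> real"
  assumes M: "prob_space M" and P: "prob_space P"
    and [measurable]: "(\<lambda>(x, \<omega>). R x \<omega>) \<in> borel_measurable (M \<Otimes>\<^sub>M P)"
      "(\<lambda>(x, \<omega>). R' x \<omega>) \<in> borel_measurable (M \<Otimes>\<^sub>M P)"
    and int: "AE \<omega> in P. integrable M (\<lambda>x. R x \<omega>)" "AE \<omega> in P. integrable M (\<lambda>x. R' x \<omega>)"
    and fdd: "\<And>t xs. set xs \<subseteq> space M \<Longrightarrow>
      (LINT \<omega>|P. iexp (t * (\<Sum>x\<leftarrow>xs. R x \<omega>))) = (LINT \<omega>|P. iexp (t * (\<Sum>x\<leftarrow>xs. R' x \<omega>)))"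
  shows "(LINT \<omega>|P. iexp (LINT x|M. R x \<omega>)) = (LINT \<omega>|P. iexp (LINT x|M. R' x \<omega>))"
proof -
  interpret M: prob_space M by fact
  interpret P: prob_space P by fact
  interpret MP: pair_prob_space M P ..
  define \<phi> where "\<phi> Q t \<omega> = (LINT x|M. iexp (t * Q x \<omega>))" for Q :: "'x \<Rightarrow> 'w \<Rightarrow> real" and t \<omega>
  have \<phi>m [measurable]: "\<phi> Q t \<in> borel_measurable P"
    if [measurable]: "(\<lambda>(x, \<omega>). Q x \<omega>) \<in> borel_measurable (M \<Otimes>\<^sub>M P)" for Q t
    unfolding \<phi>_def by measurable
  have \<phi>n: "norm (\<phi> Q t \<omega>) \<le> 1" for Q t \<omega>
  proof -
    have "norm (\<phi> Q t \<omega>) \<le> (LINT x|M. norm (iexp (t * Q x \<omega>)))"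
      unfolding \<phi>_def by (rule integral_norm_bound)
    then show ?thesis by (simp add: M.prob_space)
  qed
  \<comment> \<open>One factor of the power is an integral over a new point \<open>y\<close>; Fubini
    pulls it out and the list grows by \<open>y\<close>. Started from the empty list, this turns the
    n-th power into n integrals of expectations that \<open>fdd\<close> controls.\<close>
  have expand: "(LINT \<omega>|P. iexp (t * (\<Sum>x\<leftarrow>xs. Q x \<omega>)) * \<phi> Q t \<omega> ^ Suc n) =
      (LINT y|M. (LINT \<omega>|P. iexp (t * (\<Sum>x\<leftarrow>y # xs. Q x \<omega>)) * \<phi> Q t \<omega> ^ n))"
    if [measurable]: "(\<lambda>(x, \<omega>). Q x \<omega>) \<in> borel_measurable (M \<Otimes>\<^sub>M P)" and xs: "set xs \<subseteq> space M"
    for Q t n and xs :: "'x list"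
  proof -
    have Sm [measurable]: "(\<lambda>\<omega>. \<Sum>x\<leftarrow>xs. Q x \<omega>) \<in> borel_measurable P"
      using xs
    proof (induction xs)
      case (Cons a xs)
      then have [measurable]: "(\<lambda>\<omega>. Q a \<omega>) \<in> borel_measurable P" "(\<lambda>\<omega>. \<Sum>x\<leftarrow>xs. Q x \<omega>) \<in> borel_measurable P"
        by auto
      show ?case by simp
    qed simp
    define g where "g = (\<lambda>y \<omega>. iexp (t * (\<Sum>x\<leftarrow>y # xs. Q x \<omega>)) * \<phi> Q t \<omega> ^ n)"
    have gm: "case_prod g \<in> borel_measurable (M \<Otimes>\<^sub>M P)"
      unfolding g_def by simp
    have gn: "norm (g y \<omega>) \<le> 1" for y \<omega>
      using power_le_one[OF norm_ge_zero \<phi>n, of Q t \<omega> n]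
      by (simp add: g_def norm_mult norm_power del: of_real_add of_real_mult)
    have "integrable (M \<Otimes>\<^sub>M P) (case_prod g)"
      by (rule MP.integrable_const_bound[where B = 1]) (use gm gn in auto)
    then have "(LINT y|M. (LINT \<omega>|P. g y \<omega>)) = (LINT \<omega>|P. (LINT y|M. g y \<omega>))"
      by (rule MP.Fubini_integral[symmetric])
    also have "\<dots> = (LINT \<omega>|P. iexp (t * (\<Sum>x\<leftarrow>xs. Q x \<omega>)) * \<phi> Q t \<omega> ^ Suc n)"
    proof (rule Bochner_Integration.integral_cong)
      fix \<omega>
      have "g y \<omega> = iexp (t * (\<Sum>x\<leftarrow>xs. Q x \<omega>)) * \<phi> Q t \<omega> ^ n * iexp (t * Q y \<omega>)" for y
        by (simp add: g_def ring_distribs exp_add)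
      then show "(LINT y|M. g y \<omega>) = iexp (t * (\<Sum>x\<leftarrow>xs. Q x \<omega>)) * \<phi> Q t \<omega> ^ Suc n"
        by (simp add: \<phi>_def mult_ac)
    qed simp
    finally show ?thesis by (simp add: g_def)
  qed
  have eq: "(LINT \<omega>|P. iexp (t * (\<Sum>x\<leftarrow>xs. R x \<omega>)) * \<phi> R t \<omega> ^ n) =
      (LINT \<omega>|P. iexp (t * (\<Sum>x\<leftarrow>xs. R' x \<omega>)) * \<phi> R' t \<omega> ^ n)"
    if "set xs \<subseteq> space M" for t n xs
    using that
  proof (induction n arbitrary: xs)
    case 0
    then show ?case using fdd by simp
  next
    case (Suc n)
    show ?case
      by (subst (1 2) expand, (fact | rule Suc.prems)+, rule Bochner_Integration.integral_cong)
        (use Suc in \<open>auto simp del: sum_list.Cons list.map\<close>)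
  qed
  \<comment> \<open>\<open>power_char_limit\<close> is applied path by path, outside the null set
    where a path is not integrable; the modulus bound 1 dominates.\<close>
  have lim: "(\<lambda>n. LINT \<omega>|P. \<phi> Q (1 / real n) \<omega> ^ n) \<longlonglongrightarrow> (LINT \<omega>|P. iexp (LINT x|M. Q x \<omega>))"
    if [measurable]: "(\<lambda>(x, \<omega>). Q x \<omega>) \<in> borel_measurable (M \<Otimes>\<^sub>M P)"
      and "AE \<omega> in P. integrable M (\<lambda>x. Q x \<omega>)" for Q
  proof (rule integral_dominated_convergence[where w = "\<lambda>_. 1"])
    show "AE \<omega> in P. (\<lambda>n. \<phi> Q (1 / real n) \<omega> ^ n) \<longlonglongrightarrow> iexp (LINT x|M. Q x \<omega>)"
      using that(2) by eventually_elim (simp add: \<phi>_def power_char_limit[OF M, simplified])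
    show "AE \<omega> in P. norm (\<phi> Q (1 / real n) \<omega> ^ n) \<le> 1" for n
      using \<phi>n by (simp add: norm_power power_le_one)
  qed (use that(1) in measurable)
  show ?thesis
    using lim[OF assms(3) int(1)] lim[OF assms(4) int(2)] eq[of "[]"] LIMSEQ_unique by fastforce
qed

section \<open>Continuous sections of the bundle\<close>

context fd_complex_hilbert
begin

lemma cinner_add_right: "cinner x (y + z) = cinner x y + cinner x z"
  using cinner_commute[of x "y + z"] cinner_commute[of x y] cinner_commute[of x z]
  by (simp add: cinner_add_left)

lemma cinner_scaleC_right: "cinner x (scaleC c y) = cnj c * cinner x y"
  using cinner_commute[of x "scaleC c y"] cinner_commute[of x y] by (simp add: cinner_scaleC_left)

lemma cinner_minus_left: "cinner (- x) y = - cinner x y"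
  using cinner_scaleC_left[of "complex_of_real (-1)" x y] unfolding scaleC_of_real by simp

lemma cinner_diff_left: "cinner (x - y) z = cinner x z - cinner y z"
  using cinner_add_left[of x "- y" z] by (simp add: cinner_minus_left)

lemma cinner_diff_right: "cinner x (y - z) = cinner x y - cinner x z"
  using cinner_commute[of x "y - z"] cinner_commute[of x y] cinner_commute[of x z]
  by (simp add: cinner_diff_left)

lemma cinner_zero_left [simp]: "cinner 0 x = 0"
  using cinner_diff_left[of x x x] by simp

lemma cinner_zero_right [simp]: "cinner x 0 = 0"
  using cinner_diff_right[of x x x] by simp

text \<open>Two inner products with the same norm agree: compare the expansions of the squared norm
  of \<open>x + y\<close>. Convexity, projections and bases can then be taken from the Euclidean
  structure.\<close>

lemma Re_cinner: "Re (cinner x y) = x \<bullet> y"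
proof -
  have "complex_of_real ((norm (x + y))\<^sup>2) =
      complex_of_real ((norm x)\<^sup>2) + cinner x y + cnj (cinner x y) + complex_of_real ((norm y)\<^sup>2)"
    unfolding cinner_self[symmetric] cinner_commute[of y x, symmetric]
    by (simp add: cinner_add_left cinner_add_right)
  then have "(norm (x + y))\<^sup>2 = (norm x)\<^sup>2 + 2 * Re (cinner x y) + (norm y)\<^sup>2"
    unfolding complex_eq_iff by simp
  then show ?thesis
    by (simp add: power2_norm_eq_inner inner_add_left inner_add_right inner_commute)
qed

lemma Im_cinner: "Im (cinner x y) = x \<bullet> scaleC \<i> y"
  unfolding Re_cinner[symmetric] cinner_scaleC_right by simp

lemma norm_scaleC: "norm (scaleC c x) = norm c * norm x"
proof -
  have "complex_of_real ((norm (scaleC c x))\<^sup>2) = (c * cnj c) * complex_of_real ((norm x)\<^sup>2)"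
    unfolding cinner_self[symmetric] cinner_scaleC_left cinner_scaleC_right by (simp add: mult_ac)
  also have "\<dots> = complex_of_real ((norm c * norm x)\<^sup>2)"
    by (simp add: complex_norm_square[symmetric] power_mult_distrib)
  finally show ?thesis
    by (simp only: of_real_eq_iff) (simp add: power2_eq_iff_nonneg)
qed

lemma norm_cinner_le: "norm (cinner x y) \<le> norm x * norm y"
proof (cases "cinner x y = 0")
  case False
  \<comment> \<open>The phase that rotates \<open>cinner x y\<close> onto the positive real axis,
    which reduces the complex Cauchy-Schwarz inequality to the real one.\<close>
  define c where "c = cnj (cinner x y) / norm (cinner x y)"
  have "norm c = 1" using False by (simp add: c_def norm_divide)
  have "cinner (scaleC c x) y = complex_of_real (norm (cinner x y))"
    using False unfolding cinner_scaleC_left c_def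
    by (simp add: complex_norm_square[symmetric] mult.commute power2_eq_square)
  then have "norm (cinner x y) = scaleC c x \<bullet> y"
    unfolding Re_cinner[symmetric] by simp
  also have "\<dots> \<le> norm (scaleC c x) * norm y"
    by (rule norm_cauchy_schwarz)
  finally show ?thesis using \<open>norm c = 1\<close> by (simp add: norm_scaleC)
qed simp

lemma scaleC_scaleR: "scaleC c (r *\<^sub>R x) = r *\<^sub>R scaleC c x"
  unfolding scaleC_of_real[symmetric] scale_scale by (simp add: mult.commute)

lemma bounded_linear_scaleC: "bounded_linear (scaleC c)"
  by (rule bounded_linear_intro[where K = "norm c"])
    (simp_all add: scale_right_distrib scaleC_scaleR norm_scaleC mult.commute)

lemma bounded_bilinear_cinner: "bounded_bilinear cinner"
proof
  show "cinner (r *\<^sub>R x) y = r *\<^sub>R cinner x y" for r x y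
    unfolding scaleC_of_real[symmetric] cinner_scaleC_left by (simp add: scaleR_conv_of_real)
  show "cinner x (r *\<^sub>R y) = r *\<^sub>R cinner x y" for r x y
    unfolding scaleC_of_real[symmetric] cinner_scaleC_right by (simp add: scaleR_conv_of_real)
  show "\<exists>K. \<forall>a b. norm (cinner a b) \<le> norm a * norm b * K"
    using norm_cinner_le by (intro exI[of _ 1]) simp
qed (rule cinner_add_left cinner_add_right)+

end

context unitary_rep
begin

lemma tau_plus: "k \<in> K \<Longrightarrow> tau k (x + y) = tau k x + tau k y"
  using tau_linear[of k] unfolding Vector_Spaces.linear_iff by blast

lemma tau_diff: "k \<in> K \<Longrightarrow> tau k (x - y) = tau k x - tau k y"
  using tau_plus[of k "x - y" y] by (simp only: diff_add_cancel add_diff_cancel)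

lemma tau_scaleC: "k \<in> K \<Longrightarrow> tau k (scaleC c x) = scaleC c (tau k x)"
  using tau_linear[of k] unfolding Vector_Spaces.linear_iff by blast

lemma norm_tau [simp]: "k \<in> K \<Longrightarrow> norm (tau k x) = norm x"
  using tau_unitary[of k x x] unfolding cinner_self of_real_eq_iff
  by (simp add: power2_eq_iff_nonneg)

lemma bounded_linear_tau: "k \<in> K \<Longrightarrow> bounded_linear (tau k)"
  by (rule bounded_linear_intro[where K = 1])
    (simp_all add: tau_plus tau_scaleC flip: scaleC_of_real)

lemma tau_minus_cancel [simp]:
  assumes "k \<in> K"
  shows "tau k (tau (- k) x) = x" "tau (- k) (tau k x) = x"
  using tau_add[OF assms K_minus[OF assms], of x] tau_add[OF K_minus[OF assms] assms, of x]
  by (simp_all add: tau_zero)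

text \<open>Continuity of \<open>tau\<close> is assumed only for a fixed vector. Unitarity makes it
  joint: the term with the moving vector \<open>h y - h x\<close> has the norm of that vector,
  whatever \<open>f y\<close> is.\<close>

lemma continuous_on_tau:
  assumes f: "continuous_on S f" "\<And>x. x \<in> S \<Longrightarrow> f x \<in> K" and h: "continuous_on S h"
  shows "continuous_on S (\<lambda>x. tau (f x) (h x))"
  unfolding continuous_on_def
proof
  fix x assume x: "x \<in> S"
  have S: "\<forall>\<^sub>F y in at x within S. f y \<in> K"
    using f(2) by (simp add: eventually_at_filter)
  have "continuous_on S (\<lambda>y. tau (f y) (h x))"
    using f by (intro continuous_on_compose2[OF tau_continuous[of "h x"] f(1)]) blast
  then have 1: "((\<lambda>y. tau (f y) (h x)) \<longlongrightarrow> tau (f x) (h x)) (at x within S)"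
    using x by (simp add: continuous_on_def)
  have "((\<lambda>y. h y - h x) \<longlongrightarrow> 0) (at x within S)"
    using h x by (simp add: continuous_on_def LIM_zero)
  then have 2: "((\<lambda>y. norm (h y - h x)) \<longlongrightarrow> 0) (at x within S)"
    by (rule tendsto_norm_zero)
  have "((\<lambda>y. tau (f y) (h y - h x)) \<longlongrightarrow> 0) (at x within S)"
    by (rule Lim_null_comparison[OF _ 2]) (rule eventually_mono[OF S], simp)
  from tendsto_add[OF this 1]
  have "((\<lambda>y. tau (f y) (h y - h x) + tau (f y) (h x)) \<longlongrightarrow> tau (f x) (h x)) (at x within S)"
    by simp
  then show "((\<lambda>x. tau (f x) (h x)) \<longlongrightarrow> tau (f x) (h x)) (at x within S)"
    by (rule Lim_transform_eventually) (rule eventually_mono[OF S], simp add: tau_diff)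
qed

lemma coset_eq_iff: "coset K g = coset K h \<longleftrightarrow> - g + h \<in> K"
proof
  assume "coset K g = coset K h"
  moreover have "h \<in> coset K h"
    using K_zero by (auto simp: coset_def intro!: image_eqI[of _ _ 0])
  ultimately obtain k where "k \<in> K" "h = g + k"
    by (auto simp: coset_def)
  then show "- g + h \<in> K" by (simp add: add.assoc[symmetric])
next
  assume *: "- g + h \<in> K"
  \<comment> \<open>The vector 0 is a dummy: the cosets are the projections of two equal
    orbits.\<close>
  have "orbit K tau g 0 = orbit K tau h (tau (- (- g + h)) 0)"
    unfolding orbit_eq_iff using * by (intro bexI[of _ "- g + h"]) (simp_all add: add.assoc[symmetric])
  from arg_cong[OF this, of bundle_proj] show "coset K g = coset K h"
    by (simp add: bundle_proj_orbit)
qed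

lemma coset_add [simp]: "k \<in> K \<Longrightarrow> coset K (g + k) = coset K g"
  using coset_eq_iff[of g "g + k"] by (simp add: add.assoc[symmetric])

lemma orbit_add: "k \<in> K \<Longrightarrow> orbit K tau (g + k) z = orbit K tau g (tau k z)"
  by (rule sym, rule orbit_eq_iff[THEN iffD2]) (rule bexI[of _ k], simp_all)

end

section \<open>Continuous sections with prescribed values\<close>

lemma normal_space_euclidean_compact:
  assumes "compact (UNIV :: 'a::t2_space set)"
  shows "normal_space (euclidean :: 'a topology)"
proof (rule compact_Hausdorff_or_regular_imp_normal_space)
  show "compact_space (euclidean :: 'a topology)"
    using assms by (simp add: compact_space_def compactin_euclidean_iff)
  show "Hausdorff_space (euclidean :: 'a topology) \<or> regular_space (euclidean :: 'a topology)"
    unfolding Hausdorff_space_def by (metis disjnt_def hausdorff open_openin)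
qed

lemma Tietze_vector:
  fixes f :: "'a::t2_space \<Rightarrow> 'b::euclidean_space"
  assumes "compact (UNIV :: 'a set)" and S: "closed S" and f: "continuous_on S f"
  obtains g where "continuous_on UNIV g" "\<And>x. x \<in> S \<Longrightarrow> g x = f x"
proof -
  have "\<exists>g. continuous_on UNIV g \<and> (\<forall>x\<in>S. g x = f x \<bullet> b)" for b
  proof -
    have "continuous_map (top_of_set S) euclideanreal (\<lambda>x. f x \<bullet> b)"
      using f by (simp add: continuous_on_inner)
    then obtain g where "continuous_map (euclidean :: 'a topology) euclideanreal g" "\<And>x. x \<in> S \<Longrightarrow> g x = f x \<bullet> b"
      using Tietze_extension_realinterval[OF normal_space_euclidean_compact[OF assms(1)], of S UNIV "\<lambda>x. f x \<bullet> b"] S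
      by auto
    then show ?thesis by auto
  qed
  then obtain g where g: "\<And>b. continuous_on UNIV (g b)" "\<And>b x. x \<in> S \<Longrightarrow> g b x = f x \<bullet> b"
    by metis
  show ?thesis
  proof (rule that)
    show "continuous_on UNIV (\<lambda>x. \<Sum>b\<in>Basis. g b x *\<^sub>R b)"
      using g(1) by (intro continuous_intros)
    show "(\<Sum>b\<in>Basis. g b x *\<^sub>R b) = f x" if "x \<in> S" for x
      using g(2)[OF that] by (simp add: euclidean_representation)
  qed
qed

text \<open>A modulus of continuity of the least-norm point in the Hausdorff distance
  \<open>d\<close>. A point \<open>p\<close> of \<open>C\<close> within \<open>d\<close> of
  \<open>b\<close> is at most 2 d longer than \<open>a\<close>, while the variational inequality at
  \<open>a\<close> bounds the square of \<open>norm (p - a)\<close> by the excess of the square of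
  \<open>norm p\<close> over that of \<open>norm a\<close>.\<close>

lemma norm_closest_point_diff_le:
  fixes C C' :: "'a::euclidean_space set"
  assumes C: "convex C" "closed C" "C \<noteq> {}" and C': "closed C'" "C' \<noteq> {}"
    and near: "\<And>x. x \<in> C \<Longrightarrow> \<exists>y\<in>C'. norm (y - x) \<le> d" "\<And>y. y \<in> C' \<Longrightarrow> \<exists>x\<in>C. norm (x - y) \<le> d"
  shows "norm (closest_point C' 0 - closest_point C 0) \<le> d + sqrt (4 * d * norm (closest_point C 0) + 4 * d\<^sup>2)"
proof -
  define a where "a = closest_point C 0"
  define b where "b = closest_point C' 0"
  have a: "a \<in> C" and b: "b \<in> C'"
    unfolding a_def b_def using C C' by (auto intro: closest_point_in_set)
  obtain p where p: "p \<in> C" "norm (p - b) \<le> d" using near(2)[OF b] by blast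
  obtain q where q: "q \<in> C'" "norm (q - a) \<le> d" using near(1)[OF a] by blast
  have "norm b \<le> norm q"
    using closest_point_le[OF C'(1) q(1), of 0] by (simp add: b_def)
  also have "\<dots> \<le> norm a + d" using norm_triangle_sub[of q a] q(2) by simp
  finally have "norm p \<le> norm a + 2 * d" using norm_triangle_sub[of p b] p(2) by simp
  then have "(norm p)\<^sup>2 \<le> (norm a + 2 * d)\<^sup>2" by (intro power_mono) auto
  moreover have "0 \<le> a \<bullet> (p - a)"
    using closest_point_dot[OF C(1,2) p(1), of 0] by (simp add: a_def)
  then have "(norm a)\<^sup>2 + (norm (p - a))\<^sup>2 \<le> (norm p)\<^sup>2"
    by (simp add: power2_norm_eq_inner inner_diff_left inner_diff_right inner_commute)
  ultimately have "(norm (p - a))\<^sup>2 \<le> 4 * d * norm a + 4 * d\<^sup>2"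
    by (simp add: power2_eq_square algebra_simps)
  then have "norm (p - a) \<le> sqrt (4 * d * norm a + 4 * d\<^sup>2)"
    by (rule real_le_rsqrt)
  moreover have "norm (b - a) \<le> norm (p - b) + norm (p - a)"
    using norm_triangle_ineq4[of "p - a" "p - b"] by simp
  ultimately show ?thesis
    using p(2) by (simp add: a_def b_def)
qed

locale compact_unitary_rep = unitary_rep scaleC cinner K tau
  for scaleC :: "complex \<Rightarrow> 'h::euclidean_space \<Rightarrow> 'h"
    and cinner :: "'h \<Rightarrow> 'h \<Rightarrow> complex"
    and K :: "'g::{topological_group_add,t2_space} set"
    and tau :: "'g \<Rightarrow> 'h \<Rightarrow> 'h" +
  assumes compact_UNIV: "compact (UNIV :: 'g set)"
begin

lemma closed_K: "closed K"
  using K_subgroup by (simp add: closed_subgroup_def)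

lemma compact_K: "compact K"
  using compact_Int_closed[OF compact_UNIV closed_K] by simp

text \<open>The pullbacks of continuous sections: the algebraic condition says that
  \<open>orbit K tau g (s g)\<close> depends only on the coset of \<open>g\<close>.\<close>

definition equivariant :: "('g \<Rightarrow> 'h) \<Rightarrow> bool" where
  "equivariant s \<longleftrightarrow> continuous_on UNIV s \<and> (\<forall>g. \<forall>k\<in>K. s (g + k) = tau (- k) (s g))"

lemma equivariantD: "equivariant s \<Longrightarrow> k \<in> K \<Longrightarrow> s (g + k) = tau (- k) (s g)"
  and equivariant_continuous: "equivariant s \<Longrightarrow> continuous_on UNIV s"
  by (auto simp: equivariant_def)

lemma equivariant_zero: "equivariant (\<lambda>_. 0)"
proof -
  have "tau k 0 = 0" if "k \<in> K" for k using tau_diff[OF that, of 0 0] by simp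
  then show ?thesis by (auto simp: equivariant_def K_minus)
qed

text \<open>
  No Haar measure is at hand to average a continuous extension of \<open>g\<^sub>0 + k \<mapsto> \<tau>(- k) z\<^sub>0\<close> over
  \<open>K\<close>; the averaged value is replaced by the point of least norm of the convex hull of the values
  to be averaged, which is just as canonical.
\<close>

lemma equivariant_through:
  obtains s where "equivariant s" "s g0 = z0"
proof -
  have coset: "coset K g0 = (\<lambda>g. - g0 + g) -` K"
  proof safe
    fix g assume "- g0 + g \<in> K"
    moreover have "g = g0 + (- g0 + g)" by (simp add: add.assoc[symmetric])
    ultimately show "g \<in> coset K g0" unfolding coset_def by blast
  qed (auto simp: coset_def add.assoc[symmetric])
  have "closed (coset K g0)"
    unfolding coset by (intro closed_vimage closed_K continuous_intros)
  moreover have "continuous_on (coset K g0) (\<lambda>g. tau (- (- g0 + g)) z0)"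
    by (rule continuous_on_tau) (auto simp: coset simp del: minus_add intro!: continuous_intros K_minus)
  \<comment> \<open>On the coset of \<open>g0\<close> the value \<open>z0\<close> and equivariance
    determine the function. Tietze extends it continuously, but in general not
    equivariantly.\<close>
  ultimately obtain f where f: "continuous_on UNIV f"
    and f0: "\<And>g. g \<in> coset K g0 \<Longrightarrow> f g = tau (- (- g0 + g)) z0"
    by (rule Tietze_vector[OF compact_UNIV]) blast
  \<comment> \<open>The values that averaging would integrate. At \<open>g0\<close> all of them
    equal \<open>z0\<close>, so the prescribed value survives.\<close>
  define S where "S g = (\<lambda>k. tau k (f (g + k))) ` K" for g
  define C where "C g = convex hull (S g)" for g
  define s where "s g = closest_point (C g) 0" for g
  have "compact (S g)" for g
    unfolding S_def
    by (intro compact_continuous_image compact_K continuous_on_tau continuous_on_compose2[OF f] continuous_intros) auto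
  then have C: "convex (C g)" "closed (C g)" "C g \<noteq> {}" for g
    using K_zero by (auto simp: C_def S_def intro!: compact_imp_closed compact_convex_hull)
  have equiv: "s (g + l) = tau (- l) (s g)" if l: "l \<in> K" for g l
  proof -
    \<comment> \<open>Substitute \<open>l + k\<close> for \<open>k\<close>. As
      \<open>tau (- l)\<close> is linear and isometric, it carries hulls to hulls and least-norm
      points to least-norm points.\<close>
    have "S (g + l) = tau (- l) ` S g"
    proof
      show "S (g + l) \<subseteq> tau (- l) ` S g"
      proof
        fix z assume "z \<in> S (g + l)"
        then obtain k where k: "k \<in> K" "z = tau k (f (g + l + k))" by (auto simp: S_def)
        have "z = tau (- l) (tau (l + k) (f (g + (l + k))))"
          using k l K_minus K_add by (simp add: tau_add add.assoc)
        then show "z \<in> tau (- l) ` S g"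
          using k(1) l K_add by (auto simp: S_def)
      qed
      show "tau (- l) ` S g \<subseteq> S (g + l)"
      proof
        fix z assume "z \<in> tau (- l) ` S g"
        then obtain k where k: "k \<in> K" "z = tau (- l) (tau k (f (g + k)))" by (auto simp: S_def)
        then have "z = tau (- l + k) (f (g + l + (- l + k)))"
          using l K_minus by (simp add: tau_add add.assoc)
        then show "z \<in> S (g + l)"
          using k(1) l K_add K_minus by (auto simp: S_def)
      qed
    qed
    then have Cl: "C (g + l) = tau (- l) ` C g"
      unfolding C_def using bounded_linear_tau[OF K_minus[OF l]]
      by (simp add: convex_hull_linear_image bounded_linear.linear)
    have "tau (- l) (s g) = closest_point (C (g + l)) 0"
    proof (rule closest_point_unique)
      have sg: "s g \<in> C g" unfolding s_def using C by (intro closest_point_in_set) auto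
      then show "tau (- l) (s g) \<in> C (g + l)" unfolding Cl by simp
      show "\<forall>z\<in>C (g + l). dist 0 (tau (- l) (s g)) \<le> dist 0 z"
        unfolding Cl using closest_point_le[OF C(2)[of g], of _ 0] l K_minus by (auto simp: s_def)
    qed (rule C)+
    then show ?thesis by (simp add: s_def)
  qed
  have cont: "continuous_on UNIV s"
    unfolding continuous_on_def
  proof (intro ballI tendstoI)
    fix g and e :: real assume "e > 0"
    have "((\<lambda>d. d + sqrt (4 * d * norm (s g) + 4 * d\<^sup>2)) \<longlongrightarrow> 0 + sqrt (4 * 0 * norm (s g) + 4 * 0\<^sup>2)) (at_right 0)"
      by (intro tendsto_intros)
    then have "\<forall>\<^sub>F d in at_right 0. d + sqrt (4 * d * norm (s g) + 4 * d\<^sup>2) < e"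
      using \<open>e > 0\<close> by (intro order_tendstoD(2)) auto
    moreover have "\<forall>\<^sub>F d::real in at_right 0. 0 < d"
      by (rule eventually_at_right_less)
    ultimately have "\<forall>\<^sub>F d in at_right 0. 0 < d \<and> d + sqrt (4 * d * norm (s g) + 4 * d\<^sup>2) < e"
      by eventually_elim simp
    then obtain d where d: "d > 0" "d + sqrt (4 * d * norm (s g) + 4 * d\<^sup>2) < e"
      using eventually_happens[of _ "at_right (0::real)"] by auto
    \<comment> \<open>Closeness of \<open>f (g' + k)\<close> and \<open>f (g + k)\<close> is needed
      uniformly in \<open>k\<close>; compactness of \<open>K\<close> provides it through the tube
      lemma.\<close>
    define W where "W = {(g', k). norm (f (g' + k) - f (g + k)) < d}"
    have W: "open W"
      unfolding W_def case_prod_beta'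
      by (intro open_Collect_less continuous_on_norm continuous_on_diff continuous_on_compose2[OF f] continuous_intros) auto
    have "{g} \<times> K \<subseteq> W" using d(1) by (auto simp: W_def)
    from Elementary_Topology.tube_lemma[OF compact_K W this]
    obtain U where U: "g \<in> U" "open U" "U \<times> K \<subseteq> W" by blast
    have "dist (s g') (s g) < e" if "g' \<in> U" for g'
    proof -
      \<comment> \<open>The closed \<open>d\<close>-neighbourhood of the convex set
        \<open>C g2\<close> is convex, so it contains the hull of \<open>S g1\<close> as soon as it
        contains \<open>S g1\<close>. Used both ways, this bounds the Hausdorff distance.\<close>
      have close: "C g1 \<subseteq> (\<Union>x\<in>C g2. \<Union>y\<in>cball 0 d. {x + y})"
        if *: "\<And>k. k \<in> K \<Longrightarrow> norm (f (g1 + k) - f (g2 + k)) \<le> d" for g1 g2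
        unfolding C_def[of g1]
      proof (rule hull_minimal)
        show "convex (\<Union>x\<in>C g2. \<Union>y\<in>cball 0 d. {x + y})"
          by (intro convex_sums C convex_cball)
        show "S g1 \<subseteq> (\<Union>x\<in>C g2. \<Union>y\<in>cball 0 d. {x + y})"
        proof
          fix z assume "z \<in> S g1"
          then obtain k where k: "k \<in> K" "z = tau k (f (g1 + k))" by (auto simp: S_def)
          have "z = tau k (f (g2 + k)) + tau k (f (g1 + k) - f (g2 + k))"
            using k by (simp add: tau_diff)
          moreover have "tau k (f (g2 + k)) \<in> C g2"
            unfolding C_def using k(1) by (intro hull_inc) (auto simp: S_def)
          moreover have "tau k (f (g1 + k) - f (g2 + k)) \<in> cball 0 d"
            using *[OF k(1)] k(1) by simp
          ultimately show "z \<in> (\<Union>x\<in>C g2. \<Union>y\<in>cball 0 d. {x + y})" by blast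
        qed
      qed
      have fd: "norm (f (g' + k) - f (g + k)) \<le> d" "norm (f (g + k) - f (g' + k)) \<le> d" if "k \<in> K" for k
        using U(3) \<open>g' \<in> U\<close> that by (auto simp: W_def norm_minus_commute)
      have "norm (closest_point (C g') 0 - closest_point (C g) 0)
          \<le> d + sqrt (4 * d * norm (closest_point (C g) 0) + 4 * d\<^sup>2)"
      proof (rule norm_closest_point_diff_le)
        show "\<exists>y\<in>C g'. norm (y - x) \<le> d" if "x \<in> C g" for x
        proof -
          have "C g \<subseteq> (\<Union>x\<in>C g'. \<Union>y\<in>cball 0 d. {x + y})"
            by (rule close) (rule fd)
          with that obtain y v where "y \<in> C g'" "v \<in> cball 0 d" "x = y + v"
            by blast
          then show ?thesis by (intro bexI[of _ y]) (simp_all add: norm_minus_commute)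
        qed
        show "\<exists>x\<in>C g. norm (x - y) \<le> d" if "y \<in> C g'" for y
        proof -
          have "C g' \<subseteq> (\<Union>x\<in>C g. \<Union>y\<in>cball 0 d. {x + y})"
            by (rule close) (rule fd)
          with that obtain x v where "x \<in> C g" "v \<in> cball 0 d" "y = x + v"
            by blast
          then show ?thesis by (intro bexI[of _ x]) (simp_all add: norm_minus_commute)
        qed
      qed (rule C)+
      then show ?thesis using d(2) by (simp add: s_def dist_norm)
    qed
    then show "\<forall>\<^sub>F g' in at g. dist (s g') (s g) < e"
      using U by (auto simp: eventually_at_topological)
  qed
  have "S g0 = {z0}"
  proof -
    have "tau k (f (g0 + k)) = z0" if "k \<in> K" for k
      using f0[of "g0 + k"] that by (simp add: coset_def add.assoc[symmetric])
    then show ?thesis using K_zero by (auto simp: S_def)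
  qed
  then have "s g0 = z0"
    using closest_point_in_set[OF C(2,3), of g0 0] by (simp add: s_def C_def)
  then show ?thesis
    using that[of s] cont equiv by (auto simp: equivariant_def)
qed

text \<open>An equivariant function through \<open>(g, z)\<close> still passes close to every nearby
  \<open>(g', z')\<close>. By compactness finitely many of them approximate all points over the ball
  of radius n up to 1 / (n + 1), and the union over n is countable whatever the topology of the
  group.\<close>

lemma equivariant_dense:
  obtains D where "countable D" "\<And>s. s \<in> D \<Longrightarrow> equivariant s"
    "\<And>g z e. 0 < e \<Longrightarrow> \<exists>s\<in>D. norm (s g - z) < e"
proof -
  have "\<forall>p. \<exists>s. equivariant s \<and> s (fst p) = snd p"
    using equivariant_through by metis
  then obtain S where S: "\<And>p. equivariant (S p)" "\<And>p. S p (fst p) = snd p" by metis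
  have "\<exists>F. finite F \<and> (\<forall>g. \<forall>z\<in>cball 0 (real n). \<exists>p\<in>F. norm (S p g - z) < 1 / real (Suc n))" for n
  proof -
    define U where "U p = {q. norm (S p (fst q) - snd q) < 1 / real (Suc n)}" for p
    have U: "open (U p)" for p
      unfolding U_def by (intro open_Collect_less continuous_on_norm continuous_on_diff
          continuous_on_compose2[OF equivariant_continuous[OF S(1)]] continuous_intros) auto
    have "compact ((UNIV :: 'g set) \<times> cball (0::'h) (real n))"
      by (intro compact_Times compact_UNIV compact_cball)
    moreover have "(UNIV :: 'g set) \<times> cball (0::'h) (real n) \<subseteq> (\<Union>p\<in>UNIV \<times> cball 0 (real n). U p)"
    proof
      fix q :: "'g \<times> 'h" assume "q \<in> UNIV \<times> cball 0 (real n)"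
      moreover have "q \<in> U q" by (simp add: U_def S(2))
      ultimately show "q \<in> (\<Union>p\<in>UNIV \<times> cball 0 (real n). U p)" by blast
    qed
    ultimately obtain F where "finite F" "(UNIV :: 'g set) \<times> cball (0::'h) (real n) \<subseteq> (\<Union>p\<in>F. U p)"
      using compactE_image[of "UNIV \<times> cball 0 (real n)" "UNIV \<times> cball 0 (real n)" U] U by metis
    then have "finite F \<and> (\<forall>g. \<forall>z\<in>cball 0 (real n). \<exists>p\<in>F. (g, z) \<in> U p)"
      by blast
    then show ?thesis unfolding U_def mem_Collect_eq fst_conv snd_conv by blast
  qed
  then have "\<exists>F. \<forall>n. finite (F n) \<and> (\<forall>g. \<forall>z\<in>cball 0 (real n). \<exists>p\<in>F n. norm (S p g - z) < 1 / real (Suc n))"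
    by (intro choice allI)
  then obtain F where F: "\<And>n. finite (F n)"
    "\<And>n g z. norm z \<le> real n \<Longrightarrow> \<exists>p\<in>F n. norm (S p g - z) < 1 / real (Suc n)"
    unfolding Ball_def mem_cball_0 by blast
  show ?thesis
  proof (rule that)
    show "countable (\<Union>n. S ` F n)" using F(1) by (intro countable_UN) (auto intro: countable_finite)
    show "equivariant s" if "s \<in> (\<Union>n. S ` F n)" for s using that S(1) by auto
    show "\<exists>s\<in>(\<Union>n. S ` F n). norm (s g - z) < e" if "0 < e" for g z e
    proof -
      obtain n1 n2 where n: "norm z \<le> real n1" "inverse (real (Suc n2)) < e"
        using real_arch_simple reals_Archimedean[OF \<open>0 < e\<close>] by metis
      \<comment> \<open>Large enough both for the ball to contain \<open>z\<close> and for the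
        tolerance to drop below \<open>e\<close>.\<close>
      define n where "n = max n1 n2"
      have "1 / real (Suc n) \<le> inverse (real (Suc n2))"
        unfolding inverse_eq_divide by (intro divide_left_mono) (auto simp: n_def)
      then have "1 / real (Suc n) < e" using n(2) by linarith
      moreover have "norm z \<le> real n" using n(1) by (simp add: n_def)
      then obtain p where "p \<in> F n" "norm (S p g - z) < 1 / real (Suc n)"
        using F(2) by blast
      ultimately show ?thesis by force
    qed
  qed
qed

end

section \<open>Measurability on the bundle\<close>

lemma space_borel_sigma [simp]: "space (borel_sigma X) = topspace X"
  and sets_borel_sigma: "sets (borel_sigma X) = sigma_sets (topspace X) {U. openin X U}"
  unfolding borel_sigma_def
  by (auto intro!: space_measure_of sets_measure_of dest: openin_subset)

lemma borel_sigma_openin: "openin X U \<Longrightarrow> U \<in> sets (borel_sigma X)"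
  by (auto simp: sets_borel_sigma)

lemma measurable_borel_sigma_continuous:
  assumes "continuous_map X Y f"
  shows "f \<in> borel_sigma X \<rightarrow>\<^sub>M borel_sigma Y"
proof -
  have "f \<in> borel_sigma X \<rightarrow>\<^sub>M sigma (topspace Y) {U. openin Y U}"
  proof (rule measurable_measure_of)
    show "f \<in> space (borel_sigma X) \<rightarrow> topspace Y"
      using assms by (auto simp: continuous_map_def)
    show "f -` U \<inter> space (borel_sigma X) \<in> sets (borel_sigma X)" if "U \<in> {U. openin Y U}" for U
    proof (rule borel_sigma_openin)
      have "f -` U \<inter> space (borel_sigma X) = {x \<in> topspace X. f x \<in> U}" by auto
      then show "openin X (f -` U \<inter> space (borel_sigma X))"
        using assms that by (simp add: continuous_map_def)
    qed
  qed (auto dest: openin_subset)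
  then show ?thesis by (simp add: borel_sigma_def)
qed

lemma borel_sigma_euclidean: "borel_sigma euclidean = borel"
  by (simp add: borel_sigma_def borel_def open_openin[symmetric])

lemma continuous_map_quotient_top:
  "continuous_map (quotient_top q) Y f \<longleftrightarrow> continuous_map euclidean Y (f \<circ> q)"
  by (rule continuous_compose_quotient_map_eq[OF quotient_map_quotient_top, symmetric])

section \<open>Topology of the homogeneous space and of the total space\<close>

context unitary_rep
begin

lemma topspace_hom_space: "topspace (hom_space K) = range (coset K)"
  by (simp add: hom_space_def)

lemma topspace_total_space: "topspace (total_space K tau) = range (\<lambda>(g, z). orbit K tau g z)"
  by (simp add: total_space_def)

lemma orbit_in_total_space [simp]: "orbit K tau g z \<in> topspace (total_space K tau)"
  unfolding topspace_total_space by (rule range_eqI[of _ _ "(g, z)"]) simp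

lemma coset_in_hom_space [simp]: "coset K g \<in> topspace (hom_space K)"
  by (simp add: topspace_hom_space)

lemma continuous_map_coset: "continuous_map euclidean (hom_space K) (coset K)"
  unfolding hom_space_def by (rule quotient_imp_continuous_map[OF quotient_map_quotient_top])

lemma continuous_map_orbit: "continuous_map euclidean (total_space K tau) (\<lambda>(g, z). orbit K tau g z)"
  unfolding total_space_def by (rule quotient_imp_continuous_map[OF quotient_map_quotient_top])

lemma openin_coset_image:
  assumes "open U"
  shows "openin (hom_space K) (coset K ` U)"
proof -
  have "coset K -` coset K ` U = (\<Union>k\<in>K. (\<lambda>g. g + k) -` U)"
  proof (intro set_eqI iffI)
    fix g assume "g \<in> coset K -` coset K ` U"
    then obtain u where "coset K g = coset K u" "u \<in> U" by auto
    then show "g \<in> (\<Union>k\<in>K. (\<lambda>g. g + k) -` U)"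
      by (auto simp: coset_eq_iff add.assoc[symmetric] intro!: bexI[of _ "- g + u"])
  next
    fix g assume "g \<in> (\<Union>k\<in>K. (\<lambda>g. g + k) -` U)"
    then obtain k where "k \<in> K" "g + k \<in> U" by auto
    then show "g \<in> coset K -` coset K ` U" by (auto intro!: image_eqI[of _ _ "g + k"])
  qed
  moreover have "open (\<Union>k\<in>K. (\<lambda>g. g + k) -` U)"
    using assms by (intro open_UN ballI open_vimage continuous_intros)
  ultimately show ?thesis
    by (auto simp: hom_space_def openin_quotient_top)
qed

text \<open>The saturation of \<open>U\<close> is a union of preimages of \<open>U\<close> under the
  continuous action of elements of \<open>K\<close>. Openness turns neighbourhoods of a
  representative into neighbourhoods of its orbit.\<close>

lemma openin_orbit_image:
  assumes "open U"
  shows "openin (total_space K tau) ((\<lambda>(g, z). orbit K tau g z) ` U)"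
proof -
  have "(\<lambda>(g, z). orbit K tau g z) -` (\<lambda>(g, z). orbit K tau g z) ` U
      = (\<Union>k\<in>K. (\<lambda>p. (fst p + k, tau (- k) (snd p))) -` U)"
  proof (intro set_eqI iffI)
    fix p assume "p \<in> (\<lambda>(g, z). orbit K tau g z) -` (\<lambda>(g, z). orbit K tau g z) ` U"
    then obtain h w where "orbit K tau (fst p) (snd p) = orbit K tau h w" "(h, w) \<in> U"
      by (auto simp: case_prod_beta')
    then show "p \<in> (\<Union>k\<in>K. (\<lambda>p. (fst p + k, tau (- k) (snd p))) -` U)"
      by (auto simp: orbit_eq_iff)
  next
    fix p assume "p \<in> (\<Union>k\<in>K. (\<lambda>p. (fst p + k, tau (- k) (snd p))) -` U)"
    then obtain g z k where p: "p = (g, z)" and k: "k \<in> K" "(g + k, tau (- k) z) \<in> U" by (cases p) auto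
    have "orbit K tau g z = orbit K tau (g + k) (tau (- k) z)"
      using k(1) by (simp add: orbit_add)
    then show "p \<in> (\<lambda>(g, z). orbit K tau g z) -` (\<lambda>(g, z). orbit K tau g z) ` U"
      unfolding p using k(2) by (auto intro!: image_eqI[of _ _ "(g + k, tau (- k) z)"])
  qed
  moreover have "open (\<Union>k\<in>K. (\<lambda>p. (fst p + k, tau (- k) (snd p))) -` U)"
    using assms K_minus
    by (intro open_UN ballI open_vimage continuous_on_Pair continuous_on_tau continuous_intros) auto
  ultimately show ?thesis
    by (auto simp: total_space_def openin_quotient_top)
qed

text \<open>As \<open>K\<close> is closed, the pairs with different cosets form an open subset of
  the square of the group, and the coset map is open. The compact sets of inner regularity are
  therefore closed, hence Borel.\<close>

lemma Hausdorff_hom_space: "Hausdorff_space (hom_space K)"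
  unfolding Hausdorff_space_def
proof (intro allI impI)
  fix x y assume "x \<in> topspace (hom_space K) \<and> y \<in> topspace (hom_space K) \<and> x \<noteq> y"
  then obtain a b where ab: "x = coset K a" "y = coset K b" "x \<noteq> y"
    by (auto simp: topspace_hom_space)
  then have nK: "- a + b \<notin> K" by (simp add: coset_eq_iff)
  have "open (- K)" using K_subgroup unfolding closed_subgroup_def by (blast intro: open_Compl)
  then have "open ((\<lambda>p. - fst p + snd p) -` (- K) :: ('g \<times> 'g) set)"
    by (rule open_vimage) (intro continuous_intros)
  moreover have "(a, b) \<in> (\<lambda>p. - fst p + snd p) -` (- K)" using nK by simp
  ultimately obtain U V where UV: "open U" "open V" "a \<in> U" "b \<in> V"
    "U \<times> V \<subseteq> (\<lambda>p. - fst p + snd p) -` (- K)"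
    by (rule open_prod_elim) blast
  have "disjnt (coset K ` U) (coset K ` V)"
    using UV(5) by (auto simp: disjnt_def coset_eq_iff)
  then show "\<exists>U V. openin (hom_space K) U \<and> openin (hom_space K) V \<and> x \<in> U \<and> y \<in> V \<and> disjnt U V"
    using UV ab openin_coset_image by blast
qed

lemma continuous_map_act_space: "continuous_map (hom_space K) (hom_space K) (act_space h)"
proof -
  have "continuous_map euclidean (hom_space K) (coset K \<circ> (+) h)"
    by (rule continuous_map_compose[OF _ continuous_map_coset]) (auto intro!: continuous_intros)
  moreover have "act_space h \<circ> coset K = coset K \<circ> (+) h"
    by (auto simp: act_space_coset)
  ultimately show ?thesis
    by (subst hom_space_def) (simp add: continuous_map_quotient_top)
qed

lemma continuous_map_act_bundle: "continuous_map (total_space K tau) (total_space K tau) (act_bundle h)"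
proof -
  have "continuous_map euclidean (total_space K tau) ((\<lambda>(g, z). orbit K tau g z) \<circ> (\<lambda>p. (h + fst p, snd p)))"
    by (rule continuous_map_compose[OF _ continuous_map_orbit]) (auto intro!: continuous_intros)
  moreover have "act_bundle h \<circ> (\<lambda>(g, z). orbit K tau g z) = (\<lambda>(g, z). orbit K tau g z) \<circ> (\<lambda>p. (h + fst p, snd p))"
    by (auto simp: act_bundle_orbit)
  ultimately show ?thesis
    by (subst total_space_def) (simp add: continuous_map_quotient_top)
qed

lemma act_bundle_in [simp]: "\<eta> \<in> topspace (total_space K tau) \<Longrightarrow> act_bundle h \<eta> \<in> topspace (total_space K tau)"
  using continuous_map_act_bundle by (auto simp: continuous_map_def)

lemma act_space_in [simp]: "x \<in> topspace (hom_space K) \<Longrightarrow> act_space h x \<in> topspace (hom_space K)"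
  using continuous_map_act_space by (auto simp: continuous_map_def)

lemma bundle_proj_in: "\<eta> \<in> topspace (total_space K tau) \<Longrightarrow> bundle_proj \<eta> \<in> topspace (hom_space K)"
  by (auto simp: topspace_total_space bundle_proj_orbit)

lemma bundle_proj_act: "bundle_proj (act_bundle h \<eta>) = act_space h (bundle_proj \<eta>)"
  by (force simp: bundle_proj_def act_bundle_def act_space_def)

lemma act_space_cancel: "act_space (- h) (act_space h x) = x" "act_space h (act_space (- h) x) = x"
  by (auto simp: act_space_def image_image add.assoc[symmetric])

lemma common_base_reps:
  assumes "\<eta> \<in> topspace (total_space K tau)" "\<zeta> \<in> topspace (total_space K tau)"
    and "bundle_proj \<eta> = bundle_proj \<zeta>"
  obtains g z w where "\<eta> = orbit K tau g z" "\<zeta> = orbit K tau g w"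
proof -
  obtain g z where "\<eta> = orbit K tau g z" using assms(1) by (auto simp: topspace_total_space)
  moreover from this obtain w where "\<zeta> = orbit K tau g w"
    using fibre_unique_rep[OF assms(2), of g] assms(3) by (auto simp: bundle_proj_orbit)
  ultimately show thesis by (rule that)
qed

lemma fib_inner_act:
  assumes "\<eta> \<in> topspace (total_space K tau)" "\<zeta> \<in> topspace (total_space K tau)"
    and "bundle_proj \<eta> = bundle_proj \<zeta>"
  shows "fib_inner cinner K tau (act_bundle h \<eta>) (act_bundle h \<zeta>) = fib_inner cinner K tau \<eta> \<zeta>"
  using common_base_reps[OF assms] by (metis act_bundle_orbit fib_inner_orbit)

lemma fib_inner_commute:
  assumes "\<eta> \<in> topspace (total_space K tau)" "\<zeta> \<in> topspace (total_space K tau)"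
    and "bundle_proj \<eta> = bundle_proj \<zeta>"
  shows "fib_inner cinner K tau \<eta> \<zeta> = cnj (fib_inner cinner K tau \<zeta> \<eta>)"
  using common_base_reps[OF assms] by (metis cinner_commute fib_inner_orbit)

lemma norm_fib_inner_le:
  assumes "\<eta> \<in> topspace (total_space K tau)" "\<zeta> \<in> topspace (total_space K tau)"
    and "bundle_proj \<eta> = bundle_proj \<zeta>"
  shows "norm (fib_inner cinner K tau \<eta> \<zeta>) \<le> fib_norm cinner K tau \<eta> * fib_norm cinner K tau \<zeta>"
  using common_base_reps[OF assms] by (metis norm_cinner_le fib_inner_orbit fib_norm_orbit)

definition descend :: "('g \<Rightarrow> 'h \<Rightarrow> 'c) \<Rightarrow> ('g \<times> 'h) set \<Rightarrow> 'c" where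
  "descend \<phi> \<eta> = (THE c. \<exists>g z. \<eta> = orbit K tau g z \<and> c = \<phi> g z)"

lemma descend_orbit:
  assumes "\<And>g z k. k \<in> K \<Longrightarrow> \<phi> (g + k) (tau (- k) z) = \<phi> g z"
  shows "descend \<phi> (orbit K tau g z) = \<phi> g z"
  unfolding descend_def
proof (rule the_equality)
  show "\<exists>h w. orbit K tau g z = orbit K tau h w \<and> \<phi> g z = \<phi> h w" by blast
qed (auto simp: orbit_eq_iff assms)

lemma continuous_map_descend:
  fixes \<phi> :: "'g \<Rightarrow> 'h \<Rightarrow> 'c::topological_space"
  assumes "\<And>g z k. k \<in> K \<Longrightarrow> \<phi> (g + k) (tau (- k) z) = \<phi> g z"
    and "continuous_on UNIV (\<lambda>p. \<phi> (fst p) (snd p))"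
  shows "continuous_map (total_space K tau) euclidean (descend \<phi>)"
proof -
  have "descend \<phi> \<circ> (\<lambda>(g, z). orbit K tau g z) = (\<lambda>p. \<phi> (fst p) (snd p))"
    using descend_orbit[of \<phi>, OF assms(1)] by auto
  then show ?thesis
    using assms(2) by (simp add: total_space_def continuous_map_quotient_top)
qed

lemma measurable_descend:
  fixes \<phi> :: "'g \<Rightarrow> 'h \<Rightarrow> 'c::topological_space"
  assumes "\<And>g z k. k \<in> K \<Longrightarrow> \<phi> (g + k) (tau (- k) z) = \<phi> g z"
    and "continuous_on UNIV (\<lambda>p. \<phi> (fst p) (snd p))"
  shows "descend \<phi> \<in> borel_sigma (total_space K tau) \<rightarrow>\<^sub>M borel"
  using measurable_borel_sigma_continuous[OF continuous_map_descend[OF assms]]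
  by (simp add: borel_sigma_euclidean)

lemma continuous_map_fib_norm: "continuous_map (total_space K tau) euclidean (fib_norm cinner K tau)"
proof -
  have "fib_norm cinner K tau \<circ> (\<lambda>(g, z). orbit K tau g z) = (\<lambda>p. norm (snd p))"
    by (auto simp: fib_norm_orbit)
  then show ?thesis
    by (simp add: total_space_def continuous_map_quotient_top continuous_on_norm continuous_on_snd)
qed

lemma measurable_fib_norm: "fib_norm cinner K tau \<in> borel_sigma (total_space K tau) \<rightarrow>\<^sub>M borel"
  using measurable_borel_sigma_continuous[OF continuous_map_fib_norm]
  by (simp add: borel_sigma_euclidean)

end

text \<open>
  The inner product is continuous on pairs of points with a common base point, but the Borel sets of
  the product need not be generated by rectangles. Distances to the countably many sections of
  \<open>equivariant_dense\<close> are measurable in each argument separately, and they determine the inner product.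
\<close>

lemma (in compact_unitary_rep) borel_measurable_fib_inner:
  assumes \<alpha>: "\<alpha> \<in> M \<rightarrow>\<^sub>M borel_sigma (total_space K tau)" and \<beta>: "\<beta> \<in> M \<rightarrow>\<^sub>M borel_sigma (total_space K tau)"
    and base: "\<And>m. m \<in> space M \<Longrightarrow> bundle_proj (\<alpha> m) = bundle_proj (\<beta> m)"
  shows "(\<lambda>m. fib_inner cinner K tau (\<alpha> m) (\<beta> m)) \<in> borel_measurable M"
proof -
  obtain D where D: "countable D" "\<And>s. s \<in> D \<Longrightarrow> equivariant s"
    "\<And>g z e. 0 < e \<Longrightarrow> \<exists>s\<in>D. norm (s g - z) < e"
    by (rule equivariant_dense) blast
  have "D \<noteq> {}" using D(3)[of 1 0 0] by auto
  \<comment> \<open>The distance in a fibre between \<open>c\<close> times a point and the section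
    \<open>s\<close>: a continuous function of one bundle point, hence measurable along
    \<open>\<alpha>\<close> and along \<open>\<beta>\<close> separately.\<close>
  define \<delta> where "\<delta> c s = descend (\<lambda>g z. norm (scaleC c z - s g))" for c and s :: "'g \<Rightarrow> 'h"
  have inv: "norm (scaleC c (tau (- k) z) - s (g + k)) = norm (scaleC c z - s g)" if "equivariant s" "k \<in> K" for c s g k z
    using that norm_tau[OF K_minus[OF that(2)], of "scaleC c z - s g"]
    by (simp add: equivariantD tau_scaleC tau_diff K_minus)
  have \<delta>: "\<delta> c s (orbit K tau g z) = norm (scaleC c z - s g)" if "equivariant s" for c s g z
    unfolding \<delta>_def by (rule descend_orbit) (rule inv[OF that])
  have \<delta>m: "\<delta> c s \<in> borel_sigma (total_space K tau) \<rightarrow>\<^sub>M borel" if "equivariant s" for c s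
    unfolding \<delta>_def using inv[OF that]
    by (intro measurable_descend continuous_on_norm continuous_on_diff
        bounded_linear.continuous_on[OF bounded_linear_scaleC]
        continuous_on_compose2[OF equivariant_continuous[OF that]] continuous_intros) auto
  \<comment> \<open>The reverse triangle inequality bounds each term by
    \<open>norm (z - scaleC c w)\<close>, and a section passing close to \<open>scaleC c w\<close>
    nearly attains this bound. So the distance of two moving points is a countable supremum.\<close>
  define N where "N c m = (SUP s\<in>D. \<bar>\<delta> 1 s (\<alpha> m) - \<delta> c s (\<beta> m)\<bar>)" for c m
  have sup: "bdd_above ((\<lambda>s. \<bar>\<delta> 1 s (orbit K tau g z) - \<delta> c s (orbit K tau g w)\<bar>) ` D)" (is "bdd_above (?d ` D)")
    "(SUP s\<in>D. \<bar>\<delta> 1 s (orbit K tau g z) - \<delta> c s (orbit K tau g w)\<bar>) = norm (z - scaleC c w)" for c g z w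
  proof -
    have le: "?d s \<le> norm (z - scaleC c w)" if "s \<in> D" for s
      using norm_triangle_ineq3[of "z - s g" "scaleC c w - s g"] D(2)[OF that] by (simp add: \<delta>)
    then show bdd: "bdd_above (?d ` D)" by (intro bdd_aboveI2)
    show "(SUP s\<in>D. ?d s) = norm (z - scaleC c w)"
    proof (rule antisym)
      show "(SUP s\<in>D. ?d s) \<le> norm (z - scaleC c w)"
        by (rule cSUP_least) (use \<open>D \<noteq> {}\<close> le in auto)
      show "norm (z - scaleC c w) \<le> (SUP s\<in>D. ?d s)"
      proof (rule field_le_epsilon)
        fix e :: real assume "e > 0"
        then obtain s where s: "s \<in> D" "norm (s g - scaleC c w) < e / 2"
          using D(3)[of "e / 2" g "scaleC c w"] by auto
        have "norm (z - scaleC c w) \<le> norm (z - s g) + norm (s g - scaleC c w)"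
          using norm_triangle_ineq[of "z - s g" "s g - scaleC c w"] by simp
        also have "\<dots> \<le> ?d s + 2 * norm (s g - scaleC c w)"
          using D(2)[OF s(1)] by (simp add: \<delta> norm_minus_commute)
        also have "\<dots> \<le> (SUP s\<in>D. ?d s) + e"
          using cSUP_upper[OF s(1) bdd] s(2) by linarith
        finally show "norm (z - scaleC c w) \<le> (SUP s\<in>D. ?d s) + e" .
      qed
    qed
  qed
  have reps: "\<exists>g z w. \<alpha> m = orbit K tau g z \<and> \<beta> m = orbit K tau g w" if "m \<in> space M" for m
    using common_base_reps[of "\<alpha> m" "\<beta> m"] base[OF that] measurable_space[OF \<alpha> that] measurable_space[OF \<beta> that]
    by (simp) metis
  have Nm [measurable]: "N c \<in> borel_measurable M" for c
    unfolding N_def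
  proof (rule borel_measurable_cSUP[OF D(1)])
    fix s assume "s \<in> D"
    from \<delta>m[OF D(2)[OF this]] show "(\<lambda>m. \<bar>\<delta> 1 s (\<alpha> m) - \<delta> c s (\<beta> m)\<bar>) \<in> borel_measurable M"
      using measurable_compose[OF \<alpha>, of "\<delta> 1 s" borel] measurable_compose[OF \<beta>, of "\<delta> c s" borel]
      by (intro borel_measurable_abs borel_measurable_diff) auto
  next
    fix m assume "m \<in> space M"
    then obtain g z w where "\<alpha> m = orbit K tau g z" "\<beta> m = orbit K tau g w" using reps by blast
    then show "bdd_above ((\<lambda>s. \<bar>\<delta> 1 s (\<alpha> m) - \<delta> c s (\<beta> m)\<bar>) ` D)"
      using sup(1) by simp
  qed
  have [measurable]: "(\<lambda>m. fib_norm cinner K tau (\<alpha> m)) \<in> borel_measurable M"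
    "(\<lambda>m. fib_norm cinner K tau (\<beta> m)) \<in> borel_measurable M"
    by (rule measurable_compose[OF _ measurable_fib_norm], rule \<alpha> \<beta>)+
  \<comment> \<open>Polarization: for \<open>c\<close> of modulus 1 this is the real inner product
    of \<open>z\<close> and \<open>scaleC c w\<close>, which is the real part of
    \<open>cinner z w\<close> at \<open>c = 1\<close> and the imaginary part at
    \<open>c = \<i>\<close>.\<close>
  define I where "I c m = ((fib_norm cinner K tau (\<alpha> m))\<^sup>2 + (fib_norm cinner K tau (\<beta> m))\<^sup>2 - (N c m)\<^sup>2) / 2" for c m
  have "(\<lambda>m. complex_of_real (I 1 m) + \<i> * complex_of_real (I \<i> m)) \<in> borel_measurable M"
    unfolding I_def by measurable
  moreover have "fib_inner cinner K tau (\<alpha> m) (\<beta> m) = complex_of_real (I 1 m) + \<i> * complex_of_real (I \<i> m)"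
    if m: "m \<in> space M" for m
  proof -
    obtain g z w where r: "\<alpha> m = orbit K tau g z" "\<beta> m = orbit K tau g w" using reps[OF m] by blast
    have I: "I c m = z \<bullet> scaleC c w" if "norm c = 1" for c
      unfolding I_def N_def r sup(2) fib_norm_orbit
      using norm_scaleC[of c w] that
      by (simp add: dot_norm_neg)
    show ?thesis
      unfolding r fib_inner_orbit complex_eq_iff using I[of 1] I[of \<i>] by (simp add: Re_cinner Im_cinner)
  qed
  ultimately show ?thesis
    by (simp cong: measurable_cong)
qed

section \<open>The invariant measure and shrinking neighbourhoods\<close>

text \<open>The sets with this property form a sigma-algebra containing the rectangles, since a
  countable union merges countably many countable families. One family serves all
  \<open>\<omega>\<close>; measurability of the single sections would only give one family per
  section.\<close>

lemma countable_sections_pair_measure: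
  assumes "B \<in> sets (M \<Otimes>\<^sub>M P)"
  shows "\<exists>\<A>. countable \<A> \<and> \<A> \<subseteq> sets M \<and>
    (\<forall>\<omega>\<in>space P. {x \<in> space M. (x, \<omega>) \<in> B} \<in> sigma_sets (space M) \<A>)"
  using assms unfolding sets_pair_measure
proof (induction rule: sigma_sets.induct)
  case (Basic B)
  then obtain a b where "B = a \<times> b" "a \<in> sets M" by blast
  moreover from this have "{x \<in> space M. (x, \<omega>) \<in> B} = (if \<omega> \<in> b then a else {})" for \<omega>
    using sets.sets_into_space by auto
  ultimately show ?case
    by (intro exI[of _ "{a}"]) (auto intro: sigma_sets.Empty sigma_sets.Basic)
next
  case Empty
  then show ?case by (intro exI[of _ "{}"]) (auto intro: sigma_sets.Empty)
next
  case (Compl B)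
  then obtain \<A> where \<A>: "countable \<A>" "\<A> \<subseteq> sets M"
    "\<And>\<omega>. \<omega> \<in> space P \<Longrightarrow> {x \<in> space M. (x, \<omega>) \<in> B} \<in> sigma_sets (space M) \<A>" by blast
  have "{x \<in> space M. (x, \<omega>) \<in> space M \<times> space P - B} = space M - {x \<in> space M. (x, \<omega>) \<in> B}"
    if "\<omega> \<in> space P" for \<omega> using that by auto
  then show ?case
    using \<A> by (intro exI[of _ \<A>]) (auto intro: sigma_sets.Compl)
next
  case (Union B)
  have "\<forall>n. \<exists>\<A>. countable \<A> \<and> \<A> \<subseteq> sets M \<and>
      (\<forall>\<omega>\<in>space P. {x \<in> space M. (x, \<omega>) \<in> B n} \<in> sigma_sets (space M) \<A>)"
    using Union.IH by (rule allI)
  from choice[OF this] obtain \<A> where *: "\<forall>n. countable (\<A> n) \<and> \<A> n \<subseteq> sets M \<and>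
      (\<forall>\<omega>\<in>space P. {x \<in> space M. (x, \<omega>) \<in> B n} \<in> sigma_sets (space M) (\<A> n))"
    by (rule exE)
  then have \<A>: "\<And>n. countable (\<A> n)" "\<And>n. \<A> n \<subseteq> sets M"
    "\<And>n \<omega>. \<omega> \<in> space P \<Longrightarrow> {x \<in> space M. (x, \<omega>) \<in> B n} \<in> sigma_sets (space M) (\<A> n)"
    by auto
  have "{x \<in> space M. (x, \<omega>) \<in> \<Union> (range B)} \<in> sigma_sets (space M) (\<Union>n. \<A> n)" if "\<omega> \<in> space P" for \<omega>
  proof -
    have "{x \<in> space M. (x, \<omega>) \<in> \<Union> (range B)} = (\<Union>n. {x \<in> space M. (x, \<omega>) \<in> B n})" by auto
    moreover have "{x \<in> space M. (x, \<omega>) \<in> B n} \<in> sigma_sets (space M) (\<Union>n. \<A> n)" for n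
      using \<A>(3)[OF that, of n] sigma_sets_mono'[of "\<A> n" "\<Union>n. \<A> n" "space M"] by blast
    ultimately show ?thesis by (auto intro: sigma_sets.Union)
  qed
  then show ?case
    using \<A>(1,2) by (intro exI[of _ "\<Union>n. \<A> n"]) auto
qed

section \<open>Support and regularity of the invariant measure\<close>

locale homogeneous_bundle = compact_unitary_rep scaleC cinner K tau
  for scaleC :: "complex \<Rightarrow> 'h::euclidean_space \<Rightarrow> 'h"
    and cinner :: "'h \<Rightarrow> 'h \<Rightarrow> complex"
    and K :: "'g::{topological_group_add,t2_space} set"
    and tau :: "'g \<Rightarrow> 'h \<Rightarrow> 'h" +
  fixes \<mu> :: "'g set measure"
  assumes invariant_probability: "invariant_probability K \<mu>"
begin

sublocale \<mu>: prob_space \<mu>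
  using invariant_probability by (simp add: invariant_probability_def)

lemma space_\<mu> [simp]: "space \<mu> = topspace (hom_space K)"
  and sets_\<mu>: "sets \<mu> = sets (borel_sigma (hom_space K))"
  and distr_act_space: "distr \<mu> \<mu> (act_space h) = \<mu>"
  and inner_regular: "A \<in> sets \<mu> \<Longrightarrow>
    emeasure \<mu> A = (SUP C\<in>{C. compactin (hom_space K) C \<and> C \<subseteq> A}. emeasure \<mu> C)"
  using invariant_probability by (auto simp: invariant_probability_def)

lemma openin_sets_\<mu>: "openin (hom_space K) U \<Longrightarrow> U \<in> sets \<mu>"
  by (simp add: sets_\<mu> borel_sigma_openin)

lemma closedin_sets_\<mu>:
  assumes "closedin (hom_space K) C"
  shows "C \<in> sets \<mu>"
  using sets.compl_sets[OF openin_sets_\<mu>[OF openin_diff[OF openin_topspace assms]]]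
    closedin_subset[OF assms] by (simp add: double_diff)

lemma act_space_measurable [measurable]: "act_space h \<in> \<mu> \<rightarrow>\<^sub>M \<mu>"
  using measurable_borel_sigma_continuous[OF continuous_map_act_space]
  by (simp add: measurable_cong_sets[OF sets_\<mu> sets_\<mu>])

lemma emeasure_act_space:
  "A \<in> sets \<mu> \<Longrightarrow> emeasure \<mu> (act_space h -` A \<inter> space \<mu>) = emeasure \<mu> A"
  using emeasure_distr[OF act_space_measurable, of A h] by (simp add: distr_act_space)

lemma integral_act_space:
  fixes f :: "'g set \<Rightarrow> 'b::{banach,second_countable_topology}"
  assumes "f \<in> borel_measurable \<mu>"
  shows "(LINT x|\<mu>. f (act_space h x)) = (LINT x|\<mu>. f x)"
  using integral_distr[OF act_space_measurable assms, of h] by (simp add: distr_act_space)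

text \<open>Finitely many translates of \<open>U\<close> cover the space because the group is
  compact, and each has the measure of \<open>U\<close>; they cannot all be null.\<close>

lemma emeasure_open_pos:
  assumes U: "openin (hom_space K) U" "x \<in> U"
  shows "emeasure \<mu> U \<noteq> 0"
proof
  assume null: "emeasure \<mu> U = 0"
  have "x \<in> topspace (hom_space K)"
    using openin_subset[OF U(1)] U(2) by blast
  then obtain a where a: "x = coset K a"
    by (auto simp: topspace_hom_space)
  define O' where "O' = coset K -` U"
  have O': "open O'" "a \<in> O'"
    using U a by (auto simp: O'_def hom_space_def openin_quotient_top)
  have "\<exists>F. finite F \<and> UNIV \<subseteq> (\<Union>h\<in>F. (+) h -` O')"
  proof -
    have "UNIV \<subseteq> (\<Union>h\<in>UNIV. (+) h -` O')"
    proof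
      fix g
      have "a + - g + g = a" by (simp add: add.assoc)
      then show "g \<in> (\<Union>h\<in>UNIV. (+) h -` O')" using O'(2) by (intro UN_I[of "a + - g"]) auto
    qed
    moreover have "open ((+) h -` O')" for h
      using O'(1) by (rule open_vimage) (intro continuous_intros)
    ultimately show ?thesis
      using compactE_image[OF compact_UNIV, of UNIV "\<lambda>h. (+) h -` O'"] by metis
  qed
  then obtain F where F: "finite F" "UNIV \<subseteq> (\<Union>h\<in>F. (+) h -` O')" by blast
  have "space \<mu> \<subseteq> (\<Union>h\<in>F. act_space h -` U \<inter> space \<mu>)"
    using F(2) by (fastforce simp: topspace_hom_space act_space_coset O'_def)
  then have "emeasure \<mu> (space \<mu>) \<le> emeasure \<mu> (\<Union>h\<in>F. act_space h -` U \<inter> space \<mu>)"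
    by (intro emeasure_mono sets.finite_UN measurable_sets[OF act_space_measurable] openin_sets_\<mu> U F)
  also have "\<dots> \<le> (\<Sum>h\<in>F. emeasure \<mu> (act_space h -` U \<inter> space \<mu>))"
    by (intro emeasure_subadditive_finite F image_subsetI measurable_sets[OF act_space_measurable] openin_sets_\<mu> U)
  also have "\<dots> = 0"
    using null by (simp add: emeasure_act_space openin_sets_\<mu>[OF U(1)] del: space_\<mu>)
  finally show False by (simp add: \<mu>.emeasure_space_1 del: space_\<mu>)
qed

text \<open>The two functions differ on an open set, and nonempty open sets are not null.\<close>

lemma AE_eq_imp_eq:
  fixes f f' :: "'g set \<Rightarrow> 'b::t2_space"
  assumes f: "continuous_map (hom_space K) euclidean f" "continuous_map (hom_space K) euclidean f'"
    and ae: "AE x in \<mu>. f x = f' x" and x: "x \<in> topspace (hom_space K)"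
  shows "f x = f' x"
proof (rule ccontr)
  assume "f x \<noteq> f' x"
  define U where "U = {x \<in> topspace (hom_space K). f x \<noteq> f' x}"
  have "openin (hom_space K) U"
  proof -
    have "open {g. f (coset K g) \<noteq> f' (coset K g)}"
      using f by (intro open_Collect_neq) (auto simp: hom_space_def continuous_map_quotient_top o_def)
    moreover have "coset K -` U = {g. f (coset K g) \<noteq> f' (coset K g)}"
      by (auto simp: U_def)
    ultimately show ?thesis
      by (auto simp: hom_space_def openin_quotient_top U_def)
  qed
  moreover have "emeasure \<mu> {x \<in> space \<mu>. f x \<noteq> f' x} = 0"
    using ae by (intro emeasure_eq_0_AE) simp
  then have "emeasure \<mu> U = 0" by (simp add: U_def)
  moreover have "x \<in> U" using x \<open>f x \<noteq> f' x\<close> by (simp add: U_def)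
  ultimately show False using emeasure_open_pos by blast
qed

text \<open>Continuity of translation for indicator functions. Regularity encloses \<open>A\<close>
  between a compact \<open>C\<close> and an open \<open>Q\<close> that differ little, and small
  translations keep \<open>C\<close> inside \<open>Q\<close>.\<close>

lemma translation_continuous_measure:
  assumes A: "A \<in> sets \<mu>" and "e > 0"
  obtains V where "open V" "0 \<in> V"
    "\<And>h. h \<in> V \<Longrightarrow> emeasure \<mu> {x \<in> space \<mu>. (act_space h x \<in> A) \<noteq> (x \<in> A)} \<le> ennreal e"
proof -
  have approx: "\<exists>C. compactin (hom_space K) C \<and> C \<subseteq> B \<and> emeasure \<mu> B < emeasure \<mu> C + ennreal (e / 4)"
    if "B \<in> sets \<mu>" for B
  proof -
    have "{C. compactin (hom_space K) C \<and> C \<subseteq> B} \<noteq> {}"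
      using compactin_empty by blast
    from SUP_approx_ennreal[OF _ this inner_regular[OF that], of "e / 4"] \<open>e > 0\<close>
    show ?thesis by auto
  qed
  obtain C where C: "compactin (hom_space K) C" "C \<subseteq> A" "emeasure \<mu> A < emeasure \<mu> C + ennreal (e / 4)"
    using approx[OF A] by blast
  have "space \<mu> - A \<in> sets \<mu>" using A by (rule sets.compl_sets)
  then obtain C' where C': "compactin (hom_space K) C'" "C' \<subseteq> space \<mu> - A"
    "emeasure \<mu> (space \<mu> - A) < emeasure \<mu> C' + ennreal (e / 4)"
    using approx by blast
  \<comment> \<open>Inner regularity of the complement supplies the open set around
    \<open>A\<close>.\<close>
  define Q where "Q = space \<mu> - C'"
  have closedin: "closedin (hom_space K) C" "closedin (hom_space K) C'"
    using C C' by (auto intro: compactin_imp_closedin Hausdorff_hom_space)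
  then have Q: "openin (hom_space K) Q" by (simp add: Q_def openin_diff)
  have Qm: "Q \<in> sets \<mu>" using Q by (rule openin_sets_\<mu>)
  have C'm: "C' \<in> sets \<mu>" and Cm: "C \<in> sets \<mu>"
    using closedin by (auto intro: closedin_sets_\<mu>)
  have AQ: "A \<subseteq> Q" using C'(2) sets.sets_into_space[OF A] by (auto simp: Q_def)
  \<comment> \<open>Each approximation loses less than \<open>e / 4\<close>, so \<open>Q - C\<close>
    has measure below \<open>e / 2\<close>; it is counted twice at the end.\<close>
  have "measure \<mu> A < measure \<mu> C + e / 4"
    using C(3) \<open>e > 0\<close> by (simp add: \<mu>.emeasure_eq_measure ennreal_plus[symmetric] ennreal_less_iff del: ennreal_plus)
  moreover have "measure \<mu> (space \<mu> - A) < measure \<mu> C' + e / 4"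
    using C'(3) \<open>e > 0\<close> by (simp add: \<mu>.emeasure_eq_measure ennreal_plus[symmetric] ennreal_less_iff del: ennreal_plus)
  moreover have "measure \<mu> (space \<mu> - A) = 1 - measure \<mu> A" "measure \<mu> Q = 1 - measure \<mu> C'"
    unfolding Q_def by (rule \<mu>.prob_compl, fact)+
  moreover have "measure \<mu> (Q - C) = measure \<mu> Q - measure \<mu> C"
    using AQ C(2) by (intro \<mu>.finite_measure_Diff Qm Cm) auto
  ultimately have small: "measure \<mu> (Q - C) < e / 2" by linarith
  \<comment> \<open>Translations by \<open>h\<close> and by \<open>- h\<close> are both controlled,
    because a point may enter \<open>A\<close> as well as leave it and \<open>V\<close> need not be
    symmetric.\<close>
  have tube: "\<exists>V. 0 \<in> V \<and> open V \<and> V \<times> coset K -` C \<subseteq> {p. fst p + snd p \<in> coset K -` Q} \<inter> {p. - fst p + snd p \<in> coset K -` Q}"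
  proof (rule Elementary_Topology.tube_lemma)
    have "open (- (coset K -` C))"
    proof -
      have "open (coset K -` (topspace (hom_space K) - C))"
        using openin_diff[OF openin_topspace closedin(1)] by (simp add: hom_space_def openin_quotient_top)
      moreover have "coset K -` (topspace (hom_space K) - C) = - (coset K -` C)"
        by (rule set_eqI) simp
      ultimately show ?thesis by simp
    qed
    then have "closed (coset K -` C)" by (simp add: closed_def)
    then show "compact (coset K -` C)" using compact_Int_closed[OF compact_UNIV] by auto
    have oQ: "open (coset K -` Q)" using Q by (simp add: hom_space_def openin_quotient_top)
    have "open ((\<lambda>p. fst p + snd p) -` (coset K -` Q) :: ('g \<times> 'g) set)"
      using oQ by (rule open_vimage) (intro continuous_intros)
    moreover have "open ((\<lambda>p. - fst p + snd p) -` (coset K -` Q) :: ('g \<times> 'g) set)"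
      using oQ by (rule open_vimage) (intro continuous_intros)
    ultimately show "open ({p. fst p + snd p \<in> coset K -` Q} \<inter> {p. - fst p + snd p \<in> coset K -` Q} :: ('g \<times> 'g) set)"
      by (auto simp: vimage_def)
    show "{0} \<times> coset K -` C \<subseteq> {p. fst p + snd p \<in> coset K -` Q} \<inter> {p. - fst p + snd p \<in> coset K -` Q}"
      using AQ C(2) by auto
  qed
  then obtain V where V: "0 \<in> V" "open V"
    "V \<times> coset K -` C \<subseteq> {p. fst p + snd p \<in> coset K -` Q} \<inter> {p. - fst p + snd p \<in> coset K -` Q}" by blast
  have CQ: "act_space h x \<in> Q \<and> act_space (- h) x \<in> Q" if "h \<in> V" "x \<in> C" for h x
  proof -
    have "x \<in> topspace (hom_space K)" using that(2) closedin_subset[OF closedin(1)] by blast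
    then obtain g where g: "x = coset K g" by (auto simp: topspace_hom_space)
    then have "(h, g) \<in> V \<times> coset K -` C" using that by simp
    then have "(h, g) \<in> {p. fst p + snd p \<in> coset K -` Q} \<inter> {p. - fst p + snd p \<in> coset K -` Q}"
      using V(3) by blast
    then show ?thesis by (simp add: g act_space_coset)
  qed
  have "emeasure \<mu> {x \<in> space \<mu>. (act_space h x \<in> A) \<noteq> (x \<in> A)} \<le> ennreal e" if h: "h \<in> V" for h
  proof -
    \<comment> \<open>If \<open>x\<close> and its translate disagree about \<open>A\<close>, exactly
      one of them lies in \<open>A\<close>. Either that one is in \<open>C\<close>, and then the
      other is in \<open>Q\<close> but not in \<open>C\<close>, or it is itself in
      \<open>Q - C\<close>.\<close>
    have "{x \<in> space \<mu>. (act_space h x \<in> A) \<noteq> (x \<in> A)} \<subseteq> (Q - C) \<union> (act_space h -` (Q - C) \<inter> space \<mu>)"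
    proof
      fix x assume "x \<in> {x \<in> space \<mu>. (act_space h x \<in> A) \<noteq> (x \<in> A)}"
      then consider "x \<in> space \<mu>" "act_space h x \<in> A" "x \<notin> A" | "x \<in> space \<mu>" "act_space h x \<notin> A" "x \<in> A" by auto
      then show "x \<in> (Q - C) \<union> (act_space h -` (Q - C) \<inter> space \<mu>)"
      proof cases
        case 1
        then show ?thesis
          using CQ[OF h, of "act_space h x"] AQ C(2) by (cases "act_space h x \<in> C") (auto simp: act_space_cancel)
      next
        case 2
        then show ?thesis
          using CQ[OF h, of x] AQ C(2) by (cases "x \<in> C") auto
      qed
    qed
    then have "emeasure \<mu> {x \<in> space \<mu>. (act_space h x \<in> A) \<noteq> (x \<in> A)}
        \<le> emeasure \<mu> ((Q - C) \<union> (act_space h -` (Q - C) \<inter> space \<mu>))"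
      by (intro emeasure_mono sets.Un sets.Diff measurable_sets[OF act_space_measurable] Qm Cm)
    also have "\<dots> \<le> emeasure \<mu> (Q - C) + emeasure \<mu> (act_space h -` (Q - C) \<inter> space \<mu>)"
      by (intro emeasure_subadditive sets.Diff measurable_sets[OF act_space_measurable] Qm Cm)
    also have "\<dots> = emeasure \<mu> (Q - C) + emeasure \<mu> (Q - C)"
      by (simp only: emeasure_act_space[OF sets.Diff[OF Qm Cm]])
    also have "\<dots> \<le> ennreal e"
      using small \<open>e > 0\<close> by (simp add: \<mu>.emeasure_eq_measure ennreal_plus[symmetric] del: ennreal_plus)
    finally show ?thesis .
  qed
  with V that show thesis by blast
qed

text \<open>For fixed \<open>h\<close> the almost invariant sets are closed under complements and
  countable unions, so generators suffice.\<close>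

lemma AE_invariant_sigma_sets:
  assumes "A \<in> sigma_sets (space \<mu>) \<A>" and "\<And>B. B \<in> \<A> \<Longrightarrow> AE x in \<mu>. act_space h x \<in> B \<longleftrightarrow> x \<in> B"
  shows "AE x in \<mu>. act_space h x \<in> A \<longleftrightarrow> x \<in> A"
  using assms(1)
proof (induction rule: sigma_sets.induct)
  case (Compl a)
  from Compl.IH AE_space[of \<mu>] show ?case by eventually_elim auto
next
  case (Union a)
  then have "AE x in \<mu>. \<forall>i. act_space h x \<in> a i \<longleftrightarrow> x \<in> a i"
    by (simp add: AE_all_countable)
  then show ?case by eventually_elim auto
qed (use assms(2) in auto)

end

section \<open>Values of a random field as limits of averages\<close>

context homogeneous_bundle
begin

text \<open>A countable basis separates points, so countably many almost sure equivalences give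
  equality almost everywhere; continuity and full support extend it to every point.\<close>

lemma AE_invariant_imp_invariant:
  fixes f :: "'g set \<Rightarrow> 'e::{second_countable_topology,t2_space}"
  assumes f: "continuous_map (hom_space K) euclidean f" and \<B>: "countable \<B>" "topological_basis \<B>"
    and inv: "\<And>B. B \<in> \<B> \<Longrightarrow> AE x in \<mu>. f (act_space h x) \<in> B \<longleftrightarrow> f x \<in> B"
    and x: "x \<in> topspace (hom_space K)"
  shows "f (act_space h x) = f x"
proof -
  have "AE x in \<mu>. \<forall>B\<in>\<B>. f (act_space h x) \<in> B \<longleftrightarrow> f x \<in> B"
    using inv \<B>(1) by (simp add: AE_ball_countable)
  then have "AE x in \<mu>. f (act_space h x) = f x"
  proof eventually_elim
    case (elim x)
    show ?case
    proof (rule ccontr)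
      assume "f (act_space h x) \<noteq> f x"
      then obtain U where "open U" "f (act_space h x) \<in> U" "f x \<notin> U"
        using t1_space by blast
      moreover from this obtain B where "B \<in> \<B>" "f (act_space h x) \<in> B" "B \<subseteq> U"
        using topological_basisE[OF \<B>(2)] by metis
      ultimately show False using elim by blast
    qed
  qed
  moreover have "continuous_map (hom_space K) euclidean (\<lambda>x. f (act_space h x))"
    using continuous_map_compose[OF continuous_map_act_space f] by (simp add: o_def)
  ultimately show ?thesis
    using AE_eq_imp_eq[OF _ f] x by blast
qed

text \<open>
  \<open>G\<close> need not be first countable. Joint measurability however makes all paths measurable with
  respect to one countable family of Borel sets, and the continuous functions measurable with respect
  to such a family factor through a metrizable quotient: a sequence of neighbourhoods is enough.
\<close>

lemma shrinking_neighbourhoods: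
  fixes F :: "'g set \<Rightarrow> 'w \<Rightarrow> 'e::{second_countable_topology,metric_space}"
  assumes F: "(\<lambda>(x, \<omega>). F x \<omega>) \<in> borel_measurable (\<mu> \<Otimes>\<^sub>M P)"
  obtains V :: "nat \<Rightarrow> 'g set" where "\<And>n. open (V n)" "\<And>n. 0 \<in> V n"
    "\<And>\<omega> g e. \<omega> \<in> space P \<Longrightarrow> continuous_map (hom_space K) euclidean (\<lambda>x. F x \<omega>) \<Longrightarrow> 0 < e \<Longrightarrow>
      \<forall>\<^sub>F n in sequentially. \<forall>h\<in>V n. dist (F (coset K (h + g)) \<omega>) (F (coset K g) \<omega>) < e"
proof -
  obtain \<B> :: "'e set set" where \<B>: "countable \<B>" "topological_basis \<B>"
    using ex_countable_basis by blast
  \<comment> \<open>One countable family per basic open set; the basis being countable, their union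
    is countable too.\<close>
  have "\<exists>\<A>. countable \<A> \<and> \<A> \<subseteq> sets \<mu> \<and>
      (\<forall>\<omega>\<in>space P. {x \<in> space \<mu>. F x \<omega> \<in> B} \<in> sigma_sets (space \<mu>) \<A>)" if "B \<in> \<B>" for B
  proof -
    have "(\<lambda>(x, \<omega>). F x \<omega>) -` B \<inter> space (\<mu> \<Otimes>\<^sub>M P) \<in> sets (\<mu> \<Otimes>\<^sub>M P)"
      using F topological_basis_open[OF \<B>(2) that] by (intro measurable_sets) auto
    from countable_sections_pair_measure[OF this]
    obtain \<A> where "countable \<A>" "\<A> \<subseteq> sets \<mu>"
      "\<And>\<omega>. \<omega> \<in> space P \<Longrightarrow>
        {x \<in> space \<mu>. (x, \<omega>) \<in> (\<lambda>(x, \<omega>). F x \<omega>) -` B \<inter> space (\<mu> \<Otimes>\<^sub>M P)} \<in> sigma_sets (space \<mu>) \<A>"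
      by blast
    moreover have "{x \<in> space \<mu>. (x, \<omega>) \<in> (\<lambda>(x, \<omega>). F x \<omega>) -` B \<inter> space (\<mu> \<Otimes>\<^sub>M P)} = {x \<in> space \<mu>. F x \<omega> \<in> B}"
      if "\<omega> \<in> space P" for \<omega> using that by (auto simp: space_pair_measure)
    ultimately show ?thesis by (intro exI[of _ \<A>]) simp
  qed
  then have "\<forall>B\<in>\<B>. \<exists>\<A>. countable \<A> \<and> \<A> \<subseteq> sets \<mu> \<and>
      (\<forall>\<omega>\<in>space P. {x \<in> space \<mu>. F x \<omega> \<in> B} \<in> sigma_sets (space \<mu>) \<A>)" by blast
  from bchoice[OF this] obtain \<A> where *: "\<forall>B\<in>\<B>. countable (\<A> B) \<and> \<A> B \<subseteq> sets \<mu> \<and>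
      (\<forall>\<omega>\<in>space P. {x \<in> space \<mu>. F x \<omega> \<in> B} \<in> sigma_sets (space \<mu>) (\<A> B))"
    by (rule exE)
  \<comment> \<open>The empty set is added so that \<open>\<C>\<close> is nonempty and can be
    enumerated.\<close>
  define \<C> where "\<C> = insert {} (\<Union>B\<in>\<B>. \<A> B)"
  have \<C>: "countable \<C>" "\<C> \<noteq> {}" "\<C> \<subseteq> sets \<mu>"
    using * \<B>(1) by (auto simp: \<C>_def)
  have path: "{x \<in> space \<mu>. F x \<omega> \<in> B} \<in> sigma_sets (space \<mu>) \<C>" if "\<omega> \<in> space P" "B \<in> \<B>" for \<omega> B
  proof -
    have "\<A> B \<subseteq> \<C>" using that by (auto simp: \<C>_def)
    from sigma_sets_mono'[OF this] show ?thesis using * that by blast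
  qed
  define A where "A = from_nat_into \<C>"
  have rangeA: "range A = \<C>" using \<C>(1,2) by (simp add: A_def range_from_nat_into)
  \<comment> \<open>Translations from \<open>U\<close> change \<open>A j\<close> by a set of measure
    at most 1 / (k + 1). The bound is secured on the closure, by normality of the compact group, so
    that closed sets are available for a compactness argument.\<close>
  have "\<exists>U. open U \<and> 0 \<in> U \<and> (\<forall>h\<in>closure U.
      emeasure \<mu> {x \<in> space \<mu>. (act_space h x \<in> A j) \<noteq> (x \<in> A j)} \<le> ennreal (1 / real (Suc k)))" for j k
  proof -
    have "A j \<in> sets \<mu>" using rangeA \<C>(3) by blast
    moreover have "0 < 1 / real (Suc k)" by simp
    ultimately obtain V where V: "open V" "0 \<in> V" "\<And>h. h \<in> V \<Longrightarrow>
        emeasure \<mu> {x \<in> space \<mu>. (act_space h x \<in> A j) \<noteq> (x \<in> A j)} \<le> ennreal (1 / real (Suc k))"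
      by (rule translation_continuous_measure) blast
    have "closed {0 :: 'g}" "closed (- V)" "disjnt {0} (- V)"
      using V by (auto simp: closed_Compl)
    then have "closedin euclidean {0 :: 'g} \<and> closedin euclidean (- V) \<and> disjnt {0} (- V)"
      unfolding closed_closedin by blast
    then have "\<exists>U U'. openin euclidean U \<and> openin euclidean U' \<and> {0} \<subseteq> U \<and> - V \<subseteq> U' \<and> disjnt U U'"
      using normal_space_euclidean_compact[OF compact_UNIV] unfolding normal_space_def by metis
    then obtain U U' where U: "open U" "open U'" "0 \<in> U" "- V \<subseteq> U'" "U \<inter> U' = {}"
      by (auto simp: disjnt_def)
    have "closure U \<subseteq> - U'" using U by (intro closure_minimal) auto
    then have "closure U \<subseteq> V" using U(4) by blast
    then show ?thesis using U V by blast
  qed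
  then have "\<forall>p. \<exists>U. open U \<and> 0 \<in> U \<and> (\<forall>h\<in>closure U.
      emeasure \<mu> {x \<in> space \<mu>. (act_space h x \<in> A (fst p)) \<noteq> (x \<in> A (fst p))} \<le> ennreal (1 / real (Suc (snd p))))"
    by blast
  from choice[OF this] obtain U where U: "\<forall>p. open (U p) \<and> 0 \<in> U p \<and> (\<forall>h\<in>closure (U p).
      emeasure \<mu> {x \<in> space \<mu>. (act_space h x \<in> A (fst p)) \<noteq> (x \<in> A (fst p))} \<le> ennreal (1 / real (Suc (snd p))))"
    by (rule exE)
  \<comment> \<open>Intersecting along an enumeration of the pairs (j, k) makes both sequences
    decreasing, with \<open>V n\<close> open and \<open>C n\<close> closed.\<close>
  define V where "V n = (\<Inter>i\<le>n. U (prod_decode i))" for n :: nat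
  define C where "C n = (\<Inter>i\<le>n. closure (U (prod_decode i)))" for n :: nat
  have VC: "V n \<subseteq> C n" for n
    unfolding V_def C_def using closure_subset by blast
  \<comment> \<open>An \<open>h\<close> lying in every \<open>C n\<close> moves each generator by a
    null set only, hence leaves every continuous path invariant: the field cannot tell such an
    \<open>h\<close> from 0.\<close>
  have limit: "act_space h x \<in> topspace (hom_space K) \<and> F (act_space h x) \<omega> = F x \<omega>"
    if h: "\<And>n. h \<in> C n" and \<omega>: "\<omega> \<in> space P" "continuous_map (hom_space K) euclidean (\<lambda>x. F x \<omega>)"
      and x: "x \<in> topspace (hom_space K)" for h \<omega> x
  proof
    show "F (act_space h x) \<omega> = F x \<omega>"
    proof (rule AE_invariant_imp_invariant[OF \<omega>(2) \<B> _ x])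
      fix B assume B: "B \<in> \<B>"
      have "AE x in \<mu>. act_space h x \<in> S \<longleftrightarrow> x \<in> S" if "S \<in> \<C>" for S
      proof -
        obtain j where j: "S = A j" using rangeA \<open>S \<in> \<C>\<close> by blast
        let ?N = "{x \<in> space \<mu>. (act_space h x \<in> A j) \<noteq> (x \<in> A j)}"
        have [measurable]: "A j \<in> sets \<mu>" using rangeA \<C>(3) by blast
        have "?N \<in> sets \<mu>" by measurable
        have "emeasure \<mu> ?N \<le> ennreal (1 / real (Suc k))" for k
        proof -
          have "h \<in> closure (U (j, k))"
            using h[of "prod_encode (j, k)"] by (auto simp: C_def dest: bspec[of _ _ "prod_encode (j, k)"])
          then show ?thesis using U[rule_format, of "(j, k)"] by simp
        qed
        then have "emeasure \<mu> ?N \<le> 0"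
        proof (intro LIMSEQ_le_const)
          have "(\<lambda>k. 1 / real (Suc k)) \<longlonglongrightarrow> 0" by (rule LIMSEQ_Suc, rule lim_const_over_n)
          then show "(\<lambda>k. ennreal (1 / real (Suc k))) \<longlonglongrightarrow> 0"
            using tendsto_ennrealI by force
        qed blast
        then have "AE x in \<mu>. x \<notin> ?N"
          using \<open>?N \<in> sets \<mu>\<close> by (intro AE_not_in) auto
        then show ?thesis using AE_space unfolding j by eventually_elim auto
      qed
      then have "AE x in \<mu>. act_space h x \<in> {x \<in> space \<mu>. F x \<omega> \<in> B} \<longleftrightarrow> x \<in> {x \<in> space \<mu>. F x \<omega> \<in> B}"
        by (rule AE_invariant_sigma_sets[OF path[OF \<omega>(1) B]])
      with AE_space[of \<mu>] show "AE x in \<mu>. (F (act_space h x) \<omega> \<in> B) = (F x \<omega> \<in> B)"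
        by eventually_elim simp
    qed
  qed (use x in simp)
  show thesis
  proof (rule that[of V])
    have Uo: "open (U p)" "0 \<in> U p" for p using U by blast+
    show "open (V n)" for n
      unfolding V_def by (intro open_INT ballI Uo) simp
    show "0 \<in> V n" for n
      unfolding V_def by (intro INT_I Uo)
    fix \<omega> g and e :: real
    assume \<omega>: "\<omega> \<in> space P" "continuous_map (hom_space K) euclidean (\<lambda>x. F x \<omega>)" and "0 < e"
    \<comment> \<open>The translations that move the path by \<open>e\<close> or more form a compact
      set that misses the intersection of all \<open>C n\<close>, so finitely many
      \<open>C n\<close> already exclude it. Their number depends on \<open>\<omega>\<close>, the
      sets themselves do not.\<close>
    define E where "E = {h. e \<le> dist (F (coset K (h + g)) \<omega>) (F (coset K g) \<omega>)}"
    have "continuous_on UNIV (\<lambda>g. F (coset K g) \<omega>)"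
      using \<omega>(2) by (simp add: hom_space_def continuous_map_quotient_top o_def)
    from continuous_on_compose2[OF this, of UNIV "\<lambda>h. h + g"]
    have "continuous_on UNIV (\<lambda>h. F (coset K (h + g)) \<omega>)" by (simp add: continuous_intros)
    then have "closed E"
      unfolding E_def by (intro closed_Collect_le continuous_intros)
    then have "compact E" using compact_Int_closed[OF compact_UNIV] by auto
    have "E \<inter> (\<Inter>n\<in>UNIV. C n) = {}"
    proof -
      have "h \<notin> E" if "\<And>n. h \<in> C n" for h
        using limit[OF that \<omega>, of "coset K g"] \<open>0 < e\<close> by (simp add: E_def act_space_coset)
      then show ?thesis by blast
    qed
    then obtain I where I: "finite I" "E \<inter> (\<Inter>n\<in>I. C n) = {}"
      using compact_imp_fip_image[OF \<open>compact E\<close>, of UNIV C] unfolding C_def by auto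
    obtain N where N: "\<forall>n\<in>I. n \<le> N" using I(1) finite_nat_set_iff_bounded_le by auto
    have "V n \<inter> E = {}" if "n \<ge> N" for n
    proof -
      have "V n \<subseteq> C i" if "i \<in> I" for i
      proof -
        have "i \<le> n" using N \<open>n \<ge> N\<close> that by force
        then have "C n \<subseteq> C i" by (auto simp: C_def)
        then show ?thesis using VC by blast
      qed
      then show ?thesis using I(2) by blast
    qed
    then show "\<forall>\<^sub>F n in sequentially. \<forall>h\<in>V n. dist (F (coset K (h + g)) \<omega>) (F (coset K g) \<omega>) < e"
      unfolding eventually_sequentially E_def by (intro exI[of _ N]) (fastforce simp: not_le)
  qed
qed

lemma continuous_integrable:
  fixes f :: "'g set \<Rightarrow> 'e::euclidean_space"
  assumes f: "continuous_map (hom_space K) euclidean f"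
  shows "integrable \<mu> f"
proof -
  have "continuous_on UNIV (\<lambda>g. f (coset K g))"
    using f by (simp add: hom_space_def continuous_map_quotient_top o_def)
  then have "compact (range (\<lambda>g. f (coset K g)))"
    by (rule compact_continuous_image[OF _ compact_UNIV])
  then obtain B where "\<And>g. norm (f (coset K g)) \<le> B"
    using compact_imp_bounded bounded_iff by (metis rangeI)
  moreover have "f \<in> borel_measurable \<mu>"
    using measurable_borel_sigma_continuous[OF f]
    by (simp add: borel_sigma_euclidean measurable_cong_sets[OF sets_\<mu> refl])
  ultimately show ?thesis
    by (intro \<mu>.integrable_const_bound[where B = B]) (auto simp: topspace_hom_space intro!: AE_I2)
qed

text \<open>The \<open>W n\<close> are fixed before \<open>\<omega>\<close>, so that these averages
  can become pairings with deterministic sections. Full support keeps the denominators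
  positive.\<close>

lemma average_tendsto:
  fixes F :: "'g set \<Rightarrow> 'w \<Rightarrow> 'e::euclidean_space"
  assumes F: "(\<lambda>(x, \<omega>). F x \<omega>) \<in> borel_measurable (\<mu> \<Otimes>\<^sub>M P)"
  obtains W :: "nat \<Rightarrow> 'g set set" where "\<And>n. openin (hom_space K) (W n)" "\<And>n. 0 < measure \<mu> (W n)"
    "\<And>\<omega>. \<omega> \<in> space P \<Longrightarrow> continuous_map (hom_space K) euclidean (\<lambda>x. F x \<omega>) \<Longrightarrow>
      (\<lambda>n. (LINT x|\<mu>. indicator (W n) x *\<^sub>R F x \<omega>) /\<^sub>R measure \<mu> (W n)) \<longlonglongrightarrow> F (coset K g) \<omega>"
proof -
  obtain V where V: "\<And>n. open (V n)" "\<And>n. 0 \<in> V n"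
    "\<And>\<omega> g e. \<omega> \<in> space P \<Longrightarrow> continuous_map (hom_space K) euclidean (\<lambda>x. F x \<omega>) \<Longrightarrow> 0 < e \<Longrightarrow>
      \<forall>\<^sub>F n in sequentially. \<forall>h\<in>V n. dist (F (coset K (h + g)) \<omega>) (F (coset K g) \<omega>) < e"
    using shrinking_neighbourhoods[OF F] by blast
  \<comment> \<open>The preimage is the right translate of \<open>V n\<close> by \<open>g\<close>, a
    neighbourhood of \<open>g\<close>; the coset map is open.\<close>
  define W where "W n = coset K ` (\<lambda>h. h - g) -` V n" for n
  have W: "openin (hom_space K) (W n)" for n
    unfolding W_def by (intro openin_coset_image open_vimage V(1) continuous_intros)
  have gW: "coset K g \<in> W n" for n
    unfolding W_def using V(2) by auto
  have pos: "0 < measure \<mu> (W n)" for n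
    using emeasure_open_pos[OF W gW] by (simp add: \<mu>.emeasure_eq_measure zero_less_measure_iff)
  have Wm [measurable]: "W n \<in> sets \<mu>" for n by (rule openin_sets_\<mu>[OF W])
  show thesis
  proof (rule that[OF W pos])
    fix \<omega> assume \<omega>: "\<omega> \<in> space P" "continuous_map (hom_space K) euclidean (\<lambda>x. F x \<omega>)"
    show "(\<lambda>n. (LINT x|\<mu>. indicator (W n) x *\<^sub>R F x \<omega>) /\<^sub>R measure \<mu> (W n)) \<longlonglongrightarrow> F (coset K g) \<omega>"
    proof (rule tendstoI)
      fix e :: real assume "e > 0"
      then have "\<forall>\<^sub>F n in sequentially. \<forall>h\<in>V n. dist (F (coset K (h + g)) \<omega>) (F (coset K g) \<omega>) < e / 2"
        by (intro V(3) \<omega>) simp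
      then show "\<forall>\<^sub>F n in sequentially.
          dist ((LINT x|\<mu>. indicator (W n) x *\<^sub>R F x \<omega>) /\<^sub>R measure \<mu> (W n)) (F (coset K g) \<omega>) < e"
      proof eventually_elim
        case (elim n)
        have close: "norm (F x \<omega> - F (coset K g) \<omega>) \<le> e / 2" if xW: "x \<in> W n" for x
        proof -
          obtain h where "x = coset K h" "h - g \<in> V n" using xW by (auto simp: W_def)
          then show ?thesis using elim[rule_format, of "h - g"] by (simp add: dist_norm)
        qed
        have i: "integrable \<mu> (\<lambda>x. indicator (W n) x *\<^sub>R F x \<omega>)" "integrable \<mu> (\<lambda>x. indicator (W n) x *\<^sub>R F (coset K g) \<omega>)"
          using continuous_integrable[OF \<omega>(2)] by (auto intro!: integrable_mult_indicator)
        have ind: "integrable \<mu> (indicator (W n) :: _ \<Rightarrow> real)" "(LINT x|\<mu>. indicator (W n) x) = measure \<mu> (W n)"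
          using sets.sets_into_space[OF Wm[of n]] by (simp_all add: Int_absorb2 less_top[symmetric])
        have "(LINT x|\<mu>. indicator (W n) x *\<^sub>R F x \<omega>) - measure \<mu> (W n) *\<^sub>R F (coset K g) \<omega>
            = (LINT x|\<mu>. indicator (W n) x *\<^sub>R (F x \<omega> - F (coset K g) \<omega>))"
          using Bochner_Integration.integral_diff[OF i] ind
          by (simp add: scaleR_diff_right)
        also have "norm \<dots> \<le> (LINT x|\<mu>. norm (indicator (W n) x *\<^sub>R (F x \<omega> - F (coset K g) \<omega>)))"
          by (rule integral_norm_bound)
        also have "\<dots> \<le> (LINT x|\<mu>. e / 2 * indicator (W n) x)"
        proof (rule integral_mono)
          show "integrable \<mu> (\<lambda>x. norm (indicator (W n) x *\<^sub>R (F x \<omega> - F (coset K g) \<omega>)))"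
            using Bochner_Integration.integrable_diff[OF i] by (intro integrable_norm) (simp add: scaleR_diff_right)
          show "integrable \<mu> (\<lambda>x. e / 2 * indicator (W n) x)"
            using ind(1) by (rule Bochner_Integration.integrable_mult_right)
          show "norm (indicator (W n) x *\<^sub>R (F x \<omega> - F (coset K g) \<omega>)) \<le> e / 2 * indicator (W n) x" for x
            using close[of x] by (auto simp: indicator_def)
        qed
        also have "\<dots> = e / 2 * measure \<mu> (W n)"
          using ind(2) by (simp only: Bochner_Integration.integral_mult_right_zero)
        finally have "norm ((LINT x|\<mu>. indicator (W n) x *\<^sub>R F x \<omega>) - measure \<mu> (W n) *\<^sub>R F (coset K g) \<omega>) \<le> e / 2 * measure \<mu> (W n)" .
        moreover have "(LINT x|\<mu>. indicator (W n) x *\<^sub>R F x \<omega>) /\<^sub>R measure \<mu> (W n) - F (coset K g) \<omega>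
          = ((LINT x|\<mu>. indicator (W n) x *\<^sub>R F x \<omega>) - measure \<mu> (W n) *\<^sub>R F (coset K g) \<omega>) /\<^sub>R measure \<mu> (W n)"
          using pos[of n] by (simp add: scaleR_diff_right)
        ultimately have "dist ((LINT x|\<mu>. indicator (W n) x *\<^sub>R F x \<omega>) /\<^sub>R measure \<mu> (W n)) (F (coset K g) \<omega>) \<le> e / 2"
          unfolding dist_norm using pos[of n] by (simp only: norm_scaleR abs_inverse abs_of_pos) (simp add: inverse_eq_divide pos_divide_le_eq)
        then show ?case using \<open>e > 0\<close> by simp
      qed
    qed
  qed
qed

end

section \<open>Test sections\<close>

context homogeneous_bundle
begin

definition section_along :: "('g \<Rightarrow> 'h) \<Rightarrow> 'g set \<Rightarrow> ('g \<times> 'h) set" where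
  "section_along s x = (THE \<eta>. \<exists>g. x = coset K g \<and> \<eta> = orbit K tau g (s g))"

lemma section_along_coset:
  assumes "equivariant s"
  shows "section_along s (coset K g) = orbit K tau g (s g)"
  unfolding section_along_def
proof (rule the_equality)
  show "\<exists>h. coset K g = coset K h \<and> orbit K tau g (s g) = orbit K tau h (s h)" by blast
next
  fix \<eta> assume "\<exists>h. coset K g = coset K h \<and> \<eta> = orbit K tau h (s h)"
  then obtain h where h: "- g + h \<in> K" "\<eta> = orbit K tau h (s h)" by (auto simp: coset_eq_iff)
  have "s h = tau (- (- g + h)) (s g)"
    using equivariantD[OF assms h(1), of g] by (simp add: add.assoc[symmetric] del: minus_add)
  then show "\<eta> = orbit K tau g (s g)"
    using h orbit_add[OF h(1), of g "s h"] by (simp add: add.assoc[symmetric] del: minus_add)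
qed

lemma continuous_map_section_along:
  assumes s: "equivariant s"
  shows "continuous_map (hom_space K) (total_space K tau) (section_along s)"
proof -
  have "continuous_map euclidean (total_space K tau) ((\<lambda>(g, z). orbit K tau g z) \<circ> (\<lambda>g. (g, s g)))"
    using equivariant_continuous[OF s]
    by (intro continuous_map_compose[OF _ continuous_map_orbit]) (auto intro!: continuous_intros)
  moreover have "section_along s \<circ> coset K = (\<lambda>(g, z). orbit K tau g z) \<circ> (\<lambda>g. (g, s g))"
    by (auto simp: section_along_coset[OF s])
  ultimately show ?thesis
    by (subst hom_space_def) (simp add: continuous_map_quotient_top)
qed

text \<open>Kept apart from square integrability: \<open>pairing_measurable\<close> and
  \<open>pairing_act\<close> rest on measurability alone.\<close>

definition measurable_section :: "('g set \<Rightarrow> ('g \<times> 'h) set) \<Rightarrow> bool" where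
  "measurable_section u \<longleftrightarrow> is_section K tau u \<and> u \<in> \<mu> \<rightarrow>\<^sub>M borel_sigma (total_space K tau)"

lemma measurable_sectionD:
  assumes "measurable_section u"
  shows "u \<in> \<mu> \<rightarrow>\<^sub>M borel_sigma (total_space K tau)"
    and "x \<in> topspace (hom_space K) \<Longrightarrow> u x \<in> topspace (total_space K tau)"
    and "x \<in> topspace (hom_space K) \<Longrightarrow> bundle_proj (u x) = x"
  using assms by (auto simp: measurable_section_def is_section_def)

lemma square_integrable_section_iff:
  "square_integrable_section cinner K tau \<mu> u \<longleftrightarrow>
    measurable_section u \<and> integrable \<mu> (\<lambda>x. (fib_norm cinner K tau (u x))\<^sup>2)"
  by (simp add: square_integrable_section_def measurable_section_def measurable_cong_sets[OF sets_\<mu> refl])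

lemma measurable_section_along:
  assumes s: "equivariant s"
  shows "measurable_section (section_along s)"
  unfolding measurable_section_def
proof
  show "is_section K tau (section_along s)"
    unfolding is_section_def by (auto simp: topspace_hom_space section_along_coset[OF s] bundle_proj_orbit)
  show "section_along s \<in> \<mu> \<rightarrow>\<^sub>M borel_sigma (total_space K tau)"
    using measurable_borel_sigma_continuous[OF continuous_map_section_along[OF s]]
    by (simp add: measurable_cong_sets[OF sets_\<mu> refl])
qed

lemma act_section_act_space: "act_section h u (act_space h x) = act_bundle h (u x)"
  by (simp add: act_section_def act_space_cancel)

lemma measurable_section_act:
  assumes u: "measurable_section u"
  shows "measurable_section (act_section h u)"
  unfolding measurable_section_def
proof
  show "is_section K tau (act_section h u)"
    using measurable_sectionD[OF u]
    by (auto simp: is_section_def act_section_def bundle_proj_act act_space_cancel)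
  show "act_section h u \<in> \<mu> \<rightarrow>\<^sub>M borel_sigma (total_space K tau)"
    unfolding act_section_def
    by (rule measurable_compose[OF measurable_compose[OF act_space_measurable measurable_sectionD(1)[OF u]]
          measurable_borel_sigma_continuous[OF continuous_map_act_bundle]])
qed

lemma fib_norm_act: "\<eta> \<in> topspace (total_space K tau) \<Longrightarrow> fib_norm cinner K tau (act_bundle h \<eta>) = fib_norm cinner K tau \<eta>"
  by (simp add: fib_norm_def fib_inner_act)

lemma borel_measurable_fib_norm_section:
  "measurable_section u \<Longrightarrow> (\<lambda>x. fib_norm cinner K tau (u x)) \<in> borel_measurable \<mu>"
  by (rule measurable_compose[OF measurable_sectionD(1) measurable_fib_norm])

lemma square_integrable_section_act:
  assumes u: "square_integrable_section cinner K tau \<mu> u"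
  shows "square_integrable_section cinner K tau \<mu> (act_section h u)"
proof -
  have u': "measurable_section u" "integrable \<mu> (\<lambda>x. (fib_norm cinner K tau (u x))\<^sup>2)"
    using u by (auto simp: square_integrable_section_iff)
  have "integrable (distr \<mu> \<mu> (act_space (- h))) (\<lambda>x. (fib_norm cinner K tau (u x))\<^sup>2)"
    using u'(2) by (simp add: distr_act_space)
  then have "integrable \<mu> (\<lambda>x. (fib_norm cinner K tau (u (act_space (- h) x)))\<^sup>2)"
    by (rule integrable_distr[OF act_space_measurable])
  moreover have "fib_norm cinner K tau (act_section h u x) = fib_norm cinner K tau (u (act_space (- h) x))"
    if "x \<in> space \<mu>" for x
    unfolding act_section_def using that by (intro fib_norm_act measurable_sectionD[OF u'(1)]) simp
  then have "integrable \<mu> (\<lambda>x. (fib_norm cinner K tau (act_section h u x))\<^sup>2) \<longleftrightarrow>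
      integrable \<mu> (\<lambda>x. (fib_norm cinner K tau (u (act_space (- h) x)))\<^sup>2)"
    by (intro Bochner_Integration.integrable_cong) simp_all
  ultimately have "integrable \<mu> (\<lambda>x. (fib_norm cinner K tau (act_section h u x))\<^sup>2)"
    by simp
  then show ?thesis
    using measurable_section_act[OF u'(1)] by (simp add: square_integrable_section_iff)
qed

text \<open>These cut-off sections are the ones against which \<open>T\<close> is averaged. Each
  fibre has its own zero, so the value outside \<open>W\<close> is given by the zero section
  \<open>section_along (\<lambda>_. 0)\<close>.\<close>

lemma square_integrable_section_indicator:
  assumes s: "equivariant s" and W: "W \<in> sets \<mu>"
  shows "square_integrable_section cinner K tau \<mu> (\<lambda>x. if x \<in> W then section_along s x else section_along (\<lambda>_. 0) x)"
    (is "square_integrable_section _ _ _ _ ?u")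
proof -
  note z = equivariant_zero
  note m = measurable_sectionD[OF measurable_section_along[OF s]] measurable_sectionD[OF measurable_section_along[OF z]]
  have "?u \<in> \<mu> \<rightarrow>\<^sub>M borel_sigma (total_space K tau)"
    using m(1,4) W sets.Int_space_eq2[OF W] by (intro measurable_If_set) auto
  then have u: "measurable_section ?u"
    using m(2,3,5,6) by (auto simp: measurable_section_def is_section_def)
  have "integrable \<mu> (\<lambda>x. (fib_norm cinner K tau (section_along s x))\<^sup>2)"
  proof (rule continuous_integrable)
    have "continuous_map (hom_space K) euclidean (\<lambda>x. fib_norm cinner K tau (section_along s x))"
      using continuous_map_compose[OF continuous_map_section_along[OF s] continuous_map_fib_norm] by (simp add: o_def)
    then show "continuous_map (hom_space K) euclidean (\<lambda>x. (fib_norm cinner K tau (section_along s x))\<^sup>2)"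
      by (rule continuous_map_real_pow)
  qed
  then have "integrable \<mu> (\<lambda>x. (fib_norm cinner K tau (?u x))\<^sup>2)"
  proof (rule Bochner_Integration.integrable_bound)
    show "(\<lambda>x. (fib_norm cinner K tau (?u x))\<^sup>2) \<in> borel_measurable \<mu>"
      using borel_measurable_fib_norm_section[OF u] by (rule borel_measurable_power)
    show "AE x in \<mu>. norm ((fib_norm cinner K tau (?u x))\<^sup>2) \<le> norm ((fib_norm cinner K tau (section_along s x))\<^sup>2)"
      by (intro AE_I2) (auto simp: topspace_hom_space section_along_coset s z fib_norm_orbit)
  qed
  with u show ?thesis by (simp add: square_integrable_section_iff)
qed

end

section \<open>Random sections\<close>

locale random_bundle_section = homogeneous_bundle scaleC cinner K tau \<mu> + P: prob_space P
  for scaleC :: "complex \<Rightarrow> 'h::euclidean_space \<Rightarrow> 'h"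
    and cinner :: "'h \<Rightarrow> 'h \<Rightarrow> complex"
    and K :: "'g::{topological_group_add,t2_space} set"
    and tau :: "'g \<Rightarrow> 'h \<Rightarrow> 'h"
    and \<mu> :: "'g set measure"
    and P :: "'w measure" +
  fixes T :: "'g set \<Rightarrow> 'w \<Rightarrow> ('g \<times> 'h) set"
  assumes random_section: "random_section K tau P T"
    and square_integrable: "square_integrable_random cinner K tau \<mu> P T"
begin

abbreviation ip where "ip \<equiv> fib_inner cinner K tau"
abbreviation pairing where "pairing \<equiv> section_pairing cinner K tau \<mu> T"
abbreviation Y where "Y \<equiv> scalar_field cinner K tau T"

lemma T_in: "x \<in> topspace (hom_space K) \<Longrightarrow> \<omega> \<in> space P \<Longrightarrow> T x \<omega> \<in> topspace (total_space K tau)"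
  and bundle_proj_T: "x \<in> topspace (hom_space K) \<Longrightarrow> \<omega> \<in> space P \<Longrightarrow> bundle_proj (T x \<omega>) = x"
  using random_section by (auto simp: random_section_def is_section_def)

lemma T_measurable: "(\<lambda>(x, \<omega>). T x \<omega>) \<in> \<mu> \<Otimes>\<^sub>M P \<rightarrow>\<^sub>M borel_sigma (total_space K tau)"
  using random_section
  by (subst measurable_cong_sets[OF sets_pair_measure_cong[OF sets_\<mu> refl] refl]) (simp add: random_section_def)

lemma ip_T_measurable:
  assumes u: "measurable_section u"
  shows "(\<lambda>(x, \<omega>). ip (T x \<omega>) (u x)) \<in> borel_measurable (\<mu> \<Otimes>\<^sub>M P)"
proof -
  have "(\<lambda>p. ip ((\<lambda>(x, \<omega>). T x \<omega>) p) (u (fst p))) \<in> borel_measurable (\<mu> \<Otimes>\<^sub>M P)"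
  proof (rule borel_measurable_fib_inner[OF T_measurable])
    show "(\<lambda>p. u (fst p)) \<in> \<mu> \<Otimes>\<^sub>M P \<rightarrow>\<^sub>M borel_sigma (total_space K tau)"
      by (rule measurable_compose[OF measurable_fst measurable_sectionD(1)[OF u]])
    show "bundle_proj ((\<lambda>(x, \<omega>). T x \<omega>) p) = bundle_proj (u (fst p))" if "p \<in> space (\<mu> \<Otimes>\<^sub>M P)" for p
      using that by (auto simp: space_pair_measure bundle_proj_T measurable_sectionD[OF u])
  qed
  then show ?thesis by (simp add: case_prod_beta')
qed

lemma ip_T_act_measurable:
  assumes u: "measurable_section u"
  shows "(\<lambda>(x, \<omega>). ip (T (act_space h x) \<omega>) (act_bundle h (u x))) \<in> borel_measurable (\<mu> \<Otimes>\<^sub>M P)"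
proof -
  have "(\<lambda>(x, \<omega>). (act_space h x, \<omega>)) \<in> \<mu> \<Otimes>\<^sub>M P \<rightarrow>\<^sub>M \<mu> \<Otimes>\<^sub>M P"
    by measurable
  from measurable_compose[OF this ip_T_measurable[OF measurable_section_act[OF u, of h]]]
  show ?thesis by (simp add: act_section_act_space case_prod_beta')
qed

lemma pairing_measurable:
  assumes u: "measurable_section u"
  shows "pairing u \<in> borel_measurable P"
proof -
  have [measurable]: "(\<lambda>(x, \<omega>). ip (T x \<omega>) (u x)) \<in> borel_measurable (\<mu> \<Otimes>\<^sub>M P)"
    by (rule ip_T_measurable[OF u])
  have "(\<lambda>\<omega>. LINT x|\<mu>. ip (T x \<omega>) (u x)) \<in> borel_measurable P"
    by measurable
  then show ?thesis
    by (simp add: section_pairing_def[abs_def])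
qed

text \<open>Invariance of \<open>\<mu>\<close> allows \<open>act_space h x\<close> to be substituted
  for \<open>x\<close>. The pairings of \<open>u\<close> and of its translate then integrate over
  the same \<open>x\<close>, with integrands that are conjugates of the scalar field at
  \<open>u x\<close> and at its translate.\<close>

lemma pairing_act:
  assumes u: "measurable_section u" and \<omega>: "\<omega> \<in> space P"
  shows "pairing (act_section h u) \<omega> = (LINT x|\<mu>. ip (T (act_space h x) \<omega>) (act_bundle h (u x)))"
proof -
  have "(\<lambda>x. ip (T x \<omega>) (act_section h u x)) \<in> borel_measurable \<mu>"
    using measurable_compose[OF measurable_Pair2'[OF \<omega>] ip_T_measurable[OF measurable_section_act[OF u, of h]]]
    by simp
  from integral_act_space[OF this, of h] show ?thesis
    by (simp add: section_pairing_def act_section_act_space)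
qed

text \<open>The scalar field has \<open>T\<close> in the second slot, the pairing has it in the
  first: this is the origin of the conjugates below.\<close>

lemma Y_eq:
  assumes "\<eta> \<in> topspace (total_space K tau)" "\<omega> \<in> space P"
  shows "Y \<eta> \<omega> = cnj (ip (T (bundle_proj \<eta>) \<omega>) \<eta>)"
  unfolding scalar_field_def using assms
  by (intro fib_inner_commute) (auto simp: bundle_proj_in T_in bundle_proj_T)

lemma Y_measurable:
  assumes "\<eta> \<in> topspace (total_space K tau)"
  shows "Y \<eta> \<in> borel_measurable P"
proof -
  have x: "bundle_proj \<eta> \<in> space \<mu>" using bundle_proj_in[OF assms] by simp
  have "(\<lambda>\<omega>. T (bundle_proj \<eta>) \<omega>) \<in> P \<rightarrow>\<^sub>M borel_sigma (total_space K tau)"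
    using measurable_compose[OF measurable_Pair1'[OF x] T_measurable] by simp
  then show ?thesis
    unfolding scalar_field_def[abs_def] using assms x
    by (intro borel_measurable_fib_inner) (auto simp: bundle_proj_T)
qed

text \<open>Cauchy-Schwarz in each fibre, and a b \<le> a^2 + b^2.\<close>

lemma AE_integrable_ip:
  assumes u: "square_integrable_section cinner K tau \<mu> u"
  shows "AE \<omega> in P. integrable \<mu> (\<lambda>x. ip (T x \<omega>) (u x))"
proof -
  have u': "measurable_section u" "integrable \<mu> (\<lambda>x. (fib_norm cinner K tau (u x))\<^sup>2)"
    using u by (auto simp: square_integrable_section_iff)
  have "AE \<omega> in P. integrable \<mu> (\<lambda>x. (fib_norm cinner K tau (T x \<omega>))\<^sup>2)"
    using square_integrable by (simp add: square_integrable_random_def)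
  then show ?thesis
    using AE_space
  proof eventually_elim
    case (elim \<omega>)
    have "integrable \<mu> (\<lambda>x. (fib_norm cinner K tau (T x \<omega>))\<^sup>2 + (fib_norm cinner K tau (u x))\<^sup>2)"
      using elim(1) u'(2) by (rule Bochner_Integration.integrable_add)
    then show ?case
    proof (rule Bochner_Integration.integrable_bound)
      show "(\<lambda>x. ip (T x \<omega>) (u x)) \<in> borel_measurable \<mu>"
        using measurable_compose[OF measurable_Pair2'[OF elim(2)] ip_T_measurable[OF u'(1)]] by simp
      have "norm (ip (T x \<omega>) (u x)) \<le> norm ((fib_norm cinner K tau (T x \<omega>))\<^sup>2 + (fib_norm cinner K tau (u x))\<^sup>2)"
        if x: "x \<in> topspace (hom_space K)" for x
      proof -
        have "norm (ip (T x \<omega>) (u x)) \<le> fib_norm cinner K tau (T x \<omega>) * fib_norm cinner K tau (u x)"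
          using x elim(2) by (intro norm_fib_inner_le) (auto simp: T_in bundle_proj_T measurable_sectionD[OF u'(1)])
        also have "\<dots> \<le> (fib_norm cinner K tau (T x \<omega>))\<^sup>2 + (fib_norm cinner K tau (u x))\<^sup>2"
          using sum_squares_bound[of "fib_norm cinner K tau (T x \<omega>)" "fib_norm cinner K tau (u x)"]
            zero_le_power2[of "fib_norm cinner K tau (T x \<omega>)"] zero_le_power2[of "fib_norm cinner K tau (u x)"]
          by linarith
        finally show ?thesis by simp
      qed
      then show "AE x in \<mu>. norm (ip (T x \<omega>) (u x)) \<le> norm ((fib_norm cinner K tau (T x \<omega>))\<^sup>2 + (fib_norm cinner K tau (u x))\<^sup>2)"
        by (intro AE_I2) simp
    qed
  qed
qed

lemma AE_integrable_ip_act: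
  assumes u: "square_integrable_section cinner K tau \<mu> u"
  shows "AE \<omega> in P. integrable \<mu> (\<lambda>x. ip (T (act_space h x) \<omega>) (act_bundle h (u x)))"
  using AE_integrable_ip[OF square_integrable_section_act[OF u, of h]]
proof eventually_elim
  case (elim \<omega>)
  then have "integrable (distr \<mu> \<mu> (act_space h)) (\<lambda>x. ip (T x \<omega>) (act_section h u x))"
    by (simp add: distr_act_space)
  from integrable_distr[OF act_space_measurable this] show ?case
    by (simp add: act_section_act_space)
qed

end

section \<open>Isotropy and invariance\<close>

context random_bundle_section
begin

text \<open>Invariance in list form, as the Fubini argument of \<open>char_integral_eqI\<close>
  collects its points in a list. Repeated points do no harm, because joint laws are indexed by
  positions.\<close>

lemma G_invariant_char:
  assumes inv: "G_invariant K tau P Y" and ps: "\<And>c \<eta>. (c, \<eta>) \<in> set ps \<Longrightarrow> \<eta> \<in> topspace (total_space K tau)"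
  shows "(LINT \<omega>|P. iexp (Re (\<Sum>(c, \<eta>)\<leftarrow>ps. c * Y \<eta> \<omega>)))
    = (LINT \<omega>|P. iexp (Re (\<Sum>(c, \<eta>)\<leftarrow>ps. c * Y (act_bundle h \<eta>) \<omega>)))"
proof -
  define m where "m = length ps"
  define \<eta> where "\<eta> i = snd (ps ! i)" for i
  have \<eta>: "\<eta> i \<in> topspace (total_space K tau)" if "i < m" for i
    using ps[of "fst (ps ! i)" "snd (ps ! i)"] that by (simp add: \<eta>_def m_def)
  have "joint_law P m (\<lambda>i. Y (\<eta> i)) = joint_law P m (\<lambda>i. Y (act_bundle h (\<eta> i)))"
    using inv \<eta> by (simp add: G_invariant_def)
  moreover have "Y (\<eta> i) \<in> borel_measurable P" "Y (act_bundle h (\<eta> i)) \<in> borel_measurable P" if "i < m" for i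
    using \<eta>[OF that] by (simp_all add: Y_measurable)
  ultimately have eq: "(LINT \<omega>|P. iexp (Re (\<Sum>i<m. c i * Y (\<eta> i) \<omega>))) =
      (LINT \<omega>|P. iexp (Re (\<Sum>i<m. c i * Y (act_bundle h (\<eta> i)) \<omega>)))" for c
    using joint_law_eq_iff_char[OF P.prob_space_axioms, of m "\<lambda>i. Y (\<eta> i)" "\<lambda>i. Y (act_bundle h (\<eta> i))"] by blast
  have sum: "(\<Sum>(c, \<eta>)\<leftarrow>ps. c * f \<eta>) = (\<Sum>i<m. fst (ps ! i) * f (\<eta> i))" for f :: "('g \<times> 'h) set \<Rightarrow> complex"
    by (simp add: sum_list_sum_nth m_def \<eta>_def case_prod_beta' atLeast0LessThan)
  show ?thesis
    unfolding sum[of "\<lambda>\<eta>. Y \<eta> \<omega>" for \<omega>] sum[of "\<lambda>\<eta>. Y (act_bundle h \<eta>) \<omega>" for \<omega>] by (rule eq)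
qed

lemma isotropic_if_G_invariant:
  assumes inv: "G_invariant K tau P Y"
  shows "isotropic cinner K tau \<mu> P T"
  unfolding isotropic_def
proof (intro allI impI)
  fix h and m :: nat and u assume "\<forall>i<m. square_integrable_section cinner K tau \<mu> (u i)"
  then have u: "square_integrable_section cinner K tau \<mu> (u i)" and um: "measurable_section (u i)" if "i < m" for i
    using that by (auto simp: square_integrable_section_iff)
  \<comment> \<open>For fixed coefficients a combination of pairings is a single integral over the
    base, of \<open>R\<close> for the sections and of \<open>R'\<close> for their
    translates.\<close>
  define R where "R c x \<omega> = Re (\<Sum>i<m. c i * ip (T x \<omega>) (u i x))" for c x \<omega>
  define R' where "R' c x \<omega> = Re (\<Sum>i<m. c i * ip (T (act_space h x) \<omega>) (act_bundle h (u i x)))" for c x \<omega>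
  have Rm: "(\<lambda>(x, \<omega>). R c x \<omega>) \<in> borel_measurable (\<mu> \<Otimes>\<^sub>M P)" "(\<lambda>(x, \<omega>). R' c x \<omega>) \<in> borel_measurable (\<mu> \<Otimes>\<^sub>M P)" for c
  proof -
    have "(\<lambda>p. Re (\<Sum>i<m. c i * (\<lambda>(x, \<omega>). ip (T x \<omega>) (u i x)) p)) \<in> borel_measurable (\<mu> \<Otimes>\<^sub>M P)"
      by (intro measurable_compose[OF _ borel_measurable_Re] borel_measurable_sum borel_measurable_times borel_measurable_const ip_T_measurable um) simp
    then show "(\<lambda>(x, \<omega>). R c x \<omega>) \<in> borel_measurable (\<mu> \<Otimes>\<^sub>M P)"
      by (simp add: R_def case_prod_beta')
    have "(\<lambda>p. Re (\<Sum>i<m. c i * (\<lambda>(x, \<omega>). ip (T (act_space h x) \<omega>) (act_bundle h (u i x))) p)) \<in> borel_measurable (\<mu> \<Otimes>\<^sub>M P)"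
      by (intro measurable_compose[OF _ borel_measurable_Re] borel_measurable_sum borel_measurable_times borel_measurable_const ip_T_act_measurable um) simp
    then show "(\<lambda>(x, \<omega>). R' c x \<omega>) \<in> borel_measurable (\<mu> \<Otimes>\<^sub>M P)"
      by (simp add: R'_def case_prod_beta')
  qed
  have "AE \<omega> in P. \<forall>i<m. integrable \<mu> (\<lambda>x. ip (T x \<omega>) (u i x))"
    by (intro AE_all_countable[THEN iffD2] allI AE_impI AE_integrable_ip u)
  \<comment> \<open>Sum and integral are exchanged only where all summands are integrable; elsewhere
    a summand's integral is the default value 0. So the identity is an almost sure one.\<close>
  then have int: "AE \<omega> in P. integrable \<mu> (\<lambda>x. R c x \<omega>) \<and> Re (\<Sum>i<m. c i * pairing (u i) \<omega>) = (LINT x|\<mu>. R c x \<omega>)" for c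
  proof eventually_elim
    case (elim \<omega>)
    then have i: "integrable \<mu> (\<lambda>x. \<Sum>i<m. c i * ip (T x \<omega>) (u i x))" by auto
    have "(\<Sum>i<m. c i * pairing (u i) \<omega>) = (LINT x|\<mu>. (\<Sum>i<m. c i * ip (T x \<omega>) (u i x)))"
      using elim by (simp add: section_pairing_def)
    then show ?case
      unfolding R_def using integrable_Re[OF i] integral_Re[OF i] by (simp only: simp_thms)
  qed
  have "AE \<omega> in P. \<forall>i<m. integrable \<mu> (\<lambda>x. ip (T (act_space h x) \<omega>) (act_bundle h (u i x)))"
    by (intro AE_all_countable[THEN iffD2] allI AE_impI AE_integrable_ip_act u)
  then have int': "AE \<omega> in P. integrable \<mu> (\<lambda>x. R' c x \<omega>) \<and> Re (\<Sum>i<m. c i * pairing (act_section h (u i)) \<omega>) = (LINT x|\<mu>. R' c x \<omega>)" for c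
    using AE_space
  proof eventually_elim
    case (elim \<omega>)
    then have i: "integrable \<mu> (\<lambda>x. \<Sum>i<m. c i * ip (T (act_space h x) \<omega>) (act_bundle h (u i x)))" by auto
    have "(\<Sum>i<m. c i * pairing (act_section h (u i)) \<omega>) =
        (LINT x|\<mu>. (\<Sum>i<m. c i * ip (T (act_space h x) \<omega>) (act_bundle h (u i x))))"
      using elim by (simp add: pairing_act[OF um])
    then show ?case
      unfolding R'_def using integrable_Re[OF i] integral_Re[OF i] by (simp only: simp_thms)
  qed
  have chr: "(LINT \<omega>|P. iexp (LINT x|\<mu>. R c x \<omega>)) = (LINT \<omega>|P. iexp (LINT x|\<mu>. R' c x \<omega>))" for c
  proof (rule char_integral_eqI[OF \<mu>.prob_space_axioms P.prob_space_axioms Rm])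
    show "AE \<omega> in P. integrable \<mu> (\<lambda>x. R c x \<omega>)" "AE \<omega> in P. integrable \<mu> (\<lambda>x. R' c x \<omega>)"
      using int int' by (auto elim: eventually_mono)
    fix t and xs :: "'g set list" assume "set xs \<subseteq> space \<mu>"
    then have xs: "set xs \<subseteq> topspace (hom_space K)" by simp
    \<comment> \<open>A sum of \<open>R\<close> over base points is the real part of a combination
      of \<open>Y\<close> at the bundle points \<open>u i x\<close>. The coefficients are conjugated
      because \<open>Y\<close> is conjugate to \<open>ip\<close>; real parts do not change.\<close>
    define ps where "ps = concat (map (\<lambda>x. map (\<lambda>i. (complex_of_real t * cnj (c i), u i x)) [0..<m]) xs)"
    have ps: "\<eta> \<in> topspace (total_space K tau)" if "(c, \<eta>) \<in> set ps" for c \<eta>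
      using that xs by (auto simp: ps_def intro!: measurable_sectionD(2)[OF um])
    have Rc: "Re (complex_of_real t * cnj a * cnj b) = t * Re (a * b)" for a b
      by (simp add: algebra_simps)
    have sum: "Re (\<Sum>(c, \<eta>)\<leftarrow>ps. c * Y \<eta> \<omega>) = t * (\<Sum>x\<leftarrow>xs. R c x \<omega>)" if \<omega>: "\<omega> \<in> space P" for \<omega>
      using xs unfolding ps_def
    proof (induction xs)
      case (Cons x xs)
      have "(\<Sum>i\<leftarrow>[0..<m]. complex_of_real t * cnj (c i) * Y (u i x) \<omega>) = (\<Sum>i<m. complex_of_real t * cnj (c i) * cnj (ip (T x \<omega>) (u i x)))"
        using Cons.prems \<omega> by (simp add: interv_sum_list_conv_sum_set_nat atLeast0LessThan Y_eq measurable_sectionD[OF um])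
      then have "Re (\<Sum>i\<leftarrow>[0..<m]. complex_of_real t * cnj (c i) * Y (u i x) \<omega>) = t * R c x \<omega>"
        by (simp only: Re_sum Rc R_def sum_distrib_left)
      then show ?case
        using Cons by (simp add: o_def distrib_left)
    qed simp
    have sum': "Re (\<Sum>(c, \<eta>)\<leftarrow>ps. c * Y (act_bundle h \<eta>) \<omega>) = t * (\<Sum>x\<leftarrow>xs. R' c x \<omega>)" if \<omega>: "\<omega> \<in> space P" for \<omega>
      using xs unfolding ps_def
    proof (induction xs)
      case (Cons x xs)
      have "(\<Sum>i\<leftarrow>[0..<m]. complex_of_real t * cnj (c i) * Y (act_bundle h (u i x)) \<omega>) = (\<Sum>i<m. complex_of_real t * cnj (c i) * cnj (ip (T (act_space h x) \<omega>) (act_bundle h (u i x))))"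
        using Cons.prems \<omega> by (simp add: interv_sum_list_conv_sum_set_nat atLeast0LessThan Y_eq measurable_sectionD[OF um] bundle_proj_act)
      then have "Re (\<Sum>i\<leftarrow>[0..<m]. complex_of_real t * cnj (c i) * Y (act_bundle h (u i x)) \<omega>) = t * R' c x \<omega>"
        by (simp only: Re_sum Rc R'_def sum_distrib_left)
      then show ?case
        using Cons by (simp add: o_def distrib_left)
    qed simp
    have "(LINT \<omega>|P. iexp (t * (\<Sum>x\<leftarrow>xs. R c x \<omega>))) = (LINT \<omega>|P. iexp (Re (\<Sum>(c, \<eta>)\<leftarrow>ps. c * Y \<eta> \<omega>)))"
      by (intro Bochner_Integration.integral_cong) (simp_all only: sum)
    also have "\<dots> = (LINT \<omega>|P. iexp (Re (\<Sum>(c, \<eta>)\<leftarrow>ps. c * Y (act_bundle h \<eta>) \<omega>)))"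
      by (rule G_invariant_char[OF inv ps])
    also have "\<dots> = (LINT \<omega>|P. iexp (t * (\<Sum>x\<leftarrow>xs. R' c x \<omega>)))"
      by (intro Bochner_Integration.integral_cong) (simp_all only: sum')
    finally show "(LINT \<omega>|P. iexp (t * (\<Sum>x\<leftarrow>xs. R c x \<omega>))) = (LINT \<omega>|P. iexp (t * (\<Sum>x\<leftarrow>xs. R' c x \<omega>)))" .
  qed
  have pm: "pairing (u i) \<in> borel_measurable P" "pairing (act_section h (u i)) \<in> borel_measurable P" if "i < m" for i
    using um[OF that] by (simp_all add: pairing_measurable measurable_section_act)
  show "joint_law P m (\<lambda>i. pairing (u i)) = joint_law P m (\<lambda>i. pairing (act_section h (u i)))"
  proof (rule joint_law_eq_iff_char[THEN iffD2, OF P.prob_space_axioms pm], assumption, assumption, rule allI)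
    fix c
    have Zm: "(\<lambda>\<omega>. Re (\<Sum>i<m. c i * pairing (u i) \<omega>)) \<in> borel_measurable P"
      "(\<lambda>\<omega>. Re (\<Sum>i<m. c i * pairing (act_section h (u i)) \<omega>)) \<in> borel_measurable P"
      using pm by (intro measurable_compose[OF _ borel_measurable_Re] borel_measurable_sum
          borel_measurable_times borel_measurable_const; simp)+
    note Rm(1)[of c, measurable] Rm(2)[of c, measurable]
    have Im: "(\<lambda>\<omega>. LINT x|\<mu>. R c x \<omega>) \<in> borel_measurable P" "(\<lambda>\<omega>. LINT x|\<mu>. R' c x \<omega>) \<in> borel_measurable P"
      by measurable
    have em: "(\<lambda>\<omega>. iexp (f \<omega>)) \<in> borel_measurable P" if "f \<in> borel_measurable P" for f
      using that by measurable
    have "(LINT \<omega>|P. iexp (Re (\<Sum>i<m. c i * pairing (u i) \<omega>))) = (LINT \<omega>|P. iexp (LINT x|\<mu>. R c x \<omega>))"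
      by (intro integral_cong_AE em Zm Im) (rule eventually_mono[OF int[of c]], simp only:)
    also have "\<dots> = (LINT \<omega>|P. iexp (LINT x|\<mu>. R' c x \<omega>))" by (rule chr)
    also have "\<dots> = (LINT \<omega>|P. iexp (Re (\<Sum>i<m. c i * pairing (act_section h (u i)) \<omega>)))"
      by (intro integral_cong_AE em Zm Im) (rule eventually_mono[OF int'[of c]], simp only:)
    finally show "(LINT \<omega>|P. iexp (Re (\<Sum>i<m. c i * pairing (u i) \<omega>))) =
        (LINT \<omega>|P. iexp (Re (\<Sum>i<m. c i * pairing (act_section h (u i)) \<omega>)))" .
  qed
qed

text \<open>By unitarity \<open>cinner z (s g)\<close> is constant on orbits, so the product with a
  fixed continuous section is a continuous function on the total space.\<close>

lemma continuous_map_ip_section_along: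
  assumes s: "equivariant s" and f: "continuous_map (hom_space K) (total_space K tau) f"
    and base: "\<And>x. x \<in> topspace (hom_space K) \<Longrightarrow> bundle_proj (f x) = x"
  shows "continuous_map (hom_space K) euclidean (\<lambda>x. ip (f x) (section_along s x))"
proof -
  have inv: "cinner (tau (- k) z) (s (g + k)) = cinner z (s g)" if "k \<in> K" for g z k
    using that by (simp add: equivariantD[OF s] tau_unitary K_minus)
  have "continuous_map (total_space K tau) euclidean (descend (\<lambda>g z. cinner z (s g)))"
    by (intro continuous_map_descend inv bounded_bilinear.continuous_on[OF bounded_bilinear_cinner]
        continuous_on_compose2[OF equivariant_continuous[OF s]] continuous_intros) auto
  from continuous_map_compose[OF f this]
  show ?thesis
  proof (rule continuous_map_eq)
    fix x assume x: "x \<in> topspace (hom_space K)"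
    then obtain g where g: "x = coset K g" by (auto simp: topspace_hom_space)
    have "f x \<in> topspace (total_space K tau)" using f x by (auto simp: continuous_map_def)
    then obtain z where "f x = orbit K tau g z"
      using fibre_unique_rep[of "f x" g] base[OF x] g by blast
    then show "(descend (\<lambda>g z. cinner z (s g)) \<circ> f) x = ip (f x) (section_along s x)"
      using descend_orbit[of "\<lambda>g z. cinner z (s g)", OF inv]
      by (simp add: g section_along_coset[OF s] fib_inner_orbit)
  qed
qed

lemma G_invariant_if_isotropic:
  assumes cont: "as_continuous K tau P T" and iso: "isotropic cinner K tau \<mu> P T"
  shows "G_invariant K tau P Y"
  unfolding G_invariant_def
proof (intro allI impI)
  fix h and m :: nat and \<eta> assume "\<forall>i<m. \<eta> i \<in> topspace (total_space K tau)"
  then have \<eta>: "\<eta> i \<in> topspace (total_space K tau)" if "i < m" for i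
    using that by blast
  \<comment> \<open>The product with \<open>\<eta> i\<close> makes sense in one fibre only; a
    continuous section through \<open>\<eta> i\<close> spreads it to a function on the whole
    base.\<close>
  have "\<exists>g s. equivariant s \<and> \<eta> i = orbit K tau g (s g)" if i: "i < m" for i
  proof -
    obtain g z where "\<eta> i = orbit K tau g z" using \<eta>[OF i] by (auto simp: topspace_total_space)
    moreover obtain s where "equivariant s" "s g = z" by (rule equivariant_through)
    ultimately show ?thesis by blast
  qed
  then obtain g s where s: "\<And>i. i < m \<Longrightarrow> equivariant (s i)" and \<eta>s: "\<And>i. i < m \<Longrightarrow> \<eta> i = orbit K tau (g i) (s i (g i))"
    by metis
  note sm = measurable_section_along[OF s]
  \<comment> \<open>Pairing the product with its translate yields one sequence of neighbourhoods for
    both, so that the same cut-off section and its translate approximate the two values.\<close>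
  define F where "F i x \<omega> = (ip (T x \<omega>) (section_along (s i) x),
      ip (T (act_space h x) \<omega>) (act_bundle h (section_along (s i) x)))" for i x \<omega>
  have Fm: "(\<lambda>(x, \<omega>). F i x \<omega>) \<in> borel_measurable (\<mu> \<Otimes>\<^sub>M P)" if "i < m" for i
    using borel_measurable_Pair[OF ip_T_measurable[OF sm[OF that]] ip_T_act_measurable[OF sm[OF that], of h]]
    by (simp add: F_def case_prod_beta')
  have Fc: "AE \<omega> in P. \<forall>i<m. continuous_map (hom_space K) euclidean (\<lambda>x. F i x \<omega>)"
  proof -
    have "AE \<omega> in P. continuous_map (hom_space K) (total_space K tau) (\<lambda>x. T x \<omega>)"
      using cont by (simp add: as_continuous_def)
    then show ?thesis
      using AE_space
    proof eventually_elim
      case (elim \<omega>)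
      show ?case
      proof (intro allI impI)
        fix i assume i: "i < m"
        have 1: "continuous_map (hom_space K) euclidean (\<lambda>x. ip (T x \<omega>) (section_along (s i) x))"
          using elim by (intro continuous_map_ip_section_along s i bundle_proj_T)
        \<comment> \<open>Translated back by \<open>- h\<close>, the shifted path is again a section
          over \<open>x\<close>, to which the continuity lemma applies; the fibre product is
          unaffected by the action.\<close>
        have "continuous_map (hom_space K) (total_space K tau) (\<lambda>x. act_bundle (- h) (T (act_space h x) \<omega>))"
          using continuous_map_compose[OF continuous_map_compose[OF continuous_map_act_space elim(1)] continuous_map_act_bundle]
          by (simp add: o_def)
        then have "continuous_map (hom_space K) euclidean (\<lambda>x. ip (act_bundle (- h) (T (act_space h x) \<omega>)) (section_along (s i) x))"
          using elim by (intro continuous_map_ip_section_along s i) (simp_all add: bundle_proj_act bundle_proj_T act_space_cancel)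
        then have 2: "continuous_map (hom_space K) euclidean (\<lambda>x. ip (T (act_space h x) \<omega>) (act_bundle h (section_along (s i) x)))"
        proof (rule continuous_map_eq)
          fix x assume x: "x \<in> topspace (hom_space K)"
          have "act_bundle h (act_bundle (- h) (T (act_space h x) \<omega>)) = T (act_space h x) \<omega>"
            by (auto simp: act_bundle_def image_image case_prod_beta' add.assoc[symmetric])
          then show "ip (act_bundle (- h) (T (act_space h x) \<omega>)) (section_along (s i) x)
              = ip (T (act_space h x) \<omega>) (act_bundle h (section_along (s i) x))"
            using x elim(2) fib_inner_act[of "act_bundle (- h) (T (act_space h x) \<omega>)" "section_along (s i) x" h]
            by (simp add: T_in bundle_proj_T bundle_proj_act act_space_cancel measurable_sectionD[OF sm[OF i]])
        qed
        have "continuous_on UNIV (\<lambda>g. (F i (coset K g) \<omega>))"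
          using 1 2 unfolding F_def hom_space_def continuous_map_quotient_top o_def
          by (intro continuous_on_Pair) simp_all
        then show "continuous_map (hom_space K) euclidean (\<lambda>x. F i x \<omega>)"
          by (simp add: hom_space_def continuous_map_quotient_top o_def)
      qed
    qed
  qed
  have "\<exists>W. (\<forall>n. openin (hom_space K) (W n) \<and> 0 < measure \<mu> (W n)) \<and>
      (\<forall>\<omega>\<in>space P. continuous_map (hom_space K) euclidean (\<lambda>x. F i x \<omega>) \<longrightarrow>
      (\<lambda>n. (LINT x|\<mu>. indicator (W n) x *\<^sub>R F i x \<omega>) /\<^sub>R measure \<mu> (W n)) \<longlonglongrightarrow> F i (coset K (g i)) \<omega>)" if "i < m" for i
    by (rule average_tendsto[OF Fm[OF that], of "g i"]) blast
  then have "\<forall>i. \<exists>W. i < m \<longrightarrow> ((\<forall>n. openin (hom_space K) (W n) \<and> 0 < measure \<mu> (W n)) \<and>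
      (\<forall>\<omega>\<in>space P. continuous_map (hom_space K) euclidean (\<lambda>x. F i x \<omega>) \<longrightarrow>
      (\<lambda>n. (LINT x|\<mu>. indicator (W n) x *\<^sub>R F i x \<omega>) /\<^sub>R measure \<mu> (W n)) \<longlonglongrightarrow> F i (coset K (g i)) \<omega>))"
    by blast
  from choice[OF this] obtain W where W: "\<forall>i<m. ((\<forall>n. openin (hom_space K) (W i n) \<and> 0 < measure \<mu> (W i n)) \<and>
      (\<forall>\<omega>\<in>space P. continuous_map (hom_space K) euclidean (\<lambda>x. F i x \<omega>) \<longrightarrow>
      (\<lambda>n. (LINT x|\<mu>. indicator (W i n) x *\<^sub>R F i x \<omega>) /\<^sub>R measure \<mu> (W i n)) \<longlonglongrightarrow> F i (coset K (g i)) \<omega>))"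
    by (rule exE)
  define u where "u i n x = (if x \<in> W i n then section_along (s i) x else section_along (\<lambda>_. 0) x)" for i n x
  have u: "square_integrable_section cinner K tau \<mu> (u i n)" if "i < m" for i n
    unfolding u_def[abs_def] using W that by (intro square_integrable_section_indicator s openin_sets_\<mu>) auto
  have um: "measurable_section (u i n)" if "i < m" for i n
    using u[OF that] by (simp add: square_integrable_section_iff)
  note z = equivariant_zero
  have ip0: "ip (T x \<omega>) (section_along (\<lambda>_. 0) x) = 0"
    "ip (T (act_space h x) \<omega>) (act_bundle h (section_along (\<lambda>_. 0) x)) = 0"
    if x: "x \<in> topspace (hom_space K)" and \<omega>: "\<omega> \<in> space P" for x \<omega>
  proof -
    obtain g where g: "x = coset K g" using x by (auto simp: topspace_hom_space)
    show "ip (T x \<omega>) (section_along (\<lambda>_. 0) x) = 0"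
      using pullback_eq[OF random_section \<omega>, of g] by (simp add: g section_along_coset[OF z] fib_inner_orbit)
    show "ip (T (act_space h x) \<omega>) (act_bundle h (section_along (\<lambda>_. 0) x)) = 0"
      using pullback_eq[OF random_section \<omega>, of "h + g"]
      by (simp add: g section_along_coset[OF z] fib_inner_orbit act_space_coset act_bundle_orbit)
  qed
  \<comment> \<open>Off \<open>W i n\<close> both products vanish, so the two components of an
    average are the normalized pairings of the cut-off section and of its translate.\<close>
  have lim: "AE \<omega> in P. \<forall>i<m.
      (\<lambda>n. pairing (u i n) \<omega> / measure \<mu> (W i n)) \<longlonglongrightarrow> cnj (Y (\<eta> i) \<omega>) \<and>
      (\<lambda>n. pairing (act_section h (u i n)) \<omega> / measure \<mu> (W i n)) \<longlonglongrightarrow> cnj (Y (act_bundle h (\<eta> i)) \<omega>)"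
    using Fc AE_space
  proof eventually_elim
    case (elim \<omega>)
    show ?case
    proof (intro allI impI)
      fix i assume i: "i < m"
      have c: "continuous_map (hom_space K) euclidean (\<lambda>x. F i x \<omega>)" using elim i by blast
      have int: "integrable \<mu> (\<lambda>x. indicator (W i n) x *\<^sub>R F i x \<omega>)" for n
        using continuous_integrable[OF c] W i by (intro integrable_mult_indicator openin_sets_\<mu>) auto
      have conv: "(\<lambda>n. (LINT x|\<mu>. indicator (W i n) x *\<^sub>R F i x \<omega>) /\<^sub>R measure \<mu> (W i n)) \<longlonglongrightarrow> F i (coset K (g i)) \<omega>"
        using W i elim(2) c by blast
      have "fst (LINT x|\<mu>. indicator (W i n) x *\<^sub>R F i x \<omega>) = pairing (u i n) \<omega>" for n
      proof -
        have "fst (LINT x|\<mu>. indicator (W i n) x *\<^sub>R F i x \<omega>) = (LINT x|\<mu>. fst (indicator (W i n) x *\<^sub>R F i x \<omega>))"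
          using integral_fst[OF int] by simp
        also have "\<dots> = pairing (u i n) \<omega>"
          unfolding section_pairing_def using elim(2)
          by (intro Bochner_Integration.integral_cong) (simp_all add: u_def F_def ip0)
        finally show ?thesis .
      qed
      moreover have "snd (LINT x|\<mu>. indicator (W i n) x *\<^sub>R F i x \<omega>) = pairing (act_section h (u i n)) \<omega>" for n
      proof -
        have "snd (LINT x|\<mu>. indicator (W i n) x *\<^sub>R F i x \<omega>) = (LINT x|\<mu>. snd (indicator (W i n) x *\<^sub>R F i x \<omega>))"
          using integral_snd[OF int] by simp
        also have "\<dots> = pairing (act_section h (u i n)) \<omega>"
          unfolding pairing_act[OF um[OF i] elim(2)] using elim(2)
          by (intro Bochner_Integration.integral_cong) (simp_all add: u_def F_def ip0)
        finally show ?thesis .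
      qed
      moreover have "fst (F i (coset K (g i)) \<omega>) = cnj (Y (\<eta> i) \<omega>)"
        using Y_eq[OF \<eta>[OF i] elim(2)]
        by (simp add: F_def \<eta>s[OF i] bundle_proj_orbit section_along_coset[OF s[OF i]])
      moreover have "snd (F i (coset K (g i)) \<omega>) = cnj (Y (act_bundle h (\<eta> i)) \<omega>)"
        using Y_eq[OF act_bundle_in[OF \<eta>[OF i], of h] elim(2)]
        by (simp add: F_def \<eta>s[OF i] bundle_proj_orbit bundle_proj_act section_along_coset[OF s[OF i]])
      ultimately show "(\<lambda>n. pairing (u i n) \<omega> / measure \<mu> (W i n)) \<longlonglongrightarrow> cnj (Y (\<eta> i) \<omega>) \<and>
          (\<lambda>n. pairing (act_section h (u i n)) \<omega> / measure \<mu> (W i n)) \<longlonglongrightarrow> cnj (Y (act_bundle h (\<eta> i)) \<omega>)"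
        using tendsto_fst[OF conv] tendsto_snd[OF conv]
        by (simp add: scaleR_conv_of_real divide_inverse mult.commute)
    qed
  qed
  have pm [measurable]: "pairing (u i n) \<in> borel_measurable P" "pairing (act_section h (u i n)) \<in> borel_measurable P" if "i < m" for i n
    using um[OF that] by (simp_all add: pairing_measurable measurable_section_act)
  have Ym: "Y (\<eta> i) \<in> borel_measurable P" "Y (act_bundle h (\<eta> i)) \<in> borel_measurable P" if "i < m" for i
    using \<eta>[OF that] by (simp_all add: Y_measurable)
  \<comment> \<open>Almost sure convergence is enough here, since the exponentials have modulus
    1.\<close>
  have dom: "(\<lambda>n. LINT \<omega>|P. iexp (Re (\<Sum>i<m. c i * (Z i n \<omega> / r i n)))) \<longlonglongrightarrow> (LINT \<omega>|P. iexp (Re (\<Sum>i<m. c i * cnj (L i \<omega>))))"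
    if Z: "\<And>i n. i < m \<Longrightarrow> Z i n \<in> borel_measurable P" and L: "\<And>i. i < m \<Longrightarrow> L i \<in> borel_measurable P"
      and ae: "AE \<omega> in P. \<forall>i<m. (\<lambda>n. Z i n \<omega> / complex_of_real (r i n)) \<longlonglongrightarrow> cnj (L i \<omega>)"
    for Z :: "nat \<Rightarrow> nat \<Rightarrow> 'w \<Rightarrow> complex" and L and r :: "nat \<Rightarrow> nat \<Rightarrow> real" and c
  proof (rule integral_dominated_convergence[where w = "\<lambda>_. 1"])
    have cm: "cnj \<in> borel_measurable borel"
      by (intro borel_measurable_continuous_onI continuous_intros)
    have [measurable]: "(\<lambda>\<omega>. Re (\<Sum>i<m. c i * cnj (L i \<omega>))) \<in> borel_measurable P"
      using measurable_compose[OF L cm]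
      by (intro measurable_compose[OF _ borel_measurable_Re] borel_measurable_sum borel_measurable_times borel_measurable_const) simp
    show "(\<lambda>\<omega>. iexp (Re (\<Sum>i<m. c i * cnj (L i \<omega>)))) \<in> borel_measurable P" by measurable
    have [measurable]: "(\<lambda>\<omega>. Re (\<Sum>i<m. c i * (Z i n \<omega> / r i n))) \<in> borel_measurable P" for n
      using Z by (intro measurable_compose[OF _ borel_measurable_Re] borel_measurable_sum borel_measurable_times borel_measurable_divide borel_measurable_const) simp
    show "(\<lambda>\<omega>. iexp (Re (\<Sum>i<m. c i * (Z i n \<omega> / r i n)))) \<in> borel_measurable P" for n by measurable
    show "AE \<omega> in P. (\<lambda>n. iexp (Re (\<Sum>i<m. c i * (Z i n \<omega> / r i n)))) \<longlonglongrightarrow> iexp (Re (\<Sum>i<m. c i * cnj (L i \<omega>)))"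
      using ae by eventually_elim (intro tendsto_intros; simp)
    show "AE \<omega> in P. norm (iexp (Re (\<Sum>i<m. c i * (Z i n \<omega> / r i n)))) \<le> 1" for n
      by (simp only: norm_exp_i_times) simp
  qed simp
  show "joint_law P m (\<lambda>i. Y (\<eta> i)) = joint_law P m (\<lambda>i. Y (act_bundle h (\<eta> i)))"
  proof (rule joint_law_eq_iff_char[THEN iffD2, OF P.prob_space_axioms Ym], assumption, assumption, rule allI)
    fix c :: "nat \<Rightarrow> complex"
    \<comment> \<open>Normalization only rescales the coefficients, so isotropy applies to the
      normalized pairings. The conjugated coefficients match the conjugates in the limit, and both
      disappear under the real part.\<close>
    have eq: "(LINT \<omega>|P. iexp (Re (\<Sum>i<m. cnj (c i) * (pairing (u i n) \<omega> / measure \<mu> (W i n))))) =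
        (LINT \<omega>|P. iexp (Re (\<Sum>i<m. cnj (c i) * (pairing (act_section h (u i n)) \<omega> / measure \<mu> (W i n)))))" for n
    proof -
      have "joint_law P m (\<lambda>i. pairing (u i n)) = joint_law P m (\<lambda>i. pairing (act_section h (u i n)))"
        using iso u by (simp add: isotropic_def)
      then have "(LINT \<omega>|P. iexp (Re (\<Sum>i<m. c i * pairing (u i n) \<omega>))) =
          (LINT \<omega>|P. iexp (Re (\<Sum>i<m. c i * pairing (act_section h (u i n)) \<omega>)))" for c
        using joint_law_eq_iff_char[OF P.prob_space_axioms, of m "\<lambda>i. pairing (u i n)" "\<lambda>i. pairing (act_section h (u i n))"] pm by blast
      from this[of "\<lambda>i. cnj (c i) / measure \<mu> (W i n)"] show ?thesis
        by (simp only: times_divide_eq_left times_divide_eq_right)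
    qed
    have "(\<lambda>n. LINT \<omega>|P. iexp (Re (\<Sum>i<m. cnj (c i) * (pairing (u i n) \<omega> / measure \<mu> (W i n)))))
        \<longlonglongrightarrow> (LINT \<omega>|P. iexp (Re (\<Sum>i<m. cnj (c i) * cnj (Y (\<eta> i) \<omega>))))"
      by (rule dom[OF pm(1) Ym(1)], assumption, assumption) (use lim in \<open>auto elim: eventually_mono\<close>)
    moreover have "(\<lambda>n. LINT \<omega>|P. iexp (Re (\<Sum>i<m. cnj (c i) * (pairing (u i n) \<omega> / measure \<mu> (W i n)))))
        \<longlonglongrightarrow> (LINT \<omega>|P. iexp (Re (\<Sum>i<m. cnj (c i) * cnj (Y (act_bundle h (\<eta> i)) \<omega>))))"
      unfolding eq
      by (rule dom[OF pm(2) Ym(2)], assumption, assumption) (use lim in \<open>auto elim: eventually_mono\<close>)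
    ultimately have "(LINT \<omega>|P. iexp (Re (\<Sum>i<m. cnj (c i) * cnj (Y (\<eta> i) \<omega>)))) =
        (LINT \<omega>|P. iexp (Re (\<Sum>i<m. cnj (c i) * cnj (Y (act_bundle h (\<eta> i)) \<omega>))))"
      by (rule LIMSEQ_unique)
    then show "(LINT \<omega>|P. iexp (Re (\<Sum>i<m. c i * Y (\<eta> i) \<omega>))) = (LINT \<omega>|P. iexp (Re (\<Sum>i<m. c i * Y (act_bundle h (\<eta> i)) \<omega>)))"
      by (simp only: complex_cnj_mult[symmetric] cnj_sum[symmetric] cnj.sel)
  qed
qed

end

section \<open>Mean square continuity\<close>

lemma tendsto_zero_atin_iff:
  fixes f :: "'i \<Rightarrow> real"
  assumes "a \<in> topspace I" "f a = 0" "\<And>b. 0 \<le> f b"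
  shows "(f \<longlongrightarrow> 0) (atin I a) \<longleftrightarrow> (\<forall>e>0. \<exists>U. openin I U \<and> a \<in> U \<and> (\<forall>b\<in>U. f b < e))"
proof -
  \<comment> \<open>The filter excludes the point \<open>a\<close>; as \<open>f a = 0\<close>,
    including it changes nothing.\<close>
  have "(\<forall>b\<in>U - {a}. f b < e) \<longleftrightarrow> (\<forall>b\<in>U. f b < e)" if "e > 0" for U e
    using that assms(2) by auto
  then show ?thesis
    using assms(1,3) by (simp add: tendsto_iff eventually_atin dist_real_def)
qed

context random_bundle_section
begin

abbreviation X where "X \<equiv> pullback K tau T"

lemma Y_orbit:
  assumes "\<omega> \<in> space P"
  shows "Y (orbit K tau g z) \<omega> = cinner z (X g \<omega>)"
  using pullback_eq[OF random_section assms, of g]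
  by (simp add: scalar_field_def bundle_proj_orbit fib_inner_orbit)

lemma X_inner_eq:
  assumes "\<omega> \<in> space P"
  shows "X g \<omega> \<bullet> b = Re (Y (orbit K tau g b) \<omega>)"
  by (simp add: Y_orbit[OF assms] Re_cinner inner_commute)

lemma X_measurable: "X g \<in> borel_measurable P"
proof (rule borel_measurable_euclidean_space[THEN iffD2], rule ballI)
  fix b :: 'h
  have "(\<lambda>\<omega>. Re (Y (orbit K tau g b) \<omega>)) \<in> borel_measurable P"
    by (intro measurable_compose[OF _ borel_measurable_Re] Y_measurable) simp
  then show "(\<lambda>\<omega>. X g \<omega> \<bullet> b) \<in> borel_measurable P"
    by (simp add: X_inner_eq cong: measurable_cong)
qed

lemma mean_square_continuous_scalar_field:
  assumes X: "mean_square_continuous euclidean P X"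
  shows "mean_square_continuous (total_space K tau) P Y"
proof -
  have L2: "integrable P (\<lambda>\<omega>. (norm (X g \<omega>))\<^sup>2)" for g
    using X by (simp add: mean_square_continuous_def in_L2_def)
  define q where "q g0 g = (\<integral>\<omega>. (norm (X g \<omega> - X g0 \<omega>))\<^sup>2 \<partial>P)" for g0 g
  note [measurable] = X_measurable
  have sq: "(norm (v + w))\<^sup>2 \<le> 2 * (norm v)\<^sup>2 + 2 * (norm w)\<^sup>2" for v w :: 'h
  proof -
    have "(norm (v + w))\<^sup>2 \<le> (norm v + norm w)\<^sup>2"
      by (intro power_mono norm_triangle_ineq norm_ge_zero)
    also have "\<dots> \<le> 2 * (norm v)\<^sup>2 + 2 * (norm w)\<^sup>2"
      using sum_squares_bound[of "norm v" "norm w"] by (simp add: power2_sum)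
    finally show ?thesis .
  qed
  have L2d: "integrable P (\<lambda>\<omega>. (norm (X g \<omega> - X g0 \<omega>))\<^sup>2)" for g g0
  proof (rule Bochner_Integration.integrable_bound)
    show "integrable P (\<lambda>\<omega>. 2 * (norm (X g \<omega>))\<^sup>2 + 2 * (norm (X g0 \<omega>))\<^sup>2)"
      using L2 by simp
    show "AE \<omega> in P. norm ((norm (X g \<omega> - X g0 \<omega>))\<^sup>2) \<le> norm (2 * (norm (X g \<omega>))\<^sup>2 + 2 * (norm (X g0 \<omega>))\<^sup>2)"
      using sq[of "X g \<omega>" "- X g0 \<omega>" for \<omega>] by (intro AE_I2) simp
  qed measurable
  have q0: "q g0 g0 = 0" "0 \<le> q g0 g" for g0 g
    by (simp_all add: q_def)
  have "(q g0 \<longlongrightarrow> 0) (nhds g0)" for g0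
  proof (rule tendstoI)
    fix e :: real assume "e > 0"
    have "(q g0 \<longlongrightarrow> 0) (atin euclidean g0)"
      using X by (simp add: mean_square_continuous_def q_def[abs_def])
    then obtain U where "open U" "g0 \<in> U" "\<And>g. g \<in> U \<Longrightarrow> q g0 g < e"
      using \<open>e > 0\<close> tendsto_zero_atin_iff[of g0 euclidean "q g0"] q0 by auto
    then show "\<forall>\<^sub>F g in nhds g0. dist (q g0 g) 0 < e"
      using q0(2) by (auto simp: eventually_nhds)
  qed
  note q = this
  have L2Y: "integrable P (\<lambda>\<omega>. (norm (Y (orbit K tau g z) \<omega>))\<^sup>2)" for g z
  proof (rule Bochner_Integration.integrable_bound)
    show "integrable P (\<lambda>\<omega>. (norm z)\<^sup>2 * (norm (X g \<omega>))\<^sup>2)"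
      using L2 by simp
    have [measurable]: "Y (orbit K tau g z) \<in> borel_measurable P" by (simp add: Y_measurable)
    show "(\<lambda>\<omega>. (norm (Y (orbit K tau g z) \<omega>))\<^sup>2) \<in> borel_measurable P" by measurable
    show "AE \<omega> in P. norm ((norm (Y (orbit K tau g z) \<omega>))\<^sup>2) \<le> norm ((norm z)\<^sup>2 * (norm (X g \<omega>))\<^sup>2)"
      using norm_cinner_le by (intro AE_I2) (simp add: Y_orbit power_mult_distrib[symmetric] power_mono)
  qed
  show ?thesis
    unfolding mean_square_continuous_def
  proof (intro conjI ballI)
    fix \<eta> assume "\<eta> \<in> topspace (total_space K tau)"
    then obtain g0 z0 where \<eta>: "\<eta> = orbit K tau g0 z0" by (auto simp: topspace_total_space)
    show "in_L2 P (Y \<eta>)"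
      using L2Y by (simp add: \<eta> in_L2_def Y_measurable)
    \<comment> \<open>The bound belongs to the splitting \<open>cinner (z - z0) (X g \<omega>) +
      cinner z0 (X g \<omega> - X g0 \<omega>)\<close>. Only increments are controlled, so the
      second moment of \<open>X g\<close> is estimated through \<open>X g0\<close>, which gives the
      inner bracket.\<close>
    define B where "B p = 2 * (norm (snd p - z0))\<^sup>2 * (2 * q g0 (fst p) + 2 * (\<integral>\<omega>. (norm (X g0 \<omega>))\<^sup>2 \<partial>P))
        + 2 * (norm z0)\<^sup>2 * q g0 (fst p)" for p
    have "filterlim fst (nhds g0) (nhds (g0, z0))" "filterlim snd (nhds z0) (nhds (g0, z0))"
      using tendsto_fst[OF filterlim_ident[of "nhds (g0, z0)"]] tendsto_snd[OF filterlim_ident[of "nhds (g0, z0)"]] by simp_all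
    note fs = filterlim_compose[OF q this(1)] this(2)
    have "(B \<longlongrightarrow> 2 * (norm (z0 - z0))\<^sup>2 * (2 * 0 + 2 * (\<integral>\<omega>. (norm (X g0 \<omega>))\<^sup>2 \<partial>P)) + 2 * (norm z0)\<^sup>2 * 0) (nhds (g0, z0))"
      unfolding B_def[abs_def] by (intro tendsto_intros fs)
    then have B: "(B \<longlongrightarrow> 0) (nhds (g0, z0))" by simp
    have le: "(\<integral>\<omega>. (norm (Y (orbit K tau g z) \<omega> - Y \<eta> \<omega>))\<^sup>2 \<partial>P) \<le> B (g, z)" for g z
    proof -
      have "(\<integral>\<omega>. (norm (Y (orbit K tau g z) \<omega> - Y \<eta> \<omega>))\<^sup>2 \<partial>P)
          \<le> (\<integral>\<omega>. 2 * (norm (z - z0))\<^sup>2 * (2 * (norm (X g \<omega> - X g0 \<omega>))\<^sup>2 + 2 * (norm (X g0 \<omega>))\<^sup>2)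
            + 2 * (norm z0)\<^sup>2 * (norm (X g \<omega> - X g0 \<omega>))\<^sup>2 \<partial>P)"
      proof (rule integral_mono')
        show "integrable P (\<lambda>\<omega>. 2 * (norm (z - z0))\<^sup>2 * (2 * (norm (X g \<omega> - X g0 \<omega>))\<^sup>2 + 2 * (norm (X g0 \<omega>))\<^sup>2)
            + 2 * (norm z0)\<^sup>2 * (norm (X g \<omega> - X g0 \<omega>))\<^sup>2)"
          by (intro Bochner_Integration.integrable_add Bochner_Integration.integrable_mult_right L2 L2d)
        fix \<omega> assume \<omega>: "\<omega> \<in> space P"
        have "Y (orbit K tau g z) \<omega> - Y \<eta> \<omega> = cinner (z - z0) (X g \<omega>) + cinner z0 (X g \<omega> - X g0 \<omega>)"
          using \<omega> by (simp add: \<eta> Y_orbit cinner_diff_left cinner_diff_right)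
        then have "norm (Y (orbit K tau g z) \<omega> - Y \<eta> \<omega>) \<le> norm (z - z0) * norm (X g \<omega>) + norm z0 * norm (X g \<omega> - X g0 \<omega>)"
          using norm_triangle_mono[OF norm_cinner_le norm_cinner_le] by simp
        then have "(norm (Y (orbit K tau g z) \<omega> - Y \<eta> \<omega>))\<^sup>2 \<le> (norm (z - z0) * norm (X g \<omega>) + norm z0 * norm (X g \<omega> - X g0 \<omega>))\<^sup>2"
          by (rule power_mono) simp
        also have "\<dots> \<le> 2 * (norm (z - z0))\<^sup>2 * (norm (X g \<omega>))\<^sup>2 + 2 * (norm z0)\<^sup>2 * (norm (X g \<omega> - X g0 \<omega>))\<^sup>2"
          using sum_squares_bound[of "norm (z - z0) * norm (X g \<omega>)" "norm z0 * norm (X g \<omega> - X g0 \<omega>)"]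
          by (simp add: power2_sum power_mult_distrib)
        also have "\<dots> \<le> 2 * (norm (z - z0))\<^sup>2 * (2 * (norm (X g \<omega> - X g0 \<omega>))\<^sup>2 + 2 * (norm (X g0 \<omega>))\<^sup>2)
            + 2 * (norm z0)\<^sup>2 * (norm (X g \<omega> - X g0 \<omega>))\<^sup>2"
          using sq[of "X g \<omega> - X g0 \<omega>" "X g0 \<omega>"] by (intro add_right_mono mult_left_mono) simp_all
        finally show "(norm (Y (orbit K tau g z) \<omega> - Y \<eta> \<omega>))\<^sup>2 \<le>
            2 * (norm (z - z0))\<^sup>2 * (2 * (norm (X g \<omega> - X g0 \<omega>))\<^sup>2 + 2 * (norm (X g0 \<omega>))\<^sup>2)
            + 2 * (norm z0)\<^sup>2 * (norm (X g \<omega> - X g0 \<omega>))\<^sup>2" .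
      qed simp
      also have "\<dots> = B (g, z)"
        by (simp add: B_def q_def L2 L2d)
      finally show ?thesis .
    qed
    show "((\<lambda>\<zeta>. \<integral>\<omega>. (norm (Y \<zeta> \<omega> - Y \<eta> \<omega>))\<^sup>2 \<partial>P) \<longlongrightarrow> 0) (atin (total_space K tau) \<eta>)"
    proof (subst tendsto_zero_atin_iff)
      show "\<forall>e>0. \<exists>U. openin (total_space K tau) U \<and> \<eta> \<in> U \<and> (\<forall>\<zeta>\<in>U. (\<integral>\<omega>. (norm (Y \<zeta> \<omega> - Y \<eta> \<omega>))\<^sup>2 \<partial>P) < e)"
      proof (intro allI impI)
        fix e :: real assume "e > 0"
        then have "\<forall>\<^sub>F p in nhds (g0, z0). B p < e"
          by (intro order_tendstoD(2)[OF B])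
        then obtain U where U: "open U" "(g0, z0) \<in> U" "\<And>p. p \<in> U \<Longrightarrow> B p < e"
          by (auto simp: eventually_nhds)
        \<comment> \<open>The orbit map is open, so a bound for representatives near
          \<open>(g0, z0)\<close> holds on a neighbourhood of \<open>\<eta>\<close>.\<close>
        let ?U = "(\<lambda>(g, z). orbit K tau g z) ` U"
        have "(\<integral>\<omega>. (norm (Y \<zeta> \<omega> - Y \<eta> \<omega>))\<^sup>2 \<partial>P) < e" if \<zeta>: "\<zeta> \<in> ?U" for \<zeta>
        proof -
          obtain g z where "(g, z) \<in> U" "\<zeta> = orbit K tau g z" using \<zeta> by auto
          then show ?thesis using le[of g z] U(3)[of "(g, z)"] by simp
        qed
        moreover have "\<eta> \<in> ?U" using U(2) by (auto simp: \<eta>)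
        ultimately show "\<exists>U. openin (total_space K tau) U \<and> \<eta> \<in> U \<and> (\<forall>\<zeta>\<in>U. (\<integral>\<omega>. (norm (Y \<zeta> \<omega> - Y \<eta> \<omega>))\<^sup>2 \<partial>P) < e)"
          using openin_orbit_image[OF U(1)] by blast
      qed
    qed (simp_all add: \<eta>)
  qed
qed

lemma mean_square_continuous_pullback:
  assumes Y: "mean_square_continuous (total_space K tau) P Y"
  shows "mean_square_continuous euclidean P X"
proof -
  have L2Y: "integrable P (\<lambda>\<omega>. (norm (Y (orbit K tau g z) \<omega>))\<^sup>2)" for g z
    using Y by (simp add: mean_square_continuous_def in_L2_def)
  note [measurable] = X_measurable
  have Ym [measurable]: "Y (orbit K tau g z) \<in> borel_measurable P" for g z by (simp add: Y_measurable)
  have L2Yd: "integrable P (\<lambda>\<omega>. (norm (Y (orbit K tau g z) \<omega> - Y (orbit K tau g0 z) \<omega>))\<^sup>2)" for g g0 z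
  proof (rule Bochner_Integration.integrable_bound)
    show "integrable P (\<lambda>\<omega>. 2 * (norm (Y (orbit K tau g z) \<omega>))\<^sup>2 + 2 * (norm (Y (orbit K tau g0 z) \<omega>))\<^sup>2)"
      using L2Y by simp
    have "(norm (v - w))\<^sup>2 \<le> 2 * (norm v)\<^sup>2 + 2 * (norm w)\<^sup>2" for v w :: complex
    proof -
      have "(norm (v - w))\<^sup>2 \<le> (norm v + norm w)\<^sup>2"
        by (intro power_mono norm_triangle_ineq4 norm_ge_zero)
      also have "\<dots> \<le> 2 * (norm v)\<^sup>2 + 2 * (norm w)\<^sup>2"
        using sum_squares_bound[of "norm v" "norm w"] by (simp add: power2_sum)
      finally show ?thesis .
    qed
    then show "AE \<omega> in P. norm ((norm (Y (orbit K tau g z) \<omega> - Y (orbit K tau g0 z) \<omega>))\<^sup>2)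
        \<le> norm (2 * (norm (Y (orbit K tau g z) \<omega>))\<^sup>2 + 2 * (norm (Y (orbit K tau g0 z) \<omega>))\<^sup>2)"
      by (intro AE_I2) simp
  qed measurable
  \<comment> \<open>\<open>X\<close> is recovered from its products with finitely many vectors.
    \<open>Basis\<close> is orthonormal over the reals; the real parts alone account for the left
    side, and the imaginary parts only enlarge the right side.\<close>
  have sum: "(norm v)\<^sup>2 \<le> (\<Sum>b\<in>Basis. (norm (cinner b v))\<^sup>2)" for v
  proof -
    have "(norm v)\<^sup>2 = (\<Sum>b\<in>Basis. (v \<bullet> b)\<^sup>2)"
      unfolding power2_norm_eq_inner by (subst euclidean_inner) (simp add: power2_eq_square)
    also have "\<dots> \<le> (\<Sum>b\<in>Basis. (norm (cinner b v))\<^sup>2)"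
    proof (rule sum_mono)
      fix b
      have "\<bar>v \<bullet> b\<bar> \<le> norm (cinner b v)"
        using abs_Re_le_cmod[of "cinner b v"] by (simp add: Re_cinner inner_commute)
      then have "\<bar>v \<bullet> b\<bar>\<^sup>2 \<le> (norm (cinner b v))\<^sup>2" by (rule power_mono) simp
      then show "(v \<bullet> b)\<^sup>2 \<le> (norm (cinner b v))\<^sup>2" by simp
    qed
    finally show ?thesis .
  qed
  show ?thesis
    unfolding mean_square_continuous_def
  proof (intro conjI ballI)
    fix g0
    have "integrable P (\<lambda>\<omega>. (norm (X g0 \<omega>))\<^sup>2)"
    proof (rule Bochner_Integration.integrable_bound)
      show "integrable P (\<lambda>\<omega>. \<Sum>b\<in>Basis. (norm (Y (orbit K tau g0 b) \<omega>))\<^sup>2)"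
        using L2Y by simp
      show "AE \<omega> in P. norm ((norm (X g0 \<omega>))\<^sup>2) \<le> norm (\<Sum>b\<in>Basis. (norm (Y (orbit K tau g0 b) \<omega>))\<^sup>2)"
      proof (rule AE_I2)
        fix \<omega> assume \<omega>: "\<omega> \<in> space P"
        show "norm ((norm (X g0 \<omega>))\<^sup>2) \<le> norm (\<Sum>b\<in>Basis. (norm (Y (orbit K tau g0 b) \<omega>))\<^sup>2)"
          using sum[of "X g0 \<omega>"] unfolding Y_orbit[OF \<omega>] by simp
      qed
    qed measurable
    then show "in_L2 P (X g0)" by (simp add: in_L2_def X_measurable)
    define D where "D b \<zeta> = (\<integral>\<omega>. (norm (Y \<zeta> \<omega> - Y (orbit K tau g0 b) \<omega>))\<^sup>2 \<partial>P)" for b \<zeta>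
    have D: "((\<lambda>g. D b (orbit K tau g b)) \<longlongrightarrow> 0) (atin euclidean g0)" for b
    proof (subst tendsto_zero_atin_iff)
      show "\<forall>e>0. \<exists>U. openin euclidean U \<and> g0 \<in> U \<and> (\<forall>g\<in>U. D b (orbit K tau g b) < e)"
      proof (intro allI impI)
        fix e :: real assume "e > 0"
        have "(D b \<longlongrightarrow> 0) (atin (total_space K tau) (orbit K tau g0 b))"
          using Y by (simp add: mean_square_continuous_def D_def[abs_def])
        then obtain U where U: "openin (total_space K tau) U" "orbit K tau g0 b \<in> U" "\<forall>\<zeta>\<in>U. D b \<zeta> < e"
          using \<open>e > 0\<close> tendsto_zero_atin_iff[of "orbit K tau g0 b" "total_space K tau" "D b"] by (auto simp: D_def)
        \<comment> \<open>With \<open>b\<close> fixed, the orbit of \<open>(g, b)\<close> depends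
          continuously on \<open>g\<close>, so neighbourhoods in the total space pull back to the
          group.\<close>
        have "open ((\<lambda>(g, z). orbit K tau g z) -` U)"
          using U(1) by (simp add: total_space_def openin_quotient_top)
        then have "open ((\<lambda>g. (g, b)) -` (\<lambda>(g, z). orbit K tau g z) -` U)"
          by (rule open_vimage) (intro continuous_intros)
        then show "\<exists>U. openin euclidean U \<and> g0 \<in> U \<and> (\<forall>g\<in>U. D b (orbit K tau g b) < e)"
          using U(2,3) by (intro exI[of _ "(\<lambda>g. (g, b)) -` (\<lambda>(g, z). orbit K tau g z) -` U"]) auto
      qed
    qed (simp_all add: D_def)
    have lim: "((\<lambda>g. \<Sum>b\<in>Basis. D b (orbit K tau g b)) \<longlongrightarrow> 0) (atin euclidean g0)"
      using tendsto_sum[of Basis, OF D] by simp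
    have le: "norm (\<integral>\<omega>. (norm (X g \<omega> - X g0 \<omega>))\<^sup>2 \<partial>P) \<le> (\<Sum>b\<in>Basis. D b (orbit K tau g b))" for g
    proof -
      have "(\<integral>\<omega>. (norm (X g \<omega> - X g0 \<omega>))\<^sup>2 \<partial>P)
          \<le> (\<integral>\<omega>. (\<Sum>b\<in>Basis. (norm (Y (orbit K tau g b) \<omega> - Y (orbit K tau g0 b) \<omega>))\<^sup>2) \<partial>P)"
      proof (rule integral_mono')
        show "integrable P (\<lambda>\<omega>. \<Sum>b\<in>Basis. (norm (Y (orbit K tau g b) \<omega> - Y (orbit K tau g0 b) \<omega>))\<^sup>2)"
          using L2Yd by simp
        fix \<omega> assume \<omega>: "\<omega> \<in> space P"
        show "(norm (X g \<omega> - X g0 \<omega>))\<^sup>2 \<le> (\<Sum>b\<in>Basis. (norm (Y (orbit K tau g b) \<omega> - Y (orbit K tau g0 b) \<omega>))\<^sup>2)"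
          using sum[of "X g \<omega> - X g0 \<omega>"] unfolding Y_orbit[OF \<omega>] cinner_diff_right .
      qed (simp add: sum_nonneg)
      also have "\<dots> = (\<Sum>b\<in>Basis. D b (orbit K tau g b))"
        unfolding D_def using L2Yd by (intro Bochner_Integration.integral_sum) simp
      finally show ?thesis by simp
    qed
    show "((\<lambda>g. \<integral>\<omega>. (norm (X g \<omega> - X g0 \<omega>))\<^sup>2 \<partial>P) \<longlongrightarrow> 0) (atin euclidean g0)"
      by (rule Lim_null_comparison[OF _ lim], rule always_eventually, rule allI, rule le)
  qed
qed

end

theorem proposition9p1p9:
  fixes K :: "'g::{topological_group_add,t2_space} set"
    and scaleC :: "complex \<Rightarrow> 'h::euclidean_space \<Rightarrow> 'h"
    and cinner :: "'h \<Rightarrow> 'h \<Rightarrow> complex"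
    and tau :: "'g \<Rightarrow> 'h \<Rightarrow> 'h"
    and \<mu> :: "'g set measure"
    and P :: "'w measure"
    and T :: "'g set \<Rightarrow> 'w \<Rightarrow> ('g \<times> 'h) set"
  assumes "compact (UNIV :: 'g set)"
    and "irreducible_unitary_rep scaleC cinner K tau"
    and "invariant_probability K \<mu>"
    and "prob_space P"
    and "random_section K tau P T"
    and "square_integrable_random cinner K tau \<mu> P T"
  shows "(mean_square_continuous euclidean P (pullback K tau T) \<longleftrightarrow>
            mean_square_continuous (total_space K tau) P (scalar_field cinner K tau T)) \<and>
         (as_continuous K tau P T \<longrightarrow>
            (isotropic cinner K tau \<mu> P T \<longleftrightarrow> G_invariant K tau P (scalar_field cinner K tau T)))"
proof -
  interpret irreducible_unitary_rep scaleC cinner K tau by fact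
  interpret prob_space P by fact
  interpret random_bundle_section scaleC cinner K tau \<mu> P T
    by unfold_locales fact+
  show ?thesis
    using mean_square_continuous_scalar_field mean_square_continuous_pullback
      isotropic_if_G_invariant G_invariant_if_isotropic by blast
qed

end
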